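(* Let $K\subset\hat{\mathbb{C}}$ be a compactum and let $f:\hat{\mathbb{C}}\rightarrow\hat{\mathbb{C}}$ be a rational function. Then $f(d)\in\mathcal{D}_K^{PS}$ for each $d\in \mathcal{D}_{f^{-1}(K)}^{PS}$. Consequently, $f^{-1}\left(\mathcal{D}_K^{PS}\right)=\mathcal{D}_{f^{-1}(K)}^{PS}$, where $f^{-1}\left(\mathcal{D}_K^{PS}\right)$ denotes the collection of all components of $f^{-1}(d)$ as $d$ runs through $\mathcal{D}_K^{PS}$.
   Context: A compactum is a compact metric space. A Peano space is a compactum having at most countably many non-degenerate components, each of which is locally connected, such that for every $C>0$ at most finitely many of them have diameter greater than $C$. A monotone decomposition of a compactum $K$ is an (upper semicontinuous) partition of $K$ into subcontinua, regarded as a hyperspace with the quotient topology. For a compactum $K\subset\hat{\mathbb{C}}$ it is known that among all monotone decompositions of $K$ whose hyperspace is a Peano space there is a unique one that is finer than all the others; it is denoted $\mathcal{D}_K^{PS}$ and called the core decomposition of $K$ with Peano hyperspace.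
   Formalization: The rational function f is assumed non-constant; for a constant f with value in K the claimed equality fails (e.g. K the whole sphere: singletons on one side, the whole sphere on the other). *)

theory Defs
  imports "HOL-Analysis.Analysis" "HOL-Computational_Algebra.Polynomial"
begin

definition rsphere :: "(complex \<times> real) set" where
  "rsphere = {(z, t). (cmod z)\<^sup>2 + t\<^sup>2 = 1}"

definition north :: "complex \<times> real" where
  "north = (0, 1)"

definition stereo :: "complex \<Rightarrow> complex \<times> real" where
  "stereo w = (of_real (2 / (1 + (cmod w)\<^sup>2)) * w, ((cmod w)\<^sup>2 - 1) / ((cmod w)\<^sup>2 + 1))"

definition unstereo :: "complex \<times> real \<Rightarrow> complex" where
  "unstereo x = fst x / of_real (1 - snd x)"

definition rat_map :: "complex poly \<Rightarrow> complex poly \<Rightarrow> complex \<times> real \<Rightarrow> complex \<times> real" where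
  "rat_map p q x =
     (if x = north then
        (if degree p > degree q then north
         else if degree p < degree q then stereo 0
         else stereo (lead_coeff p / lead_coeff q))
      else (let w = unstereo x in
            if poly q w = 0 then north else stereo (poly p w / poly q w)))"

definition rational_map :: "(complex \<times> real \<Rightarrow> complex \<times> real) \<Rightarrow> bool" where
  "rational_map f \<longleftrightarrow> (\<exists>p q. q \<noteq> 0 \<and> coprime p q \<and> (degree p \<ge> 1 \<or> degree q \<ge> 1) \<and>
                         (\<forall>x\<in>rsphere. f x = rat_map p q x))"

definition mdiam :: "'a metric \<Rightarrow> 'a set \<Rightarrow> real" where
  "mdiam m S = Sup {mdist m x y | x y. x \<in> S \<and> y \<in> S}"

definition peano_space :: "'a topology \<Rightarrow> bool" where
  "peano_space X \<longleftrightarrow> compact_space X \<and>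
     (\<exists>m. mtopology_of m = X \<and>
        (let N = {P \<in> connected_components_of X. \<not> (\<exists>x. P = {x})} in
           countable N \<and>
           (\<forall>P\<in>N. locally_connected_space (subtopology X P)) \<and>
           (\<forall>C>0. finite {P \<in> N. mdiam m P > C})))"

definition usc_decomp :: "'a::topological_space set \<Rightarrow> 'a set set \<Rightarrow> bool" where
  "usc_decomp K D \<longleftrightarrow>
     (\<forall>d\<in>D. \<forall>U. openin (top_of_set K) U \<and> d \<subseteq> U \<longrightarrow>
                  openin (top_of_set K) (\<Union>{e \<in> D. e \<subseteq> U}))"

definition monotone_decomp :: "'a::topological_space set \<Rightarrow> 'a set set \<Rightarrow> bool" where
  "monotone_decomp K D \<longleftrightarrow>
     \<Union>D = K \<and> (\<forall>d\<in>D. d \<noteq> {} \<and> compact d \<and> connected d) \<and>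
     pairwise disjnt D \<and> usc_decomp K D"

definition hyperspace :: "'a::topological_space set \<Rightarrow> 'a set set \<Rightarrow> 'a set topology" where
  "hyperspace K D = topology (\<lambda>\<U>. \<U> \<subseteq> D \<and> openin (top_of_set K) (\<Union>\<U>))"

definition finer :: "'a set set \<Rightarrow> 'a set set \<Rightarrow> bool" where
  "finer D D' \<longleftrightarrow> (\<forall>d\<in>D. \<exists>d'\<in>D'. d \<subseteq> d')"

definition core_decomp_PS :: "'a::topological_space set \<Rightarrow> 'a set set \<Rightarrow> bool" where
  "core_decomp_PS K D \<longleftrightarrow>
     monotone_decomp K D \<and> peano_space (hyperspace K D) \<and>
     (\<forall>D'. monotone_decomp K D' \<and> peano_space (hyperspace K D') \<longrightarrow> finer D D')"

end

theory Submission
  imports Defs "HOL-Complex_Analysis.Complex_Analysis"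
begin

text \<open>A monotone decomposition has a Peano hyperspace iff it satisfies a local criterion: inside
  each neighbourhood \<open>U\<close> of a class \<open>d\<close> there is a smaller one all of whose points \<open>y\<close> are joined
  to \<open>d\<close> by a continuum in \<open>U\<close> or have their whole component in \<open>U\<close>. Since \<open>f\<close> is open with
  finite fibres, the criterion lifts from the core decomposition of \<open>K\<close> to the components of the
  preimages of its classes, so the core decomposition of \<open>f\<^sup>-\<^sup>1(K)\<close> refines these.

  For the converse, relate two points of \<open>K\<close> if their fibres meet the same classes of the core
  decomposition of \<open>f\<^sup>-\<^sup>1(K)\<close>; the components of the classes of this closed relation form a monotone
  decomposition of \<open>K\<close>. Were the criterion to fail for it, continua in \<open>K\<close> would converge to a
  continuum not contained in one class, and their lifts would converge to a continuum meeting
  infinitely many classes of the core decomposition of \<open>f\<^sup>-\<^sup>1(K)\<close>. By the criterion upstairs, three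
  disjoint arms would then join this continuum to one and the same connected open set, while staying
  close to a lift disjoint from them: a copy of \<open>K\<^bsub>3,3\<^esub>\<close> in the sphere, which Janiszewski's
  theorem excludes.

  Hence the core decomposition of \<open>K\<close> refines the one by fibres: for \<open>d\<close> in it, all fibres over
  \<open>d\<close> meet the same classes upstairs. So these classes map onto \<open>d\<close>, and as a fibre is finite, each
  component of \<open>f\<^sup>-\<^sup>1(d)\<close> is a finite disjoint union of classes, hence a single one.\<close>

subsection \<open>Janiszewski's theorem and \<open>K\<^bsub>3,3\<^esub>\<close>\<close>

text \<open>The hyperspace is awkward to handle directly: its metric is only known to exist, and
  whether \<open>f\<close> maps classes to classes is the very question. Stated through
  neighbourhoods and continua inside \<open>K\<close>, the Peano property can be moved along
  \<open>f\<close> in both directions by openness and compactness. Going down, a sequence of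
  continua in \<open>K\<close> has several sequences of lifts, and none need come close to a whole
  lift of the limit. The bound \<open>N\<close> on the fibres repairs this: of more than
  \<open>m * N\<close> points in the lift of the limit, more than \<open>m\<close> are approached by
  one sequence of lifts. Hence a limit meeting two classes is not enough and infinitely many are
  wanted; they come from the fact that a continuum covered by finitely many disjoint closed sets
  lies in one of them. The number \<open>m\<close> reflects the pigeonhole principle: with
  \<open>w\<close> connected open sets at the far ends, more than \<open>2 * w\<close> arms force
  three to share one. In the graph, the limit's lift, the open set and a nearby lift are the three
  vertices on one side; the three arms are the vertices on the other.\<close>

lemma outside_Un_Janiszewski:
  fixes S T :: "complex set"
  assumes "compact S" "compact T" "connected (S \<inter> T)"
  shows "outside (S \<union> T) = outside S \<inter> outside T"
proof
  show "outside (S \<union> T) \<subseteq> outside S \<inter> outside T"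
    by (simp add: outside_mono)
  have bd: "bounded (S \<union> T)" using assms by (simp add: compact_imp_bounded)
  show "outside S \<inter> outside T \<subseteq> outside (S \<union> T)"
  proof
    fix x assume x: "x \<in> outside S \<inter> outside T"
    have "\<not> bounded (outside (S \<union> T))"
      using unbounded_outside[OF bd] by simp
    then obtain p where p: "p \<in> outside (S \<union> T)" by (metis bounded_empty ex_in_conv)
    then have pST: "p \<in> outside S" "p \<in> outside T" by (meson outside_mono subsetD sup_ge1 sup_ge2)+
    have *: "connected_component (- X) x p"
      if "compact X" "x \<in> outside X" "p \<in> outside X" for X :: "complex set"
      unfolding connected_component_def
    proof (intro exI conjI)
      show "connected (outside X)" using that(1) by (simp add: connected_outside compact_imp_bounded)
      show "outside X \<subseteq> - X" using outside_no_overlap by blast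
    qed (use that in auto)
    have 1: "connected_component (- S) x p" and 2: "connected_component (- T) x p"
      using * x pST assms by blast+
    have "connected_component (- (S \<union> T)) x p"
      using Janiszewski[OF assms(1) compact_imp_closed[OF assms(2)] assms(3) 1 2] .
    then show "x \<in> outside (S \<union> T)"
      using p by (metis connected_component_sym outside_same_component)
  qed
qed

text \<open>The hypotheses say that \<open>N\<close>, \<open>W\<close> and the point at infinity are all joined to
  each of three disjoint connected sets, as in a planar embedding of \<open>K\<^bsub>3,3\<^esub>\<close>.\<close>

lemma no_plane_theta:
  fixes N W A1 A2 A3 :: "complex set"
  assumes N: "compact N" "connected N" and W: "compact W" "connected W" and NW: "N \<inter> W = {}"
    and A: "connected A1" "connected A2" "connected A3"
    and cA: "compact (N \<union> W \<union> A1)" "compact (N \<union> W \<union> A2)" "compact (N \<union> W \<union> A3)"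
    and dis: "A1 \<inter> (N \<union> W) = {}" "A2 \<inter> (N \<union> W) = {}" "A3 \<inter> (N \<union> W) = {}"
             "A1 \<inter> A2 = {}" "A1 \<inter> A3 = {}" "A2 \<inter> A3 = {}"
    and meetN: "closure A1 \<inter> N \<noteq> {}" "closure A2 \<inter> N \<noteq> {}" "closure A3 \<inter> N \<noteq> {}"
    and meetW: "closure A1 \<inter> W \<noteq> {}" "closure A2 \<inter> W \<noteq> {}" "closure A3 \<inter> W \<noteq> {}"
    and out: "A1 \<subseteq> outside (N \<union> W \<union> A2 \<union> A3)" "A2 \<subseteq> outside (N \<union> W \<union> A1 \<union> A3)"
             "A3 \<subseteq> outside (N \<union> W \<union> A1 \<union> A2)"
  shows False
proof -
  have conY: "connected (N \<union> W \<union> A)"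
    if "connected A" "closure A \<inter> N \<noteq> {}" "closure A \<inter> W \<noteq> {}" "compact (N \<union> W \<union> A)" for A
  proof -
    have "closure A \<subseteq> N \<union> W \<union> A"
      using that(4) by (meson closure_minimal compact_imp_closed sup_ge2)
    then have "N \<union> W \<union> A = (closure A \<union> N) \<union> W" using closure_subset by blast
    moreover have "connected (closure A \<union> N)"
      by (rule connected_Un) (use that N in \<open>auto simp: connected_imp_connected_closure\<close>)
    then have "connected ((closure A \<union> N) \<union> W)"
      by (rule connected_Un) (use that W in auto)
    ultimately show ?thesis by simp
  qed
  have con: "connected (N \<union> W \<union> A1)" "connected (N \<union> W \<union> A3)"
    by (rule conY[OF A(1) meetN(1) meetW(1) cA(1)], rule conY[OF A(3) meetN(3) meetW(3) cA(3)])
  \<comment> \<open>\<open>G1\<close>, \<open>G2\<close>, \<open>G3\<close> are the outer domains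
    with one arm left out, \<open>F\<close> the one with all three arms. Two of the compacta overlap
    in \<open>N\<close>, \<open>W\<close> and one arm, a connected set, so by Janiszewski's theorem
    \<open>F\<close> is the intersection of the corresponding domains.\<close>
  define G1 where "G1 = outside (N \<union> W \<union> A2 \<union> A3)"
  define G2 where "G2 = outside (N \<union> W \<union> A1 \<union> A3)"
  define G3 where "G3 = outside (N \<union> W \<union> A1 \<union> A2)"
  define F where "F = outside (N \<union> W \<union> A1 \<union> A2 \<union> A3)"
  have c: "compact (N \<union> W \<union> A \<union> B)" if "compact (N \<union> W \<union> A)" "compact (N \<union> W \<union> B)" for A B
    using compact_Un[OF that] by (simp add: Un_ac)
  have cX: "compact (N \<union> W \<union> A2 \<union> A3)" "compact (N \<union> W \<union> A1 \<union> A3)" "compact (N \<union> W \<union> A1 \<union> A2)"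
    using c[OF cA(2,3)] c[OF cA(1,3)] c[OF cA(1,2)] by this
  have cT: "compact (N \<union> W \<union> A1 \<union> A2 \<union> A3)"
    using compact_Un[OF cX(3) cA(3)] by (simp add: Un_ac)
  have i23: "(N \<union> W \<union> A1 \<union> A3) \<inter> (N \<union> W \<union> A1 \<union> A2) = N \<union> W \<union> A1"
    and u23: "(N \<union> W \<union> A1 \<union> A3) \<union> (N \<union> W \<union> A1 \<union> A2) = N \<union> W \<union> A1 \<union> A2 \<union> A3"
    and i12: "(N \<union> W \<union> A2 \<union> A3) \<inter> (N \<union> W \<union> A1 \<union> A3) = N \<union> W \<union> A3"
    and u12: "(N \<union> W \<union> A2 \<union> A3) \<union> (N \<union> W \<union> A1 \<union> A3) = N \<union> W \<union> A1 \<union> A2 \<union> A3"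
    using dis by blast+
  have F23: "F = G2 \<inter> G3"
    using outside_Un_Janiszewski[OF cX(2,3)] con(1) unfolding i23 u23 F_def G2_def G3_def by simp
  have F12: "F = G1 \<inter> G2"
    using outside_Un_Janiszewski[OF cX(1,2)] con(2) unfolding i12 u12 F_def G1_def G2_def by simp
  have op: "open G1" "open G2" "open G3" "open F"
    unfolding G1_def G2_def G3_def F_def using cX cT by (simp_all add: open_outside compact_imp_closed)
  have co: "connected G2" "connected G3" "connected F"
    unfolding G2_def G3_def F_def using cX cT
    by (auto intro!: connected_outside compact_imp_bounded)
  have Fne: "F \<noteq> {}"
    using unbounded_outside[OF compact_imp_bounded[OF cT]] unfolding F_def by force
  have cl2: "closure G2 \<subseteq> G2 \<union> (N \<union> W \<union> A1 \<union> A3)"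
    and cl3: "closure G3 \<subseteq> G3 \<union> (N \<union> W \<union> A1 \<union> A2)"
    using frontier_outside_subset[OF compact_imp_closed[OF cX(2)]]
      frontier_outside_subset[OF compact_imp_closed[OF cX(3)]] op
    unfolding G2_def G3_def frontier_def by (auto simp: interior_open)
  have AG: "A1 \<subseteq> G1" "A2 \<subseteq> G2" "A3 \<subseteq> G3" using out unfolding G1_def G2_def G3_def by auto
  have disG: "G2 \<inter> (N \<union> W \<union> A1 \<union> A3) = {}" "G3 \<inter> (N \<union> W \<union> A1 \<union> A2) = {}"
    unfolding G2_def G3_def using outside_no_overlap by blast+
  define Q where "Q = outside (N \<union> W \<union> A1)"
  have Qc: "connected Q" "open Q"
    unfolding Q_def using cA(1) by (auto intro!: connected_outside compact_imp_bounded open_outside compact_imp_closed)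
  \<comment> \<open>\<open>Q\<close> is connected and misses the frontier of
    \<open>G2 \<union> G3\<close>: a frontier point lies on the compacta but not on
    \<open>A2\<close> or \<open>A3\<close>, which are inside these open domains, so it lies in
    \<open>N \<union> W \<union> A1\<close>.\<close>
  have QG: "Q = G2 \<union> G3"
  proof
    show sub: "G2 \<union> G3 \<subseteq> Q"
      unfolding Q_def G2_def G3_def by (simp add: outside_mono)
    have "Q \<inter> frontier (G2 \<union> G3) = {}"
    proof -
      have "frontier (G2 \<union> G3) \<subseteq> (closure G2 \<union> closure G3) - (G2 \<union> G3)"
        using op by (simp add: frontier_def interior_open open_Un)
      moreover have "Q \<inter> (N \<union> W \<union> A1) = {}" unfolding Q_def using outside_no_overlap by blast
      moreover have "(closure G2 \<union> closure G3) - (G2 \<union> G3) \<subseteq> N \<union> W \<union> A1"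
      proof
        fix x assume x: "x \<in> (closure G2 \<union> closure G3) - (G2 \<union> G3)"
        then have "x \<in> N \<union> W \<union> A1 \<union> A2 \<union> A3" using cl2 cl3 by auto
        then show "x \<in> N \<union> W \<union> A1" using x AG by auto
      qed
      ultimately show ?thesis by blast
    qed
    then show "Q \<subseteq> G2 \<union> G3"
      using connected_Int_frontier[OF Qc(1), of "G2 \<union> G3"] sub Fne F23 by blast
  qed
  \<comment> \<open>Source of the contradiction: \<open>Y1\<close> and \<open>Y2\<close> are
    continua whose union has the connected complement \<open>G3\<close>, so by the dual of
    Janiszewski's theorem they meet in a connected set. That set lies in
    \<open>N \<union> W\<close>, a disjoint union, and through the ends of \<open>A2\<close> it
    meets both parts.\<close>
  define Y1 where "Y1 = - (G2 \<union> G3)"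
  define Y2 where "Y2 = closure (G2 - G3)"
  have "Q \<in> components (- (N \<union> W \<union> A1))"
    using Qc(1) Fne QG F23 unfolding outside_in_components Q_def by blast
  then have Y1con: "connected Y1"
    unfolding Y1_def QG[symmetric] using con(1) component_complement_connected by blast
  \<comment> \<open>Removing the connected \<open>A2\<close> from the connected \<open>G2\<close>
    leaves \<open>F\<close> as one component, and what remains of \<open>G2\<close> without such a
    component is connected.\<close>
  have Fcomp: "F \<in> components (G2 - A2)"
    unfolding in_components_maximal
  proof (intro conjI allI impI)
    show "F \<subseteq> G2 - A2"
      using F23 disG(2) by blast
    fix D assume D: "D \<noteq> {} \<and> F \<subseteq> D \<and> D \<subseteq> G2 - A2 \<and> connected D"
    then have "D \<subseteq> - (N \<union> W \<union> A1 \<union> A2 \<union> A3)" using disG by blast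
    moreover obtain p where p: "p \<in> F" using Fne by blast
    ultimately have "connected_component (- (N \<union> W \<union> A1 \<union> A2 \<union> A3)) x p" if "x \<in> D" for x
      unfolding connected_component_def using D that by blast
    then show "D = F"
      using p D unfolding F_def by (metis connected_component_sym outside_same_component subsetI subset_antisym)
  qed (use Fne co in auto)
  have "G2 - G3 = G2 - F" using F23 by blast
  then have "connected (G2 - G3)"
    using component_diff_connected[OF A(2) co(1) AG(2) Fcomp] by simp
  then have Y2con: "connected Y2" unfolding Y2_def by (rule connected_imp_connected_closure)
  have U: "Y1 \<union> Y2 = - G3"
  proof
    have "closure (G2 - G3) \<subseteq> - G3" using op by (intro closure_minimal) auto
    then show "Y1 \<union> Y2 \<subseteq> - G3" unfolding Y1_def Y2_def by blast
    show "- G3 \<subseteq> Y1 \<union> Y2" unfolding Y1_def Y2_def using closure_subset[of "G2 - G3"] by auto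
  qed
  have "bounded (- G3)"
    unfolding G3_def using cX(3)
    by (metis (no_types, lifting) Compl_eq_Diff_UNIV compact_imp_bounded cobounded_outside)
  then have comp: "compact Y1" "compact Y2"
    using U op unfolding Y1_def Y2_def compact_eq_bounded_closed
    by (auto intro: bounded_subset)
  have conI: "connected (Y1 \<inter> Y2)"
    by (rule Janiszewski_dual[OF comp Y1con Y2con]) (use U co in simp)
  \<comment> \<open>\<open>Y2\<close> misses the open set \<open>G1\<close>, hence
    \<open>A1\<close>, because \<open>G1 \<inter> G2 = F\<close> lies in \<open>G3\<close>; and
    \<open>Y1\<close> misses \<open>G3\<close>, hence \<open>A3\<close>.\<close>
  have sub: "Y1 \<inter> Y2 \<subseteq> N \<union> W"
  proof
    fix x assume x: "x \<in> Y1 \<inter> Y2"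
    have "G1 \<inter> (G2 - G3) = {}" using F12 F23 by blast
    then have "x \<notin> G1" using x op(1) unfolding Y2_def by (metis IntD2 open_Int_closure_eq_empty disjoint_iff)
    moreover have "x \<in> closure G2" using x unfolding Y2_def by (meson Diff_subset IntD2 closure_mono subsetD)
    then have "x \<in> G2 \<union> (N \<union> W \<union> A1 \<union> A3)" using cl2 by (rule rev_subsetD)
    ultimately show "x \<in> N \<union> W" using x AG unfolding Y1_def by auto
  qed
  have "A2 \<subseteq> G2 - G3" using AG(2) disG(2) by blast
  then have "closure A2 \<subseteq> Y2" unfolding Y2_def by (rule closure_mono)
  moreover have "N \<union> W \<subseteq> Y1" unfolding Y1_def using disG by blast
  ultimately have "N \<inter> (Y1 \<inter> Y2) \<noteq> {}" "W \<inter> (Y1 \<inter> Y2) \<noteq> {}"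
    using meetN(2) meetW(2) by blast+
  then show False
    using conI sub NW compact_imp_closed[OF N(1)] compact_imp_closed[OF W(1)]
    unfolding connected_closed by blast
qed

text \<open>The properties of the sphere on which the topology rests: compactness for limits of
  continua, planar complements of points for Janiszewski's theorem, and local path connectedness for
  drawing arcs in connected open sets.\<close>

locale topological_sphere =
  fixes S :: "'a::euclidean_space set"
  assumes compact_S: "compact S"
    and punctured: "\<And>p. p \<in> S \<Longrightarrow> (S - {p}) homeomorphic (UNIV :: complex set)"
    and locally_path_connected_S: "locally path_connected S"

lemma rsphere_eq_sphere: "rsphere = sphere 0 1"
  unfolding rsphere_def by (auto simp: norm_Pair real_sqrt_eq_1_iff)

lemma compact_rsphere: "compact rsphere"
  by (simp add: rsphere_eq_sphere)

lemma punctured_rsphere_homeomorphic_plane: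
  assumes "p \<in> rsphere"
  shows "(rsphere - {p}) homeomorphic (UNIV :: complex set)"
  unfolding rsphere_eq_sphere
  by (rule homeomorphic_punctured_sphere_affine) (use assms rsphere_eq_sphere in auto)

interpretation rsphere: topological_sphere rsphere
proof
  show "locally path_connected rsphere"
    unfolding rsphere_eq_sphere by (rule locally_path_connected_sphere)
qed (simp_all add: compact_rsphere punctured_rsphere_homeomorphic_plane)

text \<open>The point \<open>p\<close> is sent to infinity by a homeomorphism of the punctured
  sphere with the plane. The sets \<open>Z1\<close>, \<open>Z2\<close>, \<open>Z3\<close>, which run
  from \<open>p\<close> to one arm and miss everything else, certify that each arm lies in the
  unbounded complementary domain of the rest, as \<open>no_plane_theta\<close> asks.\<close>

lemma (in topological_sphere) no_theta:
  assumes N: "compact N" "connected N" and W: "compact W" "connected W" and NW: "N \<inter> W = {}"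
    and A: "connected A1" "connected A2" "connected A3"
    and cA: "compact (N \<union> W \<union> A1)" "compact (N \<union> W \<union> A2)" "compact (N \<union> W \<union> A3)"
    and dis: "A1 \<inter> (N \<union> W) = {}" "A2 \<inter> (N \<union> W) = {}" "A3 \<inter> (N \<union> W) = {}"
             "A1 \<inter> A2 = {}" "A1 \<inter> A3 = {}" "A2 \<inter> A3 = {}"
    and meetN: "closure A1 \<inter> N \<noteq> {}" "closure A2 \<inter> N \<noteq> {}" "closure A3 \<inter> N \<noteq> {}"
    and meetW: "closure A1 \<inter> W \<noteq> {}" "closure A2 \<inter> W \<noteq> {}" "closure A3 \<inter> W \<noteq> {}"
    and sub: "N \<union> W \<union> A1 \<union> A2 \<union> A3 \<subseteq> S"
    and p: "p \<in> S" "p \<notin> N \<union> W \<union> A1 \<union> A2 \<union> A3"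
    and Z: "connected Z1" "connected Z2" "connected Z3" "Z1 \<union> Z2 \<union> Z3 \<subseteq> S"
           "p \<in> Z1" "p \<in> Z2" "p \<in> Z3" "Z1 \<inter> A1 \<noteq> {}" "Z2 \<inter> A2 \<noteq> {}" "Z3 \<inter> A3 \<noteq> {}"
           "Z1 \<inter> (N \<union> W \<union> A2 \<union> A3) = {}" "Z2 \<inter> (N \<union> W \<union> A1 \<union> A3) = {}"
           "Z3 \<inter> (N \<union> W \<union> A1 \<union> A2) = {}"
  shows False
proof -
  obtain h g where hom: "homeomorphism (S - {p}) (UNIV::complex set) h g"
    using punctured[OF p(1)] unfolding homeomorphic_def by blast
  let ?S = "S - {p}"
  have conth: "continuous_on ?S h" and contg: "continuous_on UNIV g"
    and gh: "\<And>x. x \<in> ?S \<Longrightarrow> g (h x) = x" and gS: "\<And>y. g y \<in> ?S"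
    using hom unfolding homeomorphism_def by auto
  have inj: "h ` X \<inter> h ` Y = {}" if "X \<inter> Y = {}" "X \<subseteq> ?S" "Y \<subseteq> ?S" for X Y
    using that gh by (smt (verit) disjoint_iff imageE subsetD)
  have ss: "N \<subseteq> ?S" "W \<subseteq> ?S" "A1 \<subseteq> ?S" "A2 \<subseteq> ?S" "A3 \<subseteq> ?S" using sub p by auto
  have comp: "compact (h ` X)" if "compact X" "X \<subseteq> ?S" for X
    using that conth by (meson compact_continuous_image continuous_on_subset)
  have conn: "connected (h ` X)" if "connected X" "X \<subseteq> ?S" for X
    using that conth by (meson connected_continuous_image continuous_on_subset)
  have clm: "closure (h ` A) \<inter> h ` M \<noteq> {}"
    if cl: "closure A \<inter> M \<noteq> {}" and c: "compact (N \<union> W \<union> A)" and s: "A \<subseteq> ?S" for A M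
  proof -
    have c: "closure A \<subseteq> N \<union> W \<union> A"
      using c by (meson closure_minimal compact_imp_closed sup_ge2)
    then have "closure A \<subseteq> ?S" using ss s by blast
    then have "h ` closure A \<subseteq> closure (h ` A)"
      using conth closure_subset[of "h ` A"]
      by (intro image_closure_subset) (auto intro: continuous_on_subset)
    then show ?thesis using cl by blast
  qed
  \<comment> \<open>If a point of the arm were mapped into a bounded complementary component
    \<open>D\<close>, the part of the connected set \<open>A \<union> Z\<close> carried into
    \<open>D\<close> would be clopen: open by the homeomorphism, closed because the closure of
    \<open>D\<close> is compact and adds only points of the other sets. It would be nonempty and
    miss \<open>p\<close>.\<close>
  have outs: "h ` A \<subseteq> outside (h ` N \<union> h ` W \<union> h ` B \<union> h ` C)"
    if AZ: "connected A" "connected Z" "p \<in> Z" "Z \<inter> A \<noteq> {}" "Z \<inter> (N \<union> W \<union> B \<union> C) = {}"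
      "Z \<subseteq> S" "A \<inter> (N \<union> W \<union> B \<union> C) = {}"
      and sA: "A \<subseteq> ?S" "B \<subseteq> ?S" "C \<subseteq> ?S"
      and cBC: "compact (N \<union> W \<union> B)" "compact (N \<union> W \<union> C)" for A B C Z
  proof (rule ccontr)
    let ?X = "N \<union> W \<union> B \<union> C"
    assume "\<not> ?thesis"
    moreover have XX: "h ` N \<union> h ` W \<union> h ` B \<union> h ` C = h ` ?X" by blast
    ultimately obtain b where b: "b \<in> A" "h b \<notin> outside (h ` ?X)" by auto
    have cX: "compact ?X" using compact_Un[OF cBC] by (simp add: Un_ac)
    have Xs: "?X \<subseteq> ?S" using ss sA by blast
    have clX: "closed (h ` ?X)" using comp[OF cX Xs] compact_imp_closed by blast
    have hbX: "h b \<notin> h ` ?X"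
      using inj[of A ?X] AZ(7) Xs sA b(1) by blast
    define D where "D = connected_component_set (- (h ` ?X)) (h b)"
    have bD: "h b \<in> D" unfolding D_def using hbX by simp
    have "bounded D"
      using b(2) hbX unfolding D_def outside_def by auto
    have opD: "open D" unfolding D_def using clX by (simp add: open_connected_component open_Compl)
    have Dc: "D \<in> components (- (h ` ?X))" unfolding D_def using hbX by (simp add: componentsI)
    have frD: "closure D \<subseteq> D \<union> h ` ?X"
      using frontier_of_components_closed_complement[OF clX Dc] opD
      unfolding frontier_def by (auto simp: interior_open)
    let ?Y = "A \<union> Z"
    have conY: "connected ?Y" using AZ by (intro connected_Un) auto
    have "openin (top_of_set ?S) (g ` D)"
      using homeomorphism_imp_open_map[OF homeomorphism_symD[OF hom], of D] opD by simp
    then obtain O' where O': "open O'" "g ` D = ?S \<inter> O'" unfolding openin_open by blast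
    have "open (O' - {p})" using O' by (simp add: open_delete)
    moreover have "?Y \<inter> (O' - {p}) = ?Y \<inter> g ` D"
      using O' AZ sA by blast
    ultimately have 1: "openin (top_of_set ?Y) (?Y \<inter> g ` D)" by (metis openin_open)
    have "compact (g ` closure D)"
      using \<open>bounded D\<close> contg by (meson compact_closure compact_continuous_image continuous_on_subset subset_UNIV)
    then have "closedin (top_of_set ?Y) (?Y \<inter> g ` closure D)"
      by (simp add: closedin_closed_Int compact_imp_closed)
    moreover have "?Y \<inter> g ` closure D = ?Y \<inter> g ` D"
    proof -
      have "g (h x) \<in> ?X" if "x \<in> ?X" for x using gh[of x] Xs that by (metis subsetD)
      then have "g ` (h ` ?X) \<subseteq> ?X" by (simp add: image_subset_iff)
      then have "g ` closure D \<subseteq> g ` D \<union> ?X" using frD by blast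
      moreover have "g ` D \<subseteq> g ` closure D" using closure_subset[of D] by blast
      moreover have "?Y \<inter> ?X = {}" using AZ by blast
      ultimately show ?thesis by blast
    qed
    ultimately have 2: "closedin (top_of_set ?Y) (?Y \<inter> g ` D)" by simp
    have "g (h b) = b" using b sA by (intro gh) auto
    then have "b \<in> ?Y \<inter> g ` D" using b bD by (metis IntI UnI1 image_eqI)
    moreover have "p \<in> ?Y" "p \<notin> g ` D" using AZ gS by auto
    ultimately show False using conY 1 2 unfolding connected_clopen by blast
  qed
  have zs: "Z1 \<subseteq> S" "Z2 \<subseteq> S" "Z3 \<subseteq> S" using Z(4) by blast+
  have dj: "A1 \<inter> (N \<union> W \<union> A2 \<union> A3) = {}" "A2 \<inter> (N \<union> W \<union> A1 \<union> A3) = {}"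
    "A3 \<inter> (N \<union> W \<union> A1 \<union> A2) = {}" using dis by blast+
  show False
  proof (rule no_plane_theta[of "h ` N" "h ` W" "h ` A1" "h ` A2" "h ` A3"])
    show "h ` A1 \<subseteq> outside (h ` N \<union> h ` W \<union> h ` A2 \<union> h ` A3)"
      by (rule outs[OF A(1) Z(1) Z(5) Z(8) Z(11) zs(1) dj(1) ss(3) ss(4) ss(5) cA(2) cA(3)])
    show "h ` A2 \<subseteq> outside (h ` N \<union> h ` W \<union> h ` A1 \<union> h ` A3)"
      by (rule outs[OF A(2) Z(2) Z(6) Z(9) Z(12) zs(2) dj(2) ss(4) ss(3) ss(5) cA(1) cA(3)])
    show "h ` A3 \<subseteq> outside (h ` N \<union> h ` W \<union> h ` A1 \<union> h ` A2)"
      by (rule outs[OF A(3) Z(3) Z(7) Z(10) Z(13) zs(3) dj(3) ss(5) ss(3) ss(4) cA(1) cA(2)])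
    have "compact (h ` (N \<union> W \<union> A1))" "compact (h ` (N \<union> W \<union> A2))" "compact (h ` (N \<union> W \<union> A3))"
      using comp cA ss by (meson Un_least)+
    then show "compact (h ` N \<union> h ` W \<union> h ` A1)" "compact (h ` N \<union> h ` W \<union> h ` A2)"
      "compact (h ` N \<union> h ` W \<union> h ` A3)" by (simp_all add: image_Un)
    show "h ` A1 \<inter> (h ` N \<union> h ` W) = {}" "h ` A2 \<inter> (h ` N \<union> h ` W) = {}" "h ` A3 \<inter> (h ` N \<union> h ` W) = {}"
      unfolding image_Un[symmetric] using inj dis ss by (meson Un_least)+
    show "compact (h ` N)" "compact (h ` W)" "connected (h ` N)" "connected (h ` W)"
      "connected (h ` A1)" "connected (h ` A2)" "connected (h ` A3)"
      using N W A ss by (simp_all add: comp conn)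
    show "h ` N \<inter> h ` W = {}" "h ` A1 \<inter> h ` A2 = {}" "h ` A1 \<inter> h ` A3 = {}" "h ` A2 \<inter> h ` A3 = {}"
      using NW dis ss by (simp_all add: inj)
    show "closure (h ` A1) \<inter> h ` N \<noteq> {}" by (rule clm[OF meetN(1) cA(1) ss(3)])
    show "closure (h ` A2) \<inter> h ` N \<noteq> {}" by (rule clm[OF meetN(2) cA(2) ss(4)])
    show "closure (h ` A3) \<inter> h ` N \<noteq> {}" by (rule clm[OF meetN(3) cA(3) ss(5)])
    show "closure (h ` A1) \<inter> h ` W \<noteq> {}" by (rule clm[OF meetW(1) cA(1) ss(3)])
    show "closure (h ` A2) \<inter> h ` W \<noteq> {}" by (rule clm[OF meetW(2) cA(2) ss(4)])
    show "closure (h ` A3) \<inter> h ` W \<noteq> {}" by (rule clm[OF meetW(3) cA(3) ss(5)])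
  qed
qed

subsection \<open>Hausdorff limits\<close>

text \<open>Convergence in the Hausdorff metric, written with \<open>infdist\<close>. Since
  \<open>infdist x {} = 0\<close>, nonemptiness is a separate assumption wherever a nearby point has
  to be extracted.\<close>

definition hausdorff_lim :: "(nat \<Rightarrow> 'a::metric_space set) \<Rightarrow> 'a set \<Rightarrow> bool" where
  "hausdorff_lim P L \<longleftrightarrow> (\<forall>e>0. \<forall>\<^sub>F n in sequentially.
     (\<forall>x\<in>P n. infdist x L < e) \<and> (\<forall>x\<in>L. infdist x (P n) < e))"

lemma infdist_less_iff:
  assumes "A \<noteq> {}"
  shows "infdist x A < e \<longleftrightarrow> (\<exists>a\<in>A. dist x a < e)"
proof
  assume "infdist x A < e"
  then show "\<exists>a\<in>A. dist x a < e"
    using assms by (simp add: infdist_def cInf_less_iff)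
next
  assume "\<exists>a\<in>A. dist x a < e"
  then show "infdist x A < e" using infdist_le le_less_trans by blast
qed

lemma hausdorff_lim_subseq:
  assumes "hausdorff_lim P L" "strict_mono r"
  shows "hausdorff_lim (P \<circ> r) L"
  using assms unfolding hausdorff_lim_def
  by (auto intro: eventually_subseq[OF assms(2)])

text \<open>Blaschke selection. The functions \<open>\<lambda>x. infdist x (P n)\<close> are
  uniformly bounded and 1-Lipschitz on \<open>S\<close>, so Arzela-Ascoli gives a uniform limit
  \<open>g\<close> along a subsequence; the limit set is the zero set of \<open>g\<close>.\<close>

lemma hausdorff_lim_exists:
  fixes P :: "nat \<Rightarrow> 'a::euclidean_space set"
  assumes S: "compact S" and P: "\<And>n. P n \<noteq> {}" "\<And>n. P n \<subseteq> S"
  obtains r L where "strict_mono r" "compact L" "L \<noteq> {}" "L \<subseteq> S" "hausdorff_lim (P \<circ> r) L"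
proof -
  have bd: "norm (infdist x (P n)) \<le> diameter S" if "x \<in> S" for n x
  proof -
    obtain a where "a \<in> P n" using P by blast
    then have "infdist x (P n) \<le> dist x a" by (rule infdist_le)
    also have "\<dots> \<le> diameter S"
      using \<open>a \<in> P n\<close> P(2) that S by (meson compact_imp_bounded diameter_bounded_bound subsetD)
    finally show ?thesis using infdist_nonneg[of x "P n"] by simp
  qed
  have eq: "\<exists>d>0. \<forall>n y. y \<in> S \<and> norm (x - y) < d \<longrightarrow> norm (infdist x (P n) - infdist y (P n)) < e"
    if "x \<in> S" "0 < e" for x and e :: real
    using infdist_triangle_abs[of x _ y for y] that
    by (intro exI[of _ e]) (auto simp: dist_norm intro: le_less_trans)
  obtain g r where g: "continuous_on S g" and r: "strict_mono (r :: nat \<Rightarrow> nat)"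
    and unif: "\<And>e. 0 < e \<Longrightarrow> \<exists>N. \<forall>n x. n \<ge> N \<and> x \<in> S \<longrightarrow> norm (infdist x (P (r n)) - g x) < e"
    by (rule Arzela_Ascoli[OF S bd eq], assumption, assumption, assumption) (rule that)
  define L where "L = {x \<in> S. g x = 0}"
  have cL: "compact L"
  proof -
    have "closedin (top_of_set S) {x \<in> S. g x = 0}"
      using g by (rule continuous_closedin_preimage_constant)
    then show ?thesis unfolding L_def using S closedin_compact by blast
  qed
  have g0: "0 \<le> g x" if "x \<in> S" for x
  proof (rule ccontr)
    assume "\<not> 0 \<le> g x"
    then obtain N where "\<forall>n y. n \<ge> N \<and> y \<in> S \<longrightarrow> norm (infdist y (P (r n)) - g y) < - g x"
      using unif[of "- g x"] by auto
    then have "norm (infdist x (P (r N)) - g x) < - g x" using that by blast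
    then show False using infdist_nonneg[of x "P (r N)"] by simp
  qed
  \<comment> \<open>On a compact set missing \<open>L\<close> the limit \<open>g\<close> has a
    positive minimum, whereas the distance to \<open>P (r n)\<close> vanishes on
    \<open>P (r n)\<close>; so late members leave every such set. Applied to \<open>S\<close> itself
    this shows that \<open>L\<close> is nonempty.\<close>
  have near: "\<exists>N. \<forall>n\<ge>N. \<forall>x\<in>P (r n). x \<notin> K" if K: "compact K" "K \<subseteq> S" "K \<inter> L = {}" for K
  proof (cases "K = {}")
    case False
    obtain k where k: "k \<in> K" "\<And>x. x \<in> K \<Longrightarrow> g k \<le> g x"
      using continuous_attains_inf[OF K(1) False continuous_on_subset[OF g K(2)]] by blast
    have "g k > 0" using k(1) K g0[of k] unfolding L_def by (force simp: less_le)
    then obtain N where N: "\<forall>n x. n \<ge> N \<and> x \<in> S \<longrightarrow> norm (infdist x (P (r n)) - g x) < g k"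
      using unif by blast
    have "x \<notin> K" if "n \<ge> N" "x \<in> P (r n)" for n x
    proof
      assume "x \<in> K"
      then have "g k \<le> g x" by (rule k)
      moreover have "x \<in> S" using that P by blast
      then have "norm (0 - g x) < g k" using N that by (metis infdist_zero)
      ultimately show False by simp
    qed
    then show ?thesis by blast
  qed auto
  have Lne: "L \<noteq> {}"
    using near[OF S] P by (metis P(1,2) all_not_in_conv inf_bot_right order_refl subsetD)
  show thesis
  proof
    show "strict_mono r" "compact L" "L \<noteq> {}" "L \<subseteq> S" using r cL Lne unfolding L_def by auto
    show "hausdorff_lim (P \<circ> r) L"
      unfolding hausdorff_lim_def o_def
    proof (intro allI impI eventually_conj)
      fix e :: real assume "0 < e"
      let ?K = "S \<inter> {x. e \<le> infdist x L}"
      have "compact ?K"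
        using S by (intro compact_Int_closed closed_Collect_le continuous_intros)
      moreover have "?K \<inter> L = {}" using \<open>0 < e\<close> by auto
      ultimately obtain N where "\<forall>n\<ge>N. \<forall>x\<in>P (r n). x \<notin> ?K" using near by blast
      then have "\<forall>n\<ge>N. \<forall>x\<in>P (r n). infdist x L < e" using P(2) by force
      then show "\<forall>\<^sub>F n in sequentially. \<forall>x\<in>P (r n). infdist x L < e"
        unfolding eventually_sequentially by blast
      obtain N where "\<forall>n x. n \<ge> N \<and> x \<in> S \<longrightarrow> norm (infdist x (P (r n)) - g x) < e"
        using unif[OF \<open>0 < e\<close>] by blast
      then have "\<forall>n\<ge>N. \<forall>x\<in>L. infdist x (P (r n)) < e"
        unfolding L_def using infdist_nonneg by fastforce
      then show "\<forall>\<^sub>F n in sequentially. \<forall>x\<in>L. infdist x (P (r n)) < e"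
        unfolding eventually_sequentially by blast
    qed
  qed
qed

text \<open>Two separated parts of \<open>L\<close> at distance \<open>d\<close> have disjoint open
  neighbourhoods of radius \<open>d / 2\<close>; a late \<open>P n\<close> lies in their union and
  meets both.\<close>

lemma hausdorff_lim_connected:
  fixes P :: "nat \<Rightarrow> 'a::heine_borel set"
  assumes lim: "hausdorff_lim P L" and L: "compact L" and P: "\<And>n. connected (P n)" "\<And>n. P n \<noteq> {}"
  shows "connected L"
proof (rule ccontr)
  assume "\<not> connected L"
  then obtain A B where AB: "closed A" "closed B" "A \<inter> L \<noteq> {}" "B \<inter> L \<noteq> {}" "L \<subseteq> A \<union> B" "A \<inter> B \<inter> L = {}"
    unfolding connected_closed by auto
  define A' B' where "A' = A \<inter> L" and "B' = B \<inter> L"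
  have c: "compact A'" "compact B'" "A' \<noteq> {}" "B' \<noteq> {}" "A' \<inter> B' = {}" "L = A' \<union> B'"
    using AB L unfolding A'_def B'_def by (auto intro: closed_Int_compact)
  obtain d where d: "d > 0" "\<And>x y. x \<in> A' \<Longrightarrow> y \<in> B' \<Longrightarrow> d \<le> dist x y"
    using separate_compact_closed[OF c(1)] compact_imp_closed[OF c(2)] c(5) by metis
  define e where "e = d / 2"
  have e: "e > 0" using d(1) unfolding e_def by simp
  define U where "U = (\<lambda>X. {x::'a. infdist x X < e})"
  have U: "x \<in> U X \<longleftrightarrow> (\<exists>a\<in>X. dist x a < e)" if "X \<noteq> {}" for x X
    unfolding U_def using that by (simp add: infdist_less_iff)
  have "\<forall>\<^sub>F n in sequentially. (\<forall>x\<in>P n. infdist x L < e) \<and> (\<forall>x\<in>L. infdist x (P n) < e)"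
    using lim e unfolding hausdorff_lim_def by blast
  then obtain n where n: "\<And>x. x \<in> P n \<Longrightarrow> infdist x L < e" "\<And>x. x \<in> L \<Longrightarrow> infdist x (P n) < e"
    unfolding eventually_sequentially by blast
  have "open (U A')" "open (U B')" unfolding U_def
    by (intro open_Collect_less continuous_intros)+
  moreover have "P n \<subseteq> U A' \<union> U B'"
  proof
    fix x assume "x \<in> P n"
    then obtain y where "y \<in> L" "dist x y < e" using n(1) c by (metis Un_empty infdist_less_iff)
    then show "x \<in> U A' \<union> U B'" using U c by blast
  qed
  moreover have meet: "U X \<inter> P n \<noteq> {}" if X: "X \<noteq> {}" "X \<subseteq> L" for X
  proof -
    obtain a where a: "a \<in> X" using X by blast
    then have "infdist a (P n) < e" using n(2) X by blast
    then obtain x where "x \<in> P n" "dist a x < e" using P(2)[of n] by (auto simp: infdist_less_iff)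
    then show ?thesis using a U[of X x] by (auto simp: dist_commute)
  qed
  moreover have "U A' \<inter> U B' \<inter> P n = {}"
  proof -
    have False if x: "x \<in> U A'" "x \<in> U B'" for x
    proof -
      obtain a b where ab: "a \<in> A'" "b \<in> B'" "dist x a < e" "dist x b < e"
        using x U[OF c(3), of x] U[OF c(4), of x] by blast
      then have "dist a b < d" using dist_triangle3[of a b x] unfolding e_def by simp
      then show False using d(2)[of a b] ab by simp
    qed
    then show ?thesis by blast
  qed
  moreover have "U A' \<inter> P n \<noteq> {}" "U B' \<inter> P n \<noteq> {}" using meet c by blast+
  ultimately show False using P(1)[of n] unfolding connected_def by blast
qed

lemma hausdorff_lim_mem:
  assumes lim: "hausdorff_lim P L" and L: "closed L" "L \<noteq> {}"
    and x: "\<And>n. x n \<in> P n" "x \<longlonglongrightarrow> l"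
  shows "l \<in> L"
proof -
  have "infdist l L \<le> e" if "e > 0" for e
  proof -
    have "\<forall>\<^sub>F n in sequentially. (\<forall>x\<in>P n. infdist x L < e/2) \<and> (\<forall>x\<in>L. infdist x (P n) < e/2)"
      using lim half_gt_zero[OF \<open>e > 0\<close>] unfolding hausdorff_lim_def by blast
    moreover have "\<forall>\<^sub>F n in sequentially. dist (x n) l < e/2"
      using x(2) half_gt_zero[OF \<open>e > 0\<close>] by (rule tendstoD)
    ultimately have "\<forall>\<^sub>F n in sequentially. infdist (x n) L < e/2 \<and> dist (x n) l < e/2"
      by eventually_elim (use x in auto)
    then obtain n where "infdist (x n) L < e/2" "dist (x n) l < e/2"
      unfolding eventually_sequentially by blast
    then show ?thesis using infdist_triangle[of l L "x n"] by (simp add: dist_commute)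
  qed
  then have "infdist l L = 0" using infdist_nonneg[of l L] by (meson order_antisym dense_ge)
  then show ?thesis using L in_closed_iff_infdist_zero by blast
qed

lemma hausdorff_lim_meets:
  assumes lim: "hausdorff_lim P L" and L: "closed L" "L \<noteq> {}"
    and F: "compact F" "\<And>n. P n \<inter> F \<noteq> {}"
  shows "L \<inter> F \<noteq> {}"
proof -
  have "\<forall>n. \<exists>x. x \<in> P n \<inter> F" using F(2) by blast
  then obtain x where x: "\<And>n. x n \<in> P n \<inter> F" by metis
  then obtain l r where l: "l \<in> F" "strict_mono r" "(x \<circ> r) \<longlonglongrightarrow> l"
    using F(1) unfolding compact_def by (metis IntD2)
  have "l \<in> L"
    by (rule hausdorff_lim_mem[OF hausdorff_lim_subseq[OF lim l(2)] L _ l(3)]) (use x in auto)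
  then show ?thesis using l by blast
qed

lemma hausdorff_lim_mono:
  assumes P: "hausdorff_lim P L" and Q: "hausdorff_lim Q M" and M: "closed M" "M \<noteq> {}"
    and sub: "\<And>n. P n \<subseteq> Q n" and ne: "\<And>n. P n \<noteq> {}"
  shows "L \<subseteq> M"
proof
  fix x assume x: "x \<in> L"
  have "infdist x M \<le> e" if e: "e > 0" for e
  proof -
    define e2 where "e2 = e/2"
    have e2: "e2 > 0" using e unfolding e2_def by simp
    have "\<forall>\<^sub>F n in sequentially. (\<forall>x\<in>P n. infdist x L < e2) \<and> (\<forall>x\<in>L. infdist x (P n) < e2)"
      using P e2 unfolding hausdorff_lim_def by blast
    moreover have "\<forall>\<^sub>F n in sequentially. (\<forall>x\<in>Q n. infdist x M < e2) \<and> (\<forall>x\<in>M. infdist x (Q n) < e2)"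
      using Q e2 unfolding hausdorff_lim_def by blast
    ultimately have "\<forall>\<^sub>F n in sequentially. infdist x (P n) < e2 \<and> (\<forall>y\<in>Q n. infdist y M < e2)"
      by eventually_elim (use x in blast)
    then obtain n where n: "infdist x (P n) < e2" "\<And>y. y \<in> Q n \<Longrightarrow> infdist y M < e2"
      unfolding eventually_sequentially by blast
    obtain y where y: "y \<in> P n" "dist x y < e2" using n(1) ne infdist_less_iff by blast
    then show ?thesis using n(2)[of y] sub infdist_triangle[of x M y] unfolding e2_def by fastforce
  qed
  then have "infdist x M = 0" using infdist_nonneg[of x M] by (meson order_antisym dense_ge)
  then show "x \<in> M" using M in_closed_iff_infdist_zero by blast
qed

lemma hausdorff_lim_subset:
  assumes lim: "hausdorff_lim P L" and C: "closed C" "\<And>n. P n \<subseteq> C" "\<And>n. P n \<noteq> {}"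
  shows "L \<subseteq> C"
proof (rule hausdorff_lim_mono[OF lim _ C(1) _ C(2,3)])
  show "hausdorff_lim (\<lambda>_. C) C" unfolding hausdorff_lim_def by simp
  show "C \<noteq> {}" using C(2,3) by blast
qed

subsection \<open>Continua in a sphere\<close>

text \<open>Boundary bumping in the form used below: the far end is located in
  \<open>closure (C - A)\<close>, so every closed set containing \<open>C - A\<close> is reached. In
  this way continua are followed until they are about to leave \<open>A\<close>.\<close>

lemma boundary_bumping_set:
  fixes C A :: "'a::metric_space set"
  assumes "compact C" "connected C" "closed A" "x \<in> C \<inter> A" "\<not> C \<subseteq> A"
  shows "connected_component_set (C \<inter> A) x \<inter> closure (C - A) \<noteq> {}"
proof -
  let ?X = "top_of_set C"
  have "connected_component_of_set (subtopology ?X (C \<inter> A)) x \<inter> ?X frontier_of (C \<inter> A) \<noteq> {}"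
  proof (rule boundary_bumping_theorem_closed)
    show "connected_space ?X" "compact_space ?X" "Hausdorff_space ?X"
      using assms by (auto simp: connectedin_iff_connected[symmetric] connectedin_def compact_space_subtopology
        intro!: Hausdorff_space_subtopology Hausdorff_space_euclidean)
    show "closedin ?X (C \<inter> A)" using assms by (simp add: closedin_closed_Int)
    show "connected_component_of_set (subtopology ?X (C \<inter> A)) x
        \<in> connected_components_of (subtopology ?X (C \<inter> A))"
      using assms by (simp add: connected_components_of_def)
  qed (use assms in auto)
  moreover have "subtopology ?X (C \<inter> A) = top_of_set (C \<inter> A)"
    by (simp add: subtopology_subtopology inf_assoc[symmetric])
  moreover have "?X frontier_of (C \<inter> A) \<subseteq> closure (C - A)"
  proof -
    have "?X frontier_of (C \<inter> A) \<subseteq> ?X closure_of (C - C \<inter> A)"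
      unfolding frontier_of_closures by auto
    also have "C - C \<inter> A = C - A" by auto
    also have "?X closure_of (C - A) \<subseteq> closure (C - A)"
      by (simp add: closure_of_subtopology Int_absorb1)
    finally show ?thesis .
  qed
  ultimately show ?thesis
    by (auto simp: connected_component_of_def connected_component_def connectedin_subtopology)
qed

lemma separation_const_exists:
  fixes F :: "'i \<Rightarrow> 'a::heine_borel set"
  assumes "finite I" "\<And>i. i \<in> I \<Longrightarrow> compact (F i)" "\<And>i j. i \<in> I \<Longrightarrow> j \<in> I \<Longrightarrow> i \<noteq> j \<Longrightarrow> F i \<inter> F j = {}"
  obtains e where "e > 0" "\<And>i j x y. i \<in> I \<Longrightarrow> j \<in> I \<Longrightarrow> i \<noteq> j \<Longrightarrow> x \<in> F i \<Longrightarrow> y \<in> F j \<Longrightarrow> e \<le> dist x y"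
proof -
  have "\<forall>\<^sub>F e::real in at_right 0. \<forall>p\<in>I \<times> I. fst p \<noteq> snd p \<longrightarrow> (\<forall>x\<in>F (fst p). \<forall>y\<in>F (snd p). e \<le> dist x y)"
  proof (rule eventually_ball_finite)
    show "\<forall>p\<in>I \<times> I. \<forall>\<^sub>F e::real in at_right 0. fst p \<noteq> snd p \<longrightarrow> (\<forall>x\<in>F (fst p). \<forall>y\<in>F (snd p). e \<le> dist x y)"
    proof
      fix p assume p: "p \<in> I \<times> I"
      show "\<forall>\<^sub>F e::real in at_right 0. fst p \<noteq> snd p \<longrightarrow> (\<forall>x\<in>F (fst p). \<forall>y\<in>F (snd p). e \<le> dist x y)"
      proof (cases "fst p = snd p")
        case False
        then have "\<exists>d>0. \<forall>x\<in>F (fst p). \<forall>y\<in>F (snd p). d \<le> dist x y"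
          using p assms(2)[of "fst p"] assms(2)[of "snd p"] assms(3)[of "fst p" "snd p"]
          by (intro separate_compact_closed compact_imp_closed) auto
        then obtain d where "d > 0" "\<forall>x\<in>F (fst p). \<forall>y\<in>F (snd p). d \<le> dist x y" by blast
        then show ?thesis
          unfolding eventually_at_right_field by (intro exI[of _ d]) force
      qed simp
    qed
  qed (use assms(1) in simp)
  then obtain b where b: "b > 0" "\<And>e. 0 < e \<Longrightarrow> e < b \<Longrightarrow>
      \<forall>p\<in>I \<times> I. fst p \<noteq> snd p \<longrightarrow> (\<forall>x\<in>F (fst p). \<forall>y\<in>F (snd p). e \<le> dist x y)"
    unfolding eventually_at_right_field by auto
  obtain e where e: "0 < e" "e < b" using b(1) dense by blast
  show thesis
    by (rule that[OF e(1)]) (use b(2)[OF e] in fastforce)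
qed

lemma path_crossing_piece:
  fixes g :: "real \<Rightarrow> 'a::t2_space"
  assumes g: "path g" "pathstart g \<in> N" "pathfinish g \<in> W"
    and NW: "compact N" "compact W" "N \<inter> W = {}"
  obtains A where "connected A" "A \<subseteq> path_image g" "A \<inter> (N \<union> W) = {}" "compact (N \<union> W \<union> A)"
    "closure A \<inter> N \<noteq> {}" "closure A \<inter> W \<noteq> {}"
proof -
  have cont: "continuous_on {0..1} g" using g(1) by (simp add: path_def)
  have g01: "g 0 \<in> N" "g 1 \<in> W" using g by (simp_all add: pathstart_def pathfinish_def)
  have pre: "compact ({a..b} \<inter> g -` X)" if "0 \<le> a" "b \<le> 1" "compact X" for a b X
  proof -
    have "continuous_on {a..b} g" using cont that by (auto intro: continuous_on_subset)
    then have "closed ({a..b} \<inter> g -` X)"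
      using that by (intro continuous_closed_preimage) (auto intro: compact_imp_closed)
    then show ?thesis by (metis compact_Icc compact_Int_closed inf.left_idem)
  qed
  have "1 \<in> {0..1} \<inter> g -` W" using g01 by auto
  then have "{0..1} \<inter> g -` W \<noteq> {}" by blast
  then obtain t where t: "t \<in> {0..1} \<inter> g -` W" "\<And>u. u \<in> {0..1} \<inter> g -` W \<Longrightarrow> t \<le> u"
    using compact_attains_inf[OF pre[of 0 1 W]] NW(2) by (metis order_refl)
  have "0 \<in> {0..t} \<inter> g -` N" using g01 t(1) by auto
  then have "{0..t} \<inter> g -` N \<noteq> {}" by blast
  then obtain s where s: "s \<in> {0..t} \<inter> g -` N" "\<And>u. u \<in> {0..t} \<inter> g -` N \<Longrightarrow> u \<le> s"
    using compact_attains_sup[OF pre[of 0 t N]] NW(1) t(1) by (metis IntD1 atLeastAtMost_iff order_refl)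
  have st: "s < t" using s(1) t(1) NW(3) by (force simp: less_le)
  define A where "A = g ` {s<..<t}"
  have cst: "continuous_on {s..t} g" using cont s(1) t(1) by (auto intro: continuous_on_subset)
  have img: "g ` {s..t} = insert (g s) (insert (g t) A)"
  proof -
    have "{s..t} = insert s (insert t {s<..<t})" using st by auto
    then show ?thesis unfolding A_def by simp
  qed
  have cl: "g ` {s..t} \<subseteq> closure A"
  proof -
    have "g ` closure {s<..<t} \<subseteq> closure (g ` {s<..<t})"
      using cst st closure_subset[of "g ` {s<..<t}"] by (intro image_closure_subset) auto
    then show ?thesis using st unfolding A_def by simp
  qed
  show thesis
  proof
    show "connected A" unfolding A_def
      using continuous_on_subset[OF cst, of "{s<..<t}"]
      by (intro connected_continuous_image) (auto simp: greaterThanLessThan_subseteq_atLeastAtMost_iff)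
    show "A \<subseteq> path_image g" unfolding A_def path_image_def using s(1) t(1) by auto
    show "A \<inter> (N \<union> W) = {}"
    proof -
      have "g u \<notin> N" "g u \<notin> W" if "u \<in> {s<..<t}" for u
        using that s(1) t(1) s(2)[of u] t(2)[of u] by force+
      then show ?thesis unfolding A_def by blast
    qed
    have "N \<union> W \<union> A = N \<union> W \<union> g ` {s..t}" using img s(1) t(1) by auto
    then show "compact (N \<union> W \<union> A)"
      using NW cst by (simp add: compact_Un compact_continuous_image)
    show "closure A \<inter> N \<noteq> {}" "closure A \<inter> W \<noteq> {}"
      using cl img s(1) t(1) by blast+
  qed
qed

lemma locally_path_connected_imp_path_connected:
  assumes "locally path_connected S" "connected S"
  shows "path_connected S"
  using assms
  by (simp add: path_connected_component path_component_eq_connected_component connected_iff_connected_component)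

section \<open>Three legs between a continuum and a connected open set\<close>

context topological_sphere
begin

text \<open>\<open>d\<close> is a Lebesgue number for the cover of \<open>S\<close> by
  neighbourhoods lying in connected sets within \<open>r / 2\<close> of their centres; the two
  halves add up to the ball of radius \<open>r\<close> about \<open>x\<close>.\<close>

lemma uniformly_locally_connected:
  assumes "r > 0"
  obtains d where "d > 0" "\<And>x y. x \<in> S \<Longrightarrow> y \<in> S \<Longrightarrow> dist x y < d \<Longrightarrow>
    \<exists>c. connected c \<and> c \<subseteq> S \<and> x \<in> c \<and> y \<in> c \<and> c \<subseteq> ball x r"
proof -
  have lc: "locally connected S"
    using locally_path_connected_S by (rule locally_path_connected_imp_locally_connected)
  have "\<exists>G. open G \<and> p \<in> G \<and> (\<exists>c. connected c \<and> c \<subseteq> S \<and> S \<inter> G \<subseteq> c \<and> c \<subseteq> ball p (r/2))"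
    if "p \<in> S" for p
  proof -
    have "openin (top_of_set S) (S \<inter> ball p (r/2))" by (simp add: openin_open_Int)
    moreover have "p \<in> S \<inter> ball p (r/2)" using that assms by simp
    ultimately obtain U c where U: "openin (top_of_set S) U" "connected c" "p \<in> U" "U \<subseteq> c" "c \<subseteq> S \<inter> ball p (r/2)"
      using locallyE[OF lc] by metis
    obtain G where "open G" "U = S \<inter> G" using U(1) by (auto simp: openin_open)
    then show ?thesis using U by blast
  qed
  then obtain G where G: "\<And>p. p \<in> S \<Longrightarrow> open (G p)" "\<And>p. p \<in> S \<Longrightarrow> p \<in> G p"
    "\<And>p. p \<in> S \<Longrightarrow> \<exists>c. connected c \<and> c \<subseteq> S \<and> S \<inter> G p \<subseteq> c \<and> c \<subseteq> ball p (r/2)"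
    by metis
  have "S \<subseteq> \<Union>(G ` S)" using G(2) by blast
  then obtain d where d: "d > 0" "\<And>x. x \<in> S \<Longrightarrow> \<exists>g\<in>G ` S. ball x d \<subseteq> g"
    using Heine_Borel_lemma[OF compact_S, of "G ` S"] G(1) by (metis (no_types, lifting) imageE)
  show thesis
  proof (rule that[OF d(1)])
    fix x y assume xy: "x \<in> S" "y \<in> S" "dist x y < d"
    obtain p where p: "p \<in> S" "ball x d \<subseteq> G p" using d(2)[OF xy(1)] by blast
    obtain c where c: "connected c" "c \<subseteq> S" "S \<inter> G p \<subseteq> c" "c \<subseteq> ball p (r/2)" using G(3)[OF p(1)] by blast
    have "x \<in> G p" "y \<in> G p" using p(2) xy d(1) by auto
    then have xyc: "x \<in> c" "y \<in> c" using c xy by auto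
    have "c \<subseteq> ball x r"
    proof
      fix z assume "z \<in> c"
      then have "dist p z < r/2" "dist p x < r/2" using c(4) xyc(1) by auto
      then show "z \<in> ball x r" using dist_triangle_half_r[of p x r z] by simp
    qed
    then show "\<exists>c. connected c \<and> c \<subseteq> S \<and> x \<in> c \<and> y \<in> c \<and> c \<subseteq> ball x r" using c xyc by blast
  qed
qed

lemma connected_open_nbhd:
  assumes H: "connected H" "H \<subseteq> S" "H \<noteq> {}" and "e > 0"
  obtains E where "openin (top_of_set S) E" "path_connected E" "H \<subseteq> E" "\<And>x. x \<in> E \<Longrightarrow> infdist x H < e"
proof -
  let ?U = "S \<inter> {x. infdist x H < e}"
  have oU: "openin (top_of_set S) ?U"
    by (intro openin_open_Int open_Collect_less continuous_intros)
  obtain x where x: "x \<in> H" using H(3) by blast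
  let ?E = "connected_component_set ?U x"
  have HU: "H \<subseteq> ?U" using H(2) \<open>e > 0\<close> by auto
  have lpU: "locally path_connected ?U" using locally_open_subset[OF locally_path_connected_S oU] .
  have oE: "openin (top_of_set ?U) ?E"
    using locally_path_connected_imp_locally_connected[OF lpU]
    by (rule openin_connected_component_locally_connected)
  show thesis
  proof
    show oS: "openin (top_of_set S) ?E" using openin_trans[OF oE oU] .
    show "path_connected ?E"
      using locally_open_subset[OF locally_path_connected_S oS]
      by (intro locally_path_connected_imp_path_connected) simp_all
    show "H \<subseteq> ?E" using H(1) HU x by (simp add: connected_component_maximal)
    show "infdist y H < e" if "y \<in> ?E" for y
      using connected_component_subset[of ?U x] that by blast
  qed
qed

text \<open>Thickening turns the continua into the configuration of \<open>no_theta\<close>. The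
  legs \<open>H i\<close> get disjoint path connected open neighbourhoods, in which arcs run from
  \<open>N\<close> to \<open>V\<close>; their ends in \<open>V\<close> are joined by two paths,
  whose union is \<open>W\<close>. The continuum \<open>P\<close> is the third hub: it passes near
  every leg without touching it, and a short connected set bridges the gap at each.\<close>

lemma no_three_legs:
  fixes H :: "nat \<Rightarrow> 'a set"
  assumes N: "compact N" "connected N" "N \<subseteq> S"
    and V: "openin (top_of_set S) V" "connected V" "N \<inter> closure V = {}"
    and H: "\<And>i. i < 3 \<Longrightarrow> compact (H i)" "\<And>i. i < 3 \<Longrightarrow> connected (H i)" "\<And>i. i < 3 \<Longrightarrow> H i \<subseteq> S"
      "\<And>i. i < 3 \<Longrightarrow> H i \<inter> N \<noteq> {}" "\<And>i. i < 3 \<Longrightarrow> H i \<inter> closure V \<noteq> {}"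
      "\<And>i j. i < 3 \<Longrightarrow> j < 3 \<Longrightarrow> i \<noteq> j \<Longrightarrow> H i \<inter> H j = {}"
    and P: "\<And>d. d > 0 \<Longrightarrow> \<exists>P. compact P \<and> connected P \<and> P \<noteq> {} \<and> P \<subseteq> S \<and> P \<inter> N = {} \<and> P \<inter> V = {} \<and>
       (\<forall>i<3. P \<inter> H i = {} \<and> (\<forall>x\<in>H i. infdist x P < d))"
  shows False
proof -
  have VS: "V \<subseteq> S" using V(1) openin_imp_subset by blast
  have Nne: "N \<noteq> {}" using H(4)[of 0] by auto
  obtain h where h: "h > 0" "\<And>x y. x \<in> N \<Longrightarrow> y \<in> closure V \<Longrightarrow> h \<le> dist x y"
    using separate_compact_closed[OF N(1) closed_closure V(3)] by blast
  obtain s where s: "s > 0" "\<And>i j x y. i < 3 \<Longrightarrow> j < 3 \<Longrightarrow> i \<noteq> j \<Longrightarrow> x \<in> H i \<Longrightarrow> y \<in> H j \<Longrightarrow> s \<le> dist x y"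
    using separation_const_exists[of "{..<3::nat}" H] H(1,6) by (metis finite_lessThan lessThan_iff)
  \<comment> \<open>A bridge of radius \<open>r\<close> about a point at distance
    \<open>h / 2\<close> from \<open>N\<close> avoids both \<open>N\<close> and \<open>V\<close>;
    the bound \<open>s / 2\<close> keeps it off the neighbourhoods of the other two legs.\<close>
  define r where "r = min (h/2) (s/2)"
  have r: "r > 0" "r \<le> h/2" "r \<le> s/2" using h(1) s(1) by (auto simp: r_def)
  obtain d where d: "d > 0" "\<And>x y. x \<in> S \<Longrightarrow> y \<in> S \<Longrightarrow> dist x y < d \<Longrightarrow>
    \<exists>c. connected c \<and> c \<subseteq> S \<and> x \<in> c \<and> y \<in> c \<and> c \<subseteq> ball x r"
    using uniformly_locally_connected[OF r(1)] by blast
  define d2 where "d2 = d/2"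
  have d2: "d2 > 0" using d(1) by (simp add: d2_def)
  obtain P where P'': "compact P \<and> connected P \<and> P \<noteq> {} \<and> P \<subseteq> S \<and> P \<inter> N = {} \<and> P \<inter> V = {} \<and>
       (\<forall>i<3. P \<inter> H i = {} \<and> (\<forall>x\<in>H i. infdist x P < d2))"
    using P[OF d2] by (rule exE)
  have P': "compact P" "connected P" "P \<noteq> {}" "P \<subseteq> S" "P \<inter> N = {}" "P \<inter> V = {}"
    and P7: "\<And>i. i < 3 \<Longrightarrow> P \<inter> H i = {}" and P8: "\<And>i x. i < 3 \<Longrightarrow> x \<in> H i \<Longrightarrow> infdist x P < d2"
    using P'' by blast+
  let ?HH = "\<Union>i<3::nat. H i"
  have HH: "closed ?HH" using H(1) by (intro compact_imp_closed compact_UN) auto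
  have "P \<inter> ?HH = {}" using P7 by auto
  from separate_compact_closed[OF P'(1) HH this] obtain e1 where e1: "e1 > 0" "\<And>x y. x \<in> P \<Longrightarrow> y \<in> ?HH \<Longrightarrow> e1 \<le> dist x y"
    by blast
  \<comment> \<open>Three demands on the width of the neighbourhoods \<open>E i\<close>:
    \<open>s / 4\<close> keeps them disjoint, and clear of a bridge of radius \<open>s / 2\<close>
    at another leg; \<open>d2\<close>, half of \<open>d\<close>, leaves any point of
    \<open>E i\<close> within \<open>d\<close> of \<open>P\<close>; \<open>e1\<close> keeps them off
    \<open>P\<close>.\<close>
  define e where "e = min (s/4) (min d2 e1)"
  have e: "e > 0" "e \<le> s/4" "e \<le> d2" "e \<le> e1" using s(1) d2 e1(1) by (auto simp: e_def)
  have "\<exists>E. openin (top_of_set S) E \<and> path_connected E \<and> H i \<subseteq> E \<and> (\<forall>x\<in>E. infdist x (H i) < e)" if i: "i < 3" for i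
    using connected_open_nbhd[OF H(2)[OF i] H(3)[OF i] _ e(1)] H(4)[OF i] by (metis inf_bot_left)
  then obtain E where E: "\<And>i. i < 3 \<Longrightarrow> openin (top_of_set S) (E i)" "\<And>i. i < 3 \<Longrightarrow> path_connected (E i)"
     "\<And>i. i < 3 \<Longrightarrow> H i \<subseteq> E i" "\<And>i x. i < 3 \<Longrightarrow> x \<in> E i \<Longrightarrow> infdist x (H i) < e"
    by metis
  have ES: "E i \<subseteq> S" if "i < 3" for i using E(1)[OF that] openin_imp_subset by blast
  have Enear: "\<exists>y\<in>H i. dist x y < e" if "i < 3" "x \<in> E i" for i x
    using E(4)[OF that] H(4)[OF that(1)] by (metis infdist_less_iff inf_bot_left)
  have "\<exists>v. v \<in> V \<inter> E i" if i: "i < 3" for i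
  proof -
    obtain O' where O': "open O'" "E i = S \<inter> O'" using E(1)[OF i] by (auto simp: openin_open)
    have "O' \<inter> closure V \<noteq> {}" using H(5)[OF i] E(3)[OF i] O'(2) by blast
    then have "O' \<inter> V \<noteq> {}" using O'(1) open_Int_closure_eq_empty by blast
    then show ?thesis using O' VS by blast
  qed
  then obtain v where v: "\<And>i. i < 3 \<Longrightarrow> v i \<in> V" "\<And>i. i < 3 \<Longrightarrow> v i \<in> E i" by (metis IntE)
  have pcV: "path_connected V"
    using locally_open_subset[OF locally_path_connected_S V(1)] V(2)
    by (rule locally_path_connected_imp_path_connected)
  obtain g1 where g1: "path g1" "path_image g1 \<subseteq> V" "pathstart g1 = v 0" "pathfinish g1 = v 1"
    using pcV v(1)[of 0] v(1)[of 1] unfolding path_connected_def by force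
  obtain g2 where g2: "path g2" "path_image g2 \<subseteq> V" "pathstart g2 = v 0" "pathfinish g2 = v 2"
    using pcV v(1)[of 0] v(1)[of 2] unfolding path_connected_def by force
  define W where "W = path_image g1 \<union> path_image g2"
  have W: "compact W" "connected W" "W \<subseteq> V"
  proof -
    have "v 0 \<in> path_image g1" "v 0 \<in> path_image g2" using g1(3) g2(3) by (metis pathstart_in_path_image)+
    then show "connected W" unfolding W_def
      using g1(1) g2(1) by (intro connected_Un connected_path_image) auto
  qed (use g1 g2 in \<open>auto simp: W_def compact_path_image intro: compact_Un\<close>)
  have vW: "v i \<in> W" if "i < 3" for i
  proof -
    have "i = 0 \<or> i = 1 \<or> i = 2" using that by linarith
    then show ?thesis unfolding W_def using g1(3,4) g2(4) by (metis UnI1 UnI2 pathstart_in_path_image pathfinish_in_path_image)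
  qed
  have NW: "N \<inter> W = {}" using W(3) V(3) closure_subset[of V] by blast
  have "\<exists>A. connected A \<and> A \<subseteq> E i \<and> A \<inter> (N \<union> W) = {} \<and> compact (N \<union> W \<union> A) \<and>
    closure A \<inter> N \<noteq> {} \<and> closure A \<inter> W \<noteq> {}" if i: "i < 3" for i
  proof -
    obtain n where n: "n \<in> H i \<inter> N" using H(4)[OF i] by blast
    then have "n \<in> E i" using E(3)[OF i] by blast
    then obtain g where g: "path g" "path_image g \<subseteq> E i" "pathstart g = n" "pathfinish g = v i"
      using E(2)[OF i] v(2)[OF i] unfolding path_connected_def by blast
    show ?thesis
    proof (rule path_crossing_piece[OF g(1) _ _ N(1) W(1) NW])
      show "pathstart g \<in> N" "pathfinish g \<in> W" using g n vW[OF i] by auto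
    qed (use g(2) in blast)
  qed
  then obtain A where "\<forall>i. i < 3 \<longrightarrow> connected (A i) \<and> A i \<subseteq> E i \<and> A i \<inter> (N \<union> W) = {} \<and>
    compact (N \<union> W \<union> A i) \<and> closure (A i) \<inter> N \<noteq> {} \<and> closure (A i) \<inter> W \<noteq> {}"
    by metis
  then have A: "\<And>i. i < 3 \<Longrightarrow> connected (A i)" "\<And>i. i < 3 \<Longrightarrow> A i \<subseteq> E i"
    "\<And>i. i < 3 \<Longrightarrow> A i \<inter> (N \<union> W) = {}" "\<And>i. i < 3 \<Longrightarrow> compact (N \<union> W \<union> A i)"
    "\<And>i. i < 3 \<Longrightarrow> closure (A i) \<inter> N \<noteq> {}" "\<And>i. i < 3 \<Longrightarrow> closure (A i) \<inter> W \<noteq> {}"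
    by simp_all
  have Edis: "E i \<inter> E j = {}" if ij: "i < 3" "j < 3" "i \<noteq> j" for i j
  proof -
    have False if x: "x \<in> E i" "x \<in> E j" for x
    proof -
      obtain y z where "y \<in> H i" "dist x y < e" "z \<in> H j" "dist x z < e"
        using Enear[OF ij(1) x(1)] Enear[OF ij(2) x(2)] by blast
      then show False using s(2)[OF ij, of y z] dist_triangle3[of y z x] e s(1) by simp
    qed
    then show ?thesis by blast
  qed
  obtain p where p: "p \<in> P" using P'(3) by blast
  have PE: "P \<inter> E i = {}" if i: "i < 3" for i
  proof -
    have False if x: "x \<in> P" "x \<in> E i" for x
    proof -
      obtain y where "y \<in> H i" "dist x y < e" using Enear[OF i x(2)] by blast
      then show False using e1(2)[OF x(1), of y] i e(4) by auto
    qed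
    then show ?thesis by blast
  qed
  have "\<exists>Z. connected Z \<and> Z \<subseteq> S \<and> p \<in> Z \<and> Z \<inter> A i \<noteq> {} \<and> Z \<inter> (N \<union> W) = {} \<and>
     (\<forall>j<3. j \<noteq> i \<longrightarrow> Z \<inter> A j = {})" if i: "i < 3" for i
  proof -
    \<comment> \<open>The bridge starts at a point \<open>t\<close> of the arm with
      \<open>infdist t N = h/2\<close>. It exists by the intermediate value theorem, as the closure
      of \<open>A i\<close> has a point in \<open>N\<close> and one in \<open>W\<close>, at distance
      at least \<open>h\<close> from \<open>N\<close>.\<close>
    have "connected (closure (A i))" using A(1)[OF i] by (rule connected_imp_connected_closure)
    then have "connected ((\<lambda>x. infdist x N) ` closure (A i))"
      by (intro connected_continuous_image continuous_intros)
    moreover obtain a b where ab: "a \<in> closure (A i)" "a \<in> N" "b \<in> closure (A i)" "b \<in> W"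
      using A(5,6)[OF i] by blast
    moreover have "infdist a N = 0" using ab by simp
    moreover have Vfar: "h \<le> infdist x N" if x: "x \<in> V" for x
    proof -
      obtain y where y: "y \<in> N" "infdist x N = dist x y"
        using infdist_attains_inf[OF compact_imp_closed[OF N(1)] Nne] by blast
      have "x \<in> closure V" using x closure_subset by blast
      then show ?thesis using h(2)[OF y(1)] y(2) by (simp add: dist_commute)
    qed
    have "h \<le> infdist b N" using Vfar ab(4) W(3) by blast
    ultimately have I: "connected ((\<lambda>x. infdist x N) ` closure (A i))"
      "0 \<in> (\<lambda>x. infdist x N) ` closure (A i)" "infdist b N \<in> (\<lambda>x. infdist x N) ` closure (A i)"
      and hb: "h \<le> infdist b N"
      by (simp, metis image_eqI, simp, simp)
    have "h/2 \<in> (\<lambda>x. infdist x N) ` closure (A i)"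
      using connectedD_interval[OF I, of "h/2"] hb h(1) by simp
    then obtain t where t: "t \<in> closure (A i)" "infdist t N = h/2" by auto
    have "closure (A i) \<subseteq> N \<union> W \<union> A i"
      using A(4)[OF i] by (meson closure_minimal compact_imp_closed sup_ge2)
    moreover have "t \<notin> N" using t(2) h(1) by auto
    moreover have "t \<notin> W" using t(2) h(1) Vfar[of t] W(3) by auto
    ultimately have tA: "t \<in> A i" using t(1) by blast
    then have tE: "t \<in> E i" using A(2)[OF i] by blast
    obtain y where y: "y \<in> H i" "dist t y < e" using Enear[OF i tE] by blast
    obtain q where q: "q \<in> P" "dist y q < d2" using P8[OF i y(1)] P'(3) by (auto simp: infdist_less_iff)
    have "dist t q < d" using dist_triangle[of t q y] y(2) q(2) e(3) unfolding d2_def by simp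
    moreover have tS: "t \<in> S" using tE ES[OF i] by blast
    moreover have "q \<in> S" using q(1) P'(4) by blast
    ultimately obtain c where c: "connected c" "c \<subseteq> S" "t \<in> c" "q \<in> c" "c \<subseteq> ball t r"
      using d(2) by blast
    have cN: "x \<notin> N" if "x \<in> c" for x
    proof
      assume "x \<in> N"
      then have "h/2 \<le> dist t x" using t(2) infdist_le[of x N t] by simp
      then show False using that c(5) r(2) by auto
    qed
    have cV: "x \<notin> V" if "x \<in> c" for x
    proof
      assume "x \<in> V"
      then have "h \<le> infdist x N" by (rule Vfar)
      then have "h/2 \<le> dist t x" using t(2) infdist_triangle[of x N t] by (simp add: dist_commute)
      then show False using that c(5) r(2) by auto
    qed
    have cE: "x \<notin> E j" if x: "x \<in> c" and j: "j < 3" "j \<noteq> i" for x j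
    proof
      assume "x \<in> E j"
      then obtain z where z: "z \<in> H j" "dist x z < e" using Enear[OF j(1)] by blast
      have "s \<le> dist y z" using s(2)[OF i j(1)] j(2) y(1) z(1) by metis
      also have "\<dots> \<le> dist t y + (dist t x + dist x z)"
        using dist_triangle3[of y z t] dist_triangle[of t z x] by simp
      also have "\<dots> < s/4 + (s/2 + s/4)" using y(2) z(2) x c(5) e(2) r(3) by force
      finally show False by simp
    qed
    show ?thesis
    proof (intro exI[of _ "P \<union> c"] conjI allI impI)
      show "connected (P \<union> c)" using P'(2) c(1) q(1) c(4) by (intro connected_Un) auto
      show "P \<union> c \<subseteq> S" "p \<in> P \<union> c" "(P \<union> c) \<inter> A i \<noteq> {}" using P'(4) c p tA by auto
      show "(P \<union> c) \<inter> (N \<union> W) = {}" using P'(5,6) cN cV W(3) by blast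
      show "(P \<union> c) \<inter> A j = {}" if j: "j < 3" "j \<noteq> i" for j
        using A(2)[OF j(1)] PE[OF j(1)] cE[OF _ j] by blast
    qed
  qed
  then obtain Z where "\<forall>i. i < 3 \<longrightarrow> connected (Z i) \<and> Z i \<subseteq> S \<and> p \<in> Z i \<and> Z i \<inter> A i \<noteq> {} \<and>
    Z i \<inter> (N \<union> W) = {} \<and> (\<forall>j<3. j \<noteq> i \<longrightarrow> Z i \<inter> A j = {})"
    by metis
  then have Z: "\<And>i. i < 3 \<Longrightarrow> connected (Z i)" "\<And>i. i < 3 \<Longrightarrow> Z i \<subseteq> S" "\<And>i. i < 3 \<Longrightarrow> p \<in> Z i"
    "\<And>i. i < 3 \<Longrightarrow> Z i \<inter> A i \<noteq> {}" "\<And>i. i < 3 \<Longrightarrow> Z i \<inter> (N \<union> W) = {}"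
    "\<And>i j. i < 3 \<Longrightarrow> j < 3 \<Longrightarrow> j \<noteq> i \<Longrightarrow> Z i \<inter> A j = {}"
    by simp_all
  have Adis: "A i \<inter> A j = {}" if "i < 3" "j < 3" "i \<noteq> j" for i j
    using A(2)[OF that(1)] A(2)[OF that(2)] Edis[OF that] by blast
  have Zd: "Z i \<inter> (N \<union> W \<union> A j \<union> A k) = {}" if "i < 3" "j < 3" "k < 3" "j \<noteq> i" "k \<noteq> i" for i j k
    using Z(5,6) that by (simp add: Int_Un_distrib)
  have AS: "A i \<subseteq> S" "p \<notin> A i" if "i < 3" for i
    using A(2)[OF that] ES[OF that] PE[OF that] p by blast+
  show False
  proof (rule no_theta[of N W "A 0" "A 1" "A 2" p "Z 0" "Z 1" "Z 2"])
    show "N \<union> W \<union> A 0 \<union> A 1 \<union> A 2 \<subseteq> S" using N(3) W(3) VS AS(1)[of 0] AS(1)[of 1] AS(1)[of 2] by auto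
    show "p \<in> S" using p P'(4) by blast
    show "p \<notin> N \<union> W \<union> A 0 \<union> A 1 \<union> A 2" using p P'(5,6) W(3) AS(2)[of 0] AS(2)[of 1] AS(2)[of 2] by auto
    show "Z 0 \<union> Z 1 \<union> Z 2 \<subseteq> S" using Z(2)[of 0] Z(2)[of 1] Z(2)[of 2] by auto
  qed (use N W NW in \<open>simp_all add: A Z Adis Zd\<close>)
qed

end

section \<open>A local criterion, and what it says about limits of continua\<close>

abbreviation joined_in :: "'a::topological_space set \<Rightarrow> 'a set \<Rightarrow> 'a set \<Rightarrow> 'a \<Rightarrow> bool" where
  "joined_in K U d y \<equiv> (\<exists>C. compact C \<and> connected C \<and> C \<subseteq> U \<and> d \<subseteq> C \<and> y \<in> C) \<or>
     connected_component_set K y \<subseteq> U"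

text \<open>The Peano property of the hyperspace read inside \<open>K\<close>. The first alternative
  of \<open>joined_in\<close> expresses that the component of \<open>d\<close> in the hyperspace is
  connected im kleinen at \<open>d\<close>; the second, that other components coming close to
  \<open>d\<close> are small, which stands for the finiteness of those of large diameter.\<close>

definition locally_peano :: "'a::topological_space set \<Rightarrow> 'a set set \<Rightarrow> bool" where
  "locally_peano K D \<longleftrightarrow> (\<forall>d\<in>D. \<forall>U. openin (top_of_set K) U \<and> d \<subseteq> U \<longrightarrow>
     (\<exists>V. openin (top_of_set K) V \<and> d \<subseteq> V \<and> V \<subseteq> U \<and>
        (\<forall>y\<in>V. joined_in K U d y)))"

lemma pigeonhole_many:
  assumes "finite T" "f ` Z \<subseteq> T" "finite Z" "card Z > m * card T"
  shows "\<exists>t\<in>T. m < card {z \<in> Z. f z = t}"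
proof (rule ccontr)
  assume "\<not> ?thesis"
  then have "\<And>t. t \<in> T \<Longrightarrow> card {z \<in> Z. f z = t} \<le> m" by force
  then have "(\<Sum>t\<in>T. card {z \<in> Z. f z = t}) \<le> (\<Sum>t\<in>T. m)" by (rule sum_mono)
  moreover have "card Z = (\<Sum>t\<in>T. card {z \<in> Z. f z = t})"
    using card_eq_sum sum.group[OF assms(3,1,2), of "\<lambda>_. 1::nat"] by simp
  ultimately show False using assms(4) by (simp add: mult.commute)
qed

lemma pigeonhole_three:
  assumes "finite T" "f ` Z \<subseteq> T" "finite Z" "card Z > 2 * card T"
  obtains t z where "t \<in> T" "\<And>i::nat. i < 3 \<Longrightarrow> z i \<in> Z \<and> f (z i) = t"
    "\<And>i j. i < 3 \<Longrightarrow> j < 3 \<Longrightarrow> i \<noteq> j \<Longrightarrow> z i \<noteq> z j"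
proof -
  have "\<exists>t\<in>T. 3 \<le> card {z \<in> Z. f z = t}"
    using pigeonhole_many[OF assms] by (simp add: Suc_le_eq numeral_3_eq_3 numeral_2_eq_2)
  then obtain t where t: "t \<in> T" "3 \<le> card {z \<in> Z. f z = t}" by blast
  obtain B where B: "B \<subseteq> {z \<in> Z. f z = t}" "card B = 3" "finite B"
    by (rule obtain_subset_with_card_n[OF t(2)])
  obtain z where z: "bij_betw z {0..<3::nat} B"
    using ex_bij_betw_nat_finite[OF B(3)] B(2) by auto
  show thesis
  proof (rule that[OF t(1), of z])
    show "z i \<in> Z \<and> f (z i) = t" if "i < 3" for i
      using bij_betwE[OF z] B(1) that by auto
    show "z i \<noteq> z j" if "i < 3" "j < 3" "i \<noteq> j" for i j
      using z that by (auto simp: bij_betw_def inj_on_def)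
  qed
qed

text \<open>Each point of \<open>Z\<close> yields an arm. Near \<open>z\<close> the criterion joins
  \<open>c z\<close> to the nearby component \<open>P n\<close> by a continuum. It cannot stay in
  \<open>A\<close>, as it would then lie in \<open>P n\<close> and contain \<open>z\<close>; so its
  part in \<open>A\<close> through a point of \<open>P n\<close> reaches the closure of some
  \<open>V\<close>. Limits of these parts run from \<open>z\<close> to such a closure and are
  disjoint for different \<open>z\<close>. Three of them end at the same \<open>V\<close>, and
  \<open>P n\<close> comes close to all three without meeting them, against
  \<open>no_three_legs\<close>. The pigeonhole asks for \<open>2 * card VV + 1\<close> points; one
  more guarantees two points even when \<open>VV\<close> is empty.\<close>

lemma (in topological_sphere) limit_continuum_meets_few_classes:
  assumes K: "compact K" "K \<subseteq> S"
    and D: "\<And>d. d \<in> D \<Longrightarrow> compact d" "\<And>d. d \<in> D \<Longrightarrow> d \<subseteq> K" "pairwise disjnt D" and peano: "locally_peano K D"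
    and A: "closed A" "A \<subseteq> K"
    and VV: "finite VV" "\<And>V. V \<in> VV \<Longrightarrow> openin (top_of_set S) V" "\<And>V. V \<in> VV \<Longrightarrow> connected V"
      "\<And>V. V \<in> VV \<Longrightarrow> V \<inter> A = {}" "K - A \<subseteq> \<Union>VV"
    and N: "compact N" "connected N" "N \<subseteq> A" "\<And>V. V \<in> VV \<Longrightarrow> N \<inter> closure V = {}"
    and P: "\<And>n. P n \<in> components A" "\<And>n. P n \<inter> N = {}"
    and Z: "finite Z" "Z \<subseteq> N" "card Z \<ge> 2 * card VV + 2"
    and c: "\<And>z. z \<in> Z \<Longrightarrow> c z \<in> D" "\<And>z. z \<in> Z \<Longrightarrow> z \<in> c z" "inj_on c Z"
    and near: "\<And>z. z \<in> Z \<Longrightarrow> (\<lambda>n. infdist z (P n)) \<longlonglongrightarrow> 0"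
  shows False
proof -
  have cA: "compact A" using compact_Int_closed[OF K(1) A(1)] A(2) by (simp add: Int_absorb1)
  have Pc: "compact (P n)" "connected (P n)" "P n \<noteq> {}" "P n \<subseteq> A" for n
  proof -
    show "connected (P n)" "P n \<noteq> {}" "P n \<subseteq> A"
      using in_components_connected[OF P(1)[of n]] in_components_nonempty[OF P(1)[of n]]
        in_components_subset[OF P(1)[of n]] by this
    show "compact (P n)" using P(1)[of n] cA compact_components by blast
  qed
  have AS: "A \<subseteq> S" using A(2) K(2) by blast
  have cdis: "c z \<inter> c z' = {}" if zz: "z \<in> Z" "z' \<in> Z" "z \<noteq> z'" for z z'
  proof -
    have "c z \<noteq> c z'" using c(3) zz by (auto dest: inj_onD)
    then show ?thesis using D(3) c(1)[OF zz(1)] c(1)[OF zz(2)] unfolding pairwise_def disjnt_def by blast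
  qed
  obtain e where e: "e > 0" "\<And>i j x y. i \<in> Z \<Longrightarrow> j \<in> Z \<Longrightarrow> i \<noteq> j \<Longrightarrow> x \<in> c i \<Longrightarrow> y \<in> c j \<Longrightarrow> e \<le> dist x y"
    using separation_const_exists[OF Z(1), of c] D(1) c(1) cdis by metis
  \<comment> \<open>Below \<open>e / 2\<close>, so that the closed neighbourhoods \<open>B z\<close>
    of the classes remain disjoint.\<close>
  define r where "r = e / 3"
  have r: "r > 0" using e(1) by (simp add: r_def)
  define B where "B = (\<lambda>z. {x. infdist x (c z) \<le> r})"
  have Bcl: "closed (B z)" for z
    unfolding B_def by (intro closed_Collect_le continuous_intros)
  have Bdis: "B z \<inter> B z' = {}" if zz: "z \<in> Z" "z' \<in> Z" "z \<noteq> z'" for z z'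
  proof -
    have False if x: "x \<in> B z" "x \<in> B z'" for x
    proof -
      obtain y where y: "y \<in> c z" "infdist x (c z) = dist x y"
        using infdist_attains_inf[OF compact_imp_closed[OF D(1)[OF c(1)[OF zz(1)]]]] c(2)[OF zz(1)] by blast
      obtain y' where y': "y' \<in> c z'" "infdist x (c z') = dist x y'"
        using infdist_attains_inf[OF compact_imp_closed[OF D(1)[OF c(1)[OF zz(2)]]]] c(2)[OF zz(2)] by blast
      have "dist x y \<le> r" "dist x y' \<le> r" using x y(2) y'(2) unfolding B_def by auto
      then have "dist y y' \<le> r + r" using dist_triangle3[of y y' x] by linarith
      also have "\<dots> < e" using r unfolding r_def by simp
      finally show False using e(2)[OF zz y(1) y'(1)] by simp
    qed
    then show ?thesis by blast
  qed
  define x where "x = (\<lambda>z n. SOME y. y \<in> P n \<and> infdist z (P n) = dist z y)"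
  have x: "x z n \<in> P n" "infdist z (P n) = dist z (x z n)" for z n
  proof -
    have "\<exists>y. y \<in> P n \<and> infdist z (P n) = dist z y"
      using infdist_attains_inf[OF compact_imp_closed[OF Pc(1)] Pc(3)] by blast
    from someI_ex[OF this] show "x z n \<in> P n" "infdist z (P n) = dist z (x z n)" unfolding x_def by blast+
  qed
  have xlim: "x z \<longlonglongrightarrow> z" if "z \<in> Z" for z
    using near[OF that] unfolding x(2) tendsto_dist_iff[of "x z"] by (subst dist_commute)
  let ?cl = "\<Union>V\<in>VV. closure V"
  have clcl: "closed ?cl" using VV(1) by (intro closed_UN) auto
  let ?U = "\<lambda>z. K \<inter> {x. infdist x (c z) < r}"
  have "\<exists>V. openin (top_of_set K) V \<and> c z \<subseteq> V \<and> V \<subseteq> ?U z \<and>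
        (\<forall>y\<in>V. joined_in K (?U z) (c z) y)" if z: "z \<in> Z" for z
  proof -
    have "openin (top_of_set K) (?U z)"
      by (intro openin_open_Int open_Collect_less continuous_intros)
    moreover have "c z \<subseteq> ?U z"
      using D(2)[OF c(1)[OF z]] r by auto
    ultimately have "openin (top_of_set K) (?U z) \<and> c z \<subseteq> ?U z"
      by (rule conjI)
    from mp[OF spec[OF bspec[OF peano[unfolded locally_peano_def] c(1)[OF z]]] this] show ?thesis .
  qed
  from bchoice[OF ballI[OF this]]
  obtain V where V: "\<forall>z\<in>Z. openin (top_of_set K) (V z) \<and> c z \<subseteq> V z \<and> V z \<subseteq> ?U z \<and>
        (\<forall>y\<in>V z. joined_in K (?U z) (c z) y)"
    by (rule exE)
  have "\<forall>\<^sub>F n in sequentially. \<forall>z\<in>Z. x z n \<in> V z"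
  proof (rule eventually_ball_finite[OF Z(1)], rule ballI)
    fix z assume z: "z \<in> Z"
    then obtain O' where O': "open O'" "V z = K \<inter> O'" using V by (auto simp: openin_open)
    have "z \<in> O'" using V z c(2) O'(2) by blast
    then have "\<forall>\<^sub>F n in sequentially. x z n \<in> O'" using xlim[OF z] O'(1) by (rule topological_tendstoD[rotated -1])
    moreover have "x z n \<in> K" for n using x(1) Pc(4) A(2) by blast
    ultimately show "\<forall>\<^sub>F n in sequentially. x z n \<in> V z" using O'(2) by simp
  qed
  then obtain n0 where n0: "\<And>n z. n \<ge> n0 \<Longrightarrow> z \<in> Z \<Longrightarrow> x z n \<in> V z"
    unfolding eventually_sequentially by blast
  have two: "\<exists>z'\<in>Z. z' \<noteq> z" for z
  proof (rule ccontr)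
    assume "\<not> ?thesis"
    then have "Z \<subseteq> {z}" by blast
    then have "card Z \<le> 1" using card_mono[of "{z}" Z] by simp
    then show False using Z(3) by simp
  qed
  have "\<exists>H. compact H \<and> connected H \<and> H \<subseteq> P n \<and> H \<subseteq> B z \<and> x z n \<in> H \<and> H \<inter> (S \<inter> ?cl) \<noteq> {}"
    if n: "n \<ge> n0" and z: "z \<in> Z" for n z
  proof -
    have xV: "x z n \<in> V z" using n0[OF n z] .
    \<comment> \<open>The second alternative is excluded: \<open>P n\<close> lies in the component
      of \<open>x z n\<close>, yet it also contains a point close to the class of another
      \<open>z'\<close>.\<close>
    have "\<not> connected_component_set K (x z n) \<subseteq> ?U z"
    proof
      assume *: "connected_component_set K (x z n) \<subseteq> ?U z"
      obtain z' where z': "z' \<in> Z" "z' \<noteq> z" using two by blast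
      have "P n \<subseteq> connected_component_set K (x z n)"
        using Pc(2,4)[of n] A(2) x(1) by (intro connected_component_maximal) auto
      then have "x z' n \<in> B z" using * x(1)[of z' n] unfolding B_def by force
      moreover have "x z' n \<in> B z'"
        using n0[OF n z'(1)] V z'(1) unfolding B_def by force
      ultimately show False using Bdis[OF z z'(1)] z'(2) by blast
    qed
    then obtain C where C: "compact C" "connected C" "C \<subseteq> ?U z" "c z \<subseteq> C" "x z n \<in> C"
      using bspec[OF conjunct2[OF conjunct2[OF conjunct2[OF bspec[OF V z]]]] xV] by blast
    have xA: "x z n \<in> C \<inter> A" using C(5) x(1) Pc(4) by blast
    have nCA: "\<not> C \<subseteq> A"
    proof
      assume CA: "C \<subseteq> A"
      have "C \<subseteq> P n"
        using components_maximal[OF P(1)[of n] C(2) CA] C(5) x(1)[of z n] by blast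
      then show False using C(4) c(2)[OF z] Z(2) z P(2)[of n] by blast
    qed
    let ?H = "connected_component_set (C \<inter> A) (x z n)"
    have HCA: "?H \<subseteq> C \<inter> A" by (rule connected_component_subset)
    have "connected ?H" by simp
    have "compact ?H" using compact_components[OF compact_Int_closed[OF C(1) A(1)] componentsI[OF xA]] .
    have xH: "x z n \<in> ?H" using xA by simp
    have HP: "?H \<subseteq> P n"
    proof (rule components_maximal[OF P(1)[of n] \<open>connected ?H\<close>])
      show "?H \<subseteq> A" using HCA by blast
      show "P n \<inter> ?H \<noteq> {}" using x(1)[of z n] xH by blast
    qed
    have "?H \<inter> closure (C - A) \<noteq> {}"
      using boundary_bumping_set[OF C(1,2) A(1) xA nCA] .
    moreover have "closure (C - A) \<subseteq> ?cl"
    proof -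
      have "C - A \<subseteq> \<Union>VV" using VV(5) C(3) by blast
      also have "\<dots> \<subseteq> ?cl" using closure_subset by fast
      finally show ?thesis using clcl by (rule closure_minimal)
    qed
    ultimately have "?H \<inter> (S \<inter> ?cl) \<noteq> {}" using HCA AS by blast
    moreover have "?H \<subseteq> B z" using HCA C(3) unfolding B_def by force
    ultimately show ?thesis using \<open>connected ?H\<close> \<open>compact ?H\<close> HP xH by (intro exI[of _ ?H]) simp
  qed
  note H = this
  \<comment> \<open>The shift by \<open>n0\<close> makes the continua \<open>H\<close> available for
    every index.\<close>
  define Q where "Q = (\<lambda>n. P (n + n0))"
  have QS: "Q n \<noteq> {}" "Q n \<subseteq> S" for n using Pc(3,4) AS unfolding Q_def by blast+
  obtain u L where u: "strict_mono u" and L: "compact L" "L \<noteq> {}" "L \<subseteq> S" "hausdorff_lim (Q \<circ> u) L"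
    by (rule hausdorff_lim_exists[OF compact_S QS]) (rule that)
  have "\<exists>M. compact M \<and> connected M \<and> M \<subseteq> L \<and> M \<subseteq> B z \<and> M \<subseteq> A \<and> z \<in> M \<and> M \<inter> (S \<inter> ?cl) \<noteq> {}" if z: "z \<in> Z" for z
  proof -
    have "\<forall>n. \<exists>H. compact H \<and> connected H \<and> H \<subseteq> P (u n + n0) \<and> H \<subseteq> B z \<and> x z (u n + n0) \<in> H \<and> H \<inter> (S \<inter> ?cl) \<noteq> {}"
      using H[OF _ z] by simp
    from choice[OF this] obtain G where G': "\<forall>n. compact (G n) \<and> connected (G n) \<and> G n \<subseteq> P (u n + n0) \<and>
        G n \<subseteq> B z \<and> x z (u n + n0) \<in> G n \<and> G n \<inter> (S \<inter> ?cl) \<noteq> {}" by (rule exE)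
    have G: "compact (G n)" "connected (G n)" "G n \<subseteq> (Q \<circ> u) n" "G n \<subseteq> B z" "x z (u n + n0) \<in> G n"
        "G n \<inter> (S \<inter> ?cl) \<noteq> {}" for n
      using spec[OF G', of n] unfolding Q_def o_def by blast+
    have Gne: "G n \<noteq> {}" for n using G(5) by blast
    have GS: "G n \<subseteq> S" for n using G(3)[of n] QS(2) by auto
    \<comment> \<open>Each \<open>z\<close> may use its own further subsequence \<open>w\<close>:
      along it the continua still converge to the common \<open>L\<close>, which is all that is
      compared.\<close>
    obtain w M where w: "strict_mono w" and M: "compact M" "M \<noteq> {}" "M \<subseteq> S" "hausdorff_lim (G \<circ> w) M"
      by (rule hausdorff_lim_exists[OF compact_S Gne GS]) (rule that)
    have "connected M" using hausdorff_lim_connected[OF M(4,1)] G(2) Gne by simp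
    moreover have "M \<subseteq> L"
      by (rule hausdorff_lim_mono[OF M(4) hausdorff_lim_subseq[OF L(4) w]])
         (use G(3) Gne L(1,2) in \<open>auto intro: compact_imp_closed\<close>)
    moreover have "M \<subseteq> B z"
      by (rule hausdorff_lim_subset[OF M(4) Bcl]) (use G(4) Gne in auto)
    moreover have "M \<subseteq> A"
      by (rule hausdorff_lim_subset[OF M(4) A(1)]) (use G(3) Gne Pc(4) in \<open>force simp: Q_def\<close>)+
    moreover have "z \<in> M"
    proof (rule hausdorff_lim_mem[OF M(4) compact_imp_closed[OF M(1)] M(2)])
      show "x z (u (w n) + n0) \<in> (G \<circ> w) n" for n using G(5) by simp
      have "strict_mono (\<lambda>n. u (w n) + n0)" using u w by (auto simp: strict_mono_def)
      then show "(\<lambda>n. x z (u (w n) + n0)) \<longlonglongrightarrow> z"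
        using LIMSEQ_subseq_LIMSEQ[OF xlim[OF z]] by (simp add: o_def)
    qed
    moreover have "M \<inter> (S \<inter> ?cl) \<noteq> {}"
      by (rule hausdorff_lim_meets[OF M(4) compact_imp_closed[OF M(1)] M(2)])
         (use G(6) compact_S clcl in \<open>auto intro: compact_Int_closed\<close>)
    ultimately show ?thesis using M(1) by blast
  qed
  from bchoice[OF ballI[OF this]] obtain M where M: "\<forall>z\<in>Z. compact (M z) \<and> connected (M z) \<and> M z \<subseteq> L \<and> M z \<subseteq> B z \<and> M z \<subseteq> A \<and> z \<in> M z \<and>
    M z \<inter> (S \<inter> ?cl) \<noteq> {}" by (rule exE)
  then have "\<forall>z\<in>Z. \<exists>V\<in>VV. M z \<inter> closure V \<noteq> {}" by blast
  then obtain k where k: "\<forall>z\<in>Z. k z \<in> VV \<and> M z \<inter> closure (k z) \<noteq> {}" by metis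
  obtain W zz where zz: "W \<in> VV" "\<And>i::nat. i < 3 \<Longrightarrow> zz i \<in> Z \<and> k (zz i) = W"
    "\<And>i j. i < 3 \<Longrightarrow> j < 3 \<Longrightarrow> i \<noteq> j \<Longrightarrow> zz i \<noteq> zz j"
  proof -
    have "k ` Z \<subseteq> VV" "card Z > 2 * card VV" using k Z(3) by auto
    then show thesis by (rule pigeonhole_three[OF VV(1) _ Z(1)]) (rule that)
  qed
  \<comment> \<open>\<open>M z\<close> is a connected subset of \<open>A\<close> containing
    \<open>z \<in> N\<close>; meeting the component \<open>P n\<close> would put \<open>z\<close>
    into it.\<close>
  have MP: "M z \<inter> P n = {}" if z: "z \<in> Z" for z n
  proof (rule ccontr)
    assume "M z \<inter> P n \<noteq> {}"
    then have "M z \<subseteq> P n" using components_maximal[OF P(1)[of n]] M z by (metis inf_commute)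
    then show False using M z Z(2) P(2)[of n] by blast
  qed
  show False
  proof (rule no_three_legs[of N W "\<lambda>i. M (zz i)"])
    show "compact N" "connected N" "N \<subseteq> S" using N A(2) K(2) by auto
    show "openin (top_of_set S) W" "connected W" "N \<inter> closure W = {}" using VV(2,3) N(4) zz(1) by auto
    fix i :: nat assume i: "i < 3"
    have zi: "zz i \<in> Z" "k (zz i) = W" using zz(2)[OF i] by auto
    show "compact (M (zz i))" "connected (M (zz i))" using M zi by auto
    show "M (zz i) \<subseteq> S" using M zi AS by blast
    show "M (zz i) \<inter> N \<noteq> {}" using M zi(1) Z(2) by blast
    show "M (zz i) \<inter> closure W \<noteq> {}" using k zi by auto
    show "M (zz i) \<inter> M (zz j) = {}" if j: "j < 3" "i \<noteq> j" for j
      using Bdis[of "zz i" "zz j"] M zi(1) zz(2)[OF j(1)] zz(3)[OF i j] by blast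
  next
    fix d :: real assume d: "d > 0"
    have "\<forall>\<^sub>F n in sequentially. (\<forall>x\<in>(Q \<circ> u) n. infdist x L < d) \<and> (\<forall>x\<in>L. infdist x ((Q \<circ> u) n) < d)"
      using L(4) d unfolding hausdorff_lim_def by blast
    then obtain n where n: "\<forall>x\<in>L. infdist x (P (u n + n0)) < d"
      unfolding eventually_sequentially Q_def o_def by blast
    let ?P = "P (u n + n0)"
    show "\<exists>P. compact P \<and> connected P \<and> P \<noteq> {} \<and> P \<subseteq> S \<and> P \<inter> N = {} \<and> P \<inter> W = {} \<and>
       (\<forall>i<3. P \<inter> M (zz i) = {} \<and> (\<forall>x\<in>M (zz i). infdist x P < d))"
    proof (intro exI[of _ ?P] conjI allI impI)
      show "?P \<inter> W = {}" using VV(4)[OF zz(1)] Pc(4)[of "u n + n0"] by blast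
      fix i :: nat assume i: "i < 3"
      show "?P \<inter> M (zz i) = {}" using MP[of "zz i"] zz(2)[OF i] by blast
      show "\<forall>x\<in>M (zz i). infdist x ?P < d" using n M zz(2)[OF i] by blast
    next
      show "?P \<subseteq> S" using Pc(4)[of "u n + n0"] AS by (rule subset_trans)
    qed (simp_all add: Pc P(2))
  qed
qed

subsection \<open>Monotone decompositions with Peano hyperspace\<close>

lemma compact_between_finite_union:
  fixes F G :: "'a::metric_space set"
  assumes B: "topological_basis B" and F: "compact F" "open G" "F \<subseteq> G"
  obtains C where "finite C" "C \<subseteq> B" "F \<subseteq> \<Union>C" "closure (\<Union>C) \<subseteq> G"
proof -
  have "\<exists>b\<in>B. x \<in> b \<and> closure b \<subseteq> G" if x: "x \<in> F" for x
  proof -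
    obtain e where e: "e > 0" "cball x e \<subseteq> G"
      using F(2,3) x by (meson open_contains_cball subsetD)
    obtain b where b: "b \<in> B" "x \<in> b" "b \<subseteq> ball x e"
      using topological_basisE[OF B open_ball[of x e]] e(1) by (metis centre_in_ball)
    have "closure b \<subseteq> cball x e"
      using b(3) ball_subset_cball[of x e] by (intro closure_minimal) auto
    then show ?thesis using b e(2) by blast
  qed
  then obtain b where b: "\<forall>x\<in>F. b x \<in> B \<and> x \<in> b x \<and> closure (b x) \<subseteq> G" by metis
  have "\<forall>x\<in>F. open (b x)" using b topological_basis_open[OF B] by blast
  moreover have "F \<subseteq> (\<Union>x\<in>F. b x)" using b by blast
  ultimately obtain T where T: "T \<subseteq> F" "finite T" "F \<subseteq> (\<Union>x\<in>T. b x)"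
    using compactE_image[OF F(1), of F b] by metis
  show thesis
  proof (rule that[of "b ` T"])
    show "finite (b ` T)" "b ` T \<subseteq> B" "F \<subseteq> \<Union>(b ` T)" using T b by auto
    have "closed (\<Union>x\<in>T. closure (b x))" using T(2) by (intro closed_UN) auto
    moreover have "\<Union>(b ` T) \<subseteq> (\<Union>x\<in>T. closure (b x))" using closure_subset by fast
    ultimately have "closure (\<Union>(b ` T)) \<subseteq> (\<Union>x\<in>T. closure (b x))" by (rule closure_minimal[rotated])
    then show "closure (\<Union>(b ` T)) \<subseteq> G" using T(1) b by blast
  qed
qed

text \<open>\<open>peano_space\<close> demands a metric that induces the quotient topology; it is
  found here. Finite unions of basic open sets form a countable family. For any two of them whose
  closures have disjoint images in \<open>Y\<close>, Urysohn's lemma gives a function on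
  \<open>Y\<close>. As fibres are compact, these countably many functions separate points and embed
  \<open>Y\<close> in a countable product of lines.\<close>

lemma metrizable_closed_map_image:
  fixes K :: "'a::{metric_space, second_countable_topology} set"
  assumes K: "compact K" and f: "continuous_map (top_of_set K) Y f" "closed_map (top_of_set K) Y f"
    and surj: "f ` K = topspace Y"
  shows "metrizable_space Y" "compact_space Y" "Hausdorff_space Y"
proof -
  have cK: "compact_space (top_of_set K)" using K by (simp add: compact_space_subtopology)
  have HK: "Hausdorff_space (top_of_set K)" by (simp add: Hausdorff_space_subtopology)
  have nK: "normal_space (top_of_set K)"
    using cK HK by (simp add: compact_Hausdorff_or_regular_imp_normal_space)
  have nY: "normal_space Y" and hY: "Hausdorff_space Y"
    using normal_Hausdorff_space_closed_continuous_map_image[OF nK HK f(2,1)] surj by auto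
  have "compactin Y (f ` topspace (top_of_set K))"
    using image_compactin[OF _ f(1)] cK by (simp add: compact_space_def)
  then have cY: "compact_space Y" using surj by (simp add: compact_space_def)
  obtain B :: "'a set set" where B: "countable B" "topological_basis B"
    using ex_countable_basis by blast
  define FF where "FF = {C. finite C \<and> C \<subseteq> B}"
  have cFF: "countable FF" unfolding FF_def by (rule countable_Collect_finite_subset[OF B(1)])
  define c where "c = (\<lambda>C. f ` (K \<inter> closure (\<Union>C)))"
  have ccl: "closedin Y (c C)" for C
    using f(2) unfolding c_def closed_map_def by (simp add: closedin_closed_Int)
  define I where "I = {p \<in> FF \<times> FF. disjnt (c (fst p)) (c (snd p))}"
  have cI: "countable I" unfolding I_def using cFF by (auto intro: countable_subset[of _ "FF \<times> FF"])
  have "\<exists>g. continuous_map Y euclideanreal g \<and> g ` c (fst p) \<subseteq> {0} \<and> g ` c (snd p) \<subseteq> {1}" if p: "p \<in> I" for p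
  proof -
    have d: "disjnt (c (fst p)) (c (snd p))" using p unfolding I_def by blast
    show ?thesis by (rule Urysohn_lemma_alt[OF nY ccl ccl d, of 0 1]) blast
  qed
  then obtain g where g: "\<forall>p\<in>I. continuous_map Y euclideanreal (g p) \<and> g p ` c (fst p) \<subseteq> {0} \<and> g p ` c (snd p) \<subseteq> {1}"
    by metis
  define h where "h = (\<lambda>y. \<lambda>p\<in>I. g p y)"
  let ?P = "product_topology (\<lambda>p. euclideanreal) I"
  have hc: "continuous_map Y ?P h"
    unfolding continuous_map_componentwise h_def using g by auto
  have "inj_on h (topspace Y)"
  proof (rule inj_onI, rule ccontr)
    fix y z assume yz: "y \<in> topspace Y" "z \<in> topspace Y" "h y = h z" "y \<noteq> z"
    obtain U V where UV: "openin Y U" "openin Y V" "y \<in> U" "z \<in> V" "disjnt U V"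
      using hY yz unfolding Hausdorff_space_def by blast
    \<comment> \<open>The compact fibre over \<open>w\<close> lies in an open set that meets
      \<open>K\<close> in the preimage of \<open>W\<close>; a finite union of basic sets fits
      between the two together with its closure, whose image is the closed set sought.\<close>
    have near: "\<exists>C\<in>FF. w \<in> c C \<and> c C \<subseteq> W" if W: "openin Y W" "w \<in> W" for w W
    proof -
      have wY: "w \<in> topspace Y" using openin_subset[OF W(1)] W(2) by blast
      have "openin (top_of_set K) {x \<in> K. f x \<in> W}"
        using openin_continuous_map_preimage[OF f(1) W(1)] by simp
      then obtain G where G: "open G" "{x \<in> K. f x \<in> W} = K \<inter> G" by (auto simp: openin_open)
      let ?F = "{x \<in> K. f x \<in> {w}}"
      have "closedin (top_of_set K) ?F"
        using closedin_continuous_map_preimage[OF f(1), of "{w}"] hY wY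
        by (simp add: closedin_Hausdorff_sing_eq)
      then have "compact ?F" using K closedin_compact by blast
      moreover have "?F \<subseteq> G" using G(2) W(2) by auto
      ultimately obtain C where C: "finite C" "C \<subseteq> B" "?F \<subseteq> \<Union>C" "closure (\<Union>C) \<subseteq> G"
        by (rule compact_between_finite_union[OF B(2) _ G(1)])
      obtain x where x: "x \<in> K" "f x = w" using wY surj by (metis imageE)
      then have "x \<in> closure (\<Union>C)" using C(3) closure_subset[of "\<Union>C"] by blast
      then have "w \<in> c C" unfolding c_def using x by blast
      moreover have "c C \<subseteq> W" unfolding c_def using C(4) G(2) by blast
      ultimately show ?thesis using C(1,2) unfolding FF_def by blast
    qed
    obtain C1 C2 where C: "C1 \<in> FF" "y \<in> c C1" "c C1 \<subseteq> U" "C2 \<in> FF" "z \<in> c C2" "c C2 \<subseteq> V"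
      using near[OF UV(1,3)] near[OF UV(2,4)] by blast
    have p: "(C1, C2) \<in> I"
      using C UV(5) unfolding I_def disjnt_def by auto
    have "g (C1, C2) y = g (C1, C2) z"
      using fun_cong[OF yz(3), of "(C1, C2)"] p unfolding h_def by simp
    moreover have "g (C1, C2) y = 0" "g (C1, C2) z = 1"
      using g[rule_format, OF p] C(2,5) by (auto simp: image_subset_iff)
    ultimately show False by simp
  qed
  moreover have hP: "Hausdorff_space ?P" by (simp add: Hausdorff_space_product_topology)
  ultimately have "embedding_map Y ?P h"
    using injective_closed_imp_embedding_map[OF hc] T1_Spaces.continuous_imp_closed_map[OF hc cY hP] by blast
  then have "Y homeomorphic_space (subtopology ?P (h ` topspace Y))"
    unfolding embedding_map_def homeomorphic_space by blast
  moreover have "metrizable_space ?P"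
    unfolding metrizable_space_product_topology using cI metrizable_space_euclidean
    by (auto intro: countable_subset[of _ I])
  ultimately show "metrizable_space Y"
    using metrizable_space_subtopology homeomorphic_metrizable_space by blast
  show "compact_space Y" "Hausdorff_space Y" by (rule cY, rule hY)
qed

text \<open>\<open>hyperspace\<close> is given through \<open>topology\<close>, which returns its
  predicate only if that is a topology. Disjointness of the classes makes the union of an
  intersection the intersection of the unions.\<close>

lemma openin_hyperspace:
  assumes "pairwise disjnt D"
  shows "openin (hyperspace K D) \<U> \<longleftrightarrow> \<U> \<subseteq> D \<and> openin (top_of_set K) (\<Union>\<U>)"
proof -
  have "istopology (\<lambda>\<U>. \<U> \<subseteq> D \<and> openin (top_of_set K) (\<Union>\<U>))"
    unfolding istopology_def
  proof (intro conjI allI impI)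
    fix S T assume ST: "S \<subseteq> D \<and> openin (top_of_set K) (\<Union>S)" "T \<subseteq> D \<and> openin (top_of_set K) (\<Union>T)"
    have "\<Union>(S \<inter> T) = \<Union>S \<inter> \<Union>T"
    proof
      show "\<Union>S \<inter> \<Union>T \<subseteq> \<Union>(S \<inter> T)"
      proof
        fix x assume "x \<in> \<Union>S \<inter> \<Union>T"
        then obtain s t where st: "s \<in> S" "x \<in> s" "t \<in> T" "x \<in> t" by blast
        then have "s = t" using assms ST unfolding pairwise_def disjnt_def by blast
        then show "x \<in> \<Union>(S \<inter> T)" using st by blast
      qed
    qed blast
    then show "openin (top_of_set K) (\<Union>(S \<inter> T))" using ST by (simp add: openin_Int)
  next
    fix \<K> assume K: "\<forall>S\<in>\<K>. S \<subseteq> D \<and> openin (top_of_set K) (\<Union>S)"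
    have "\<Union>(\<Union>\<K>) = \<Union>(Union ` \<K>)" by blast
    then show "openin (top_of_set K) (\<Union>(\<Union>\<K>))" using openin_Union[of "Union ` \<K>" "top_of_set K"] K by auto
  qed blast+
  then show ?thesis unfolding hyperspace_def by (simp add: topology_inverse')
qed

locale monotone_decomposition =
  fixes K :: "'a::{metric_space, second_countable_topology} set" and D :: "'a set set"
  assumes compact_K: "compact K" and decomp: "monotone_decomp K D"
begin

lemma D_facts: "\<Union>D = K" "\<And>d. d \<in> D \<Longrightarrow> d \<noteq> {}" "\<And>d. d \<in> D \<Longrightarrow> compact d" "\<And>d. d \<in> D \<Longrightarrow> connected d"
  "pairwise disjnt D" "\<And>d. d \<in> D \<Longrightarrow> d \<subseteq> K"
  using decomp unfolding monotone_decomp_def by auto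

lemma D_eqI: "d \<in> D \<Longrightarrow> e \<in> D \<Longrightarrow> x \<in> d \<Longrightarrow> x \<in> e \<Longrightarrow> d = e"
  using D_facts(5) unfolding pairwise_def disjnt_def by blast

text \<open>The quotient map of \<open>K\<close> onto the hyperspace; outside \<open>K\<close> its
  value is unspecified.\<close>

definition cls where "cls x = (THE d. d \<in> D \<and> x \<in> d)"

lemma cls_eq: "d \<in> D \<Longrightarrow> x \<in> d \<Longrightarrow> cls x = d"
  unfolding cls_def using D_eqI by (intro the_equality) auto

lemma cls_in: "x \<in> K \<Longrightarrow> cls x \<in> D" "x \<in> K \<Longrightarrow> x \<in> cls x"
proof -
  assume "x \<in> K"
  then obtain d where "d \<in> D" "x \<in> d" using D_facts(1) by blast
  then show "cls x \<in> D" "x \<in> cls x" using cls_eq[of d x] by auto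
qed

abbreviation X where "X \<equiv> hyperspace K D"

lemma openin_X: "openin X \<U> \<longleftrightarrow> \<U> \<subseteq> D \<and> openin (top_of_set K) (\<Union>\<U>)"
  using openin_hyperspace[OF D_facts(5)] .

lemma topspace_X: "topspace X = D"
proof
  show "topspace X \<subseteq> D" using openin_topspace[of X] unfolding openin_X by blast
  have "openin X D" unfolding openin_X D_facts(1) by simp
  then show "D \<subseteq> topspace X" by (rule openin_subset)
qed

lemma cls_image: "cls ` K = D"
proof
  show "D \<subseteq> cls ` K"
  proof
    fix d assume d: "d \<in> D"
    then obtain x where "x \<in> d" using D_facts(2) by blast
    then show "d \<in> cls ` K" using d cls_eq D_facts(6) by blast
  qed
qed (use cls_in in blast)

lemma cls_preimage: "\<U> \<subseteq> D \<Longrightarrow> {x \<in> K. cls x \<in> \<U>} = \<Union>\<U>"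
  using cls_in cls_eq D_facts(6) by (auto, blast+)

text \<open>\<open>usc_decomp\<close> speaks of open sets that contain some class; for the others
  the union is empty, hence open.\<close>

lemma openin_saturated_core:
  assumes "openin (top_of_set K) U"
  shows "openin (top_of_set K) (\<Union>{e \<in> D. e \<subseteq> U})"
proof (cases "\<exists>d\<in>D. d \<subseteq> U")
  case True
  then show ?thesis using decomp assms unfolding monotone_decomp_def usc_decomp_def by blast
next
  case False
  then have *: "{e \<in> D. e \<subseteq> U} = {}" by blast
  show ?thesis unfolding * by simp
qed

lemma continuous_cls: "continuous_map (top_of_set K) X cls"
  unfolding continuous_map_def topspace_X
proof (intro conjI allI impI)
  show "cls \<in> topspace (top_of_set K) \<rightarrow> D" using cls_in by auto
  fix \<U> assume "openin X \<U>"
  then show "openin (top_of_set K) {x \<in> topspace (top_of_set K). cls x \<in> \<U>}"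
    unfolding openin_X by (simp add: cls_preimage)
qed

lemma closed_map_cls: "closed_map (top_of_set K) X cls"
  unfolding closed_map_def
proof (intro allI impI)
  fix F assume F: "closedin (top_of_set K) F"
  have FK: "F \<subseteq> K" using closedin_subset[OF F] by simp
  have "D - cls ` F = {e \<in> D. e \<subseteq> K - F}"
  proof safe
    fix e x assume "e \<in> D" "e \<notin> cls ` F" "x \<in> e" "x \<in> F"
    then show False using cls_eq by blast
  next
    fix e x assume e: "cls x \<in> D" "cls x \<subseteq> K - F" "x \<in> F"
    then show False using cls_in(2)[of x] FK by blast
  qed (use D_facts(6) in blast)+
  then have "openin X (D - cls ` F)"
    unfolding openin_X using openin_saturated_core[of "K - F"] F
    by (auto simp: openin_diff)
  moreover have "cls ` F \<subseteq> D" using FK cls_in by blast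
  ultimately show "closedin X (cls ` F)" unfolding closedin_def topspace_X by simp
qed

lemma X_space: "metrizable_space X" "compact_space X" "Hausdorff_space X"
  using metrizable_closed_map_image[OF compact_K continuous_cls closed_map_cls] cls_image topspace_X by auto

lemma connected_Union_X:
  assumes "connectedin X \<C>"
  shows "connected (\<Union>\<C>)"
proof -
  have "monotone_map (top_of_set K) X cls"
    unfolding monotone_map_def topspace_X
  proof (intro conjI ballI)
    fix d assume d: "d \<in> D"
    have "{x \<in> topspace (top_of_set K). cls x = d} = d"
      using cls_preimage[of "{d}"] d by simp
    then show "connectedin (top_of_set K) {x \<in> topspace (top_of_set K). cls x = d}"
      using D_facts(4,6) d by (simp add: connectedin_subtopology)
  qed (use cls_image in auto)
  then have "connectedin (top_of_set K) {x \<in> topspace (top_of_set K). cls x \<in> \<C>}"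
    using monotone_closed_map[OF continuous_cls closed_map_cls] cls_image topspace_X assms by simp
  then show ?thesis
    using cls_preimage[of \<C>] connectedin_subset_topspace[OF assms] topspace_X
    by (simp add: connectedin_subtopology)
qed

lemma connectedin_cls_image:
  assumes "connected C" "C \<subseteq> K"
  shows "connectedin X (cls ` C)"
  using connectedin_continuous_map_image[OF continuous_cls, of C] assms by (simp add: connectedin_subtopology)

lemma compact_Union_X:
  assumes "closedin X \<C>"
  shows "compact (\<Union>\<C>)"
proof -
  have "closedin (top_of_set K) {x \<in> topspace (top_of_set K). cls x \<in> \<C>}"
    using closedin_continuous_map_preimage[OF continuous_cls assms] .
  then have "closedin (top_of_set K) (\<Union>\<C>)"
    using cls_preimage[of \<C>] closedin_subset[OF assms] topspace_X by simp
  then show ?thesis using compact_K closedin_compact by blast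
qed

text \<open>Images and preimages of connected sets under \<open>cls\<close> are connected, so
  components of \<open>K\<close> and of the hyperspace correspond. This carries the second
  alternative of \<open>joined_in\<close> from one to the other.\<close>

lemma component_Union_X:
  assumes y: "y \<in> K" and U: "\<U> \<subseteq> D"
  shows "connected_component_set K y \<subseteq> \<Union>\<U> \<longleftrightarrow> connected_component_of_set X (cls y) \<subseteq> \<U>"
proof
  assume L: "connected_component_set K y \<subseteq> \<Union>\<U>"
  let ?P = "connected_component_of_set X (cls y)"
  have P: "?P \<subseteq> D" using connected_component_of_subset_topspace[of X "cls y"] topspace_X by blast
  have "cls y \<in> ?P" using cls_in(1)[OF y] topspace_X by (simp add: connected_component_of_refl)
  then have "y \<in> \<Union>?P" using cls_in(2)[OF y] by blast
  moreover have "connected (\<Union>?P)" by (rule connected_Union_X[OF connectedin_connected_component_of])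
  moreover have "\<Union>?P \<subseteq> K" using P D_facts(1) by blast
  ultimately have "\<Union>?P \<subseteq> connected_component_set K y" by (rule connected_component_maximal)
  then have *: "\<Union>?P \<subseteq> \<Union>\<U>" using L by blast
  show "?P \<subseteq> \<U>"
  proof
    fix e assume e: "e \<in> ?P"
    then obtain x where x: "x \<in> e" using P D_facts(2) by blast
    then obtain u where "u \<in> \<U>" "x \<in> u" using * e by blast
    then show "e \<in> \<U>" using D_eqI[of e u x] x e P U by blast
  qed
next
  assume R: "connected_component_of_set X (cls y) \<subseteq> \<U>"
  let ?C = "connected_component_set K y"
  have C: "?C \<subseteq> K" by (rule connected_component_subset)
  have "connectedin X (cls ` ?C)" using connectedin_cls_image[OF _ C] by simp
  moreover have "cls y \<in> cls ` ?C" using y by simp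
  ultimately have "cls ` ?C \<subseteq> connected_component_of_set X (cls y)"
    by (rule connected_component_of_maximal)
  then show "?C \<subseteq> \<Union>\<U>" using R C cls_in(2) by blast
qed

end

section \<open>The Peano property and the local criterion are equivalent\<close>

context Metric_space
begin

text \<open>\<open>mdiam\<close> is a supremum of reals and behaves as a diameter on bounded
  nonempty sets. In the compact hyperspace every set is bounded.\<close>

lemma mdiam_metric:
  assumes "mbounded P" "P \<noteq> {}"
  shows "a \<in> P \<Longrightarrow> b \<in> P \<Longrightarrow> d a b \<le> mdiam (metric (M, d)) P"
    and "(\<And>a b. a \<in> P \<Longrightarrow> b \<in> P \<Longrightarrow> d a b \<le> C) \<Longrightarrow> mdiam (metric (M, d)) P \<le> C"
proof -
  let ?A = "{d x y | x y. x \<in> P \<and> y \<in> P}"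
  have eq: "mdiam (metric (M, d)) P = Sup ?A" unfolding mdiam_def by simp
  obtain B where "\<forall>x\<in>P. \<forall>y\<in>P. d x y \<le> B" using assms(1) unfolding mbounded_alt by blast
  then have bdd: "bdd_above ?A" by (intro bdd_aboveI[of _ B]) auto
  show "d a b \<le> mdiam (metric (M, d)) P" if "a \<in> P" "b \<in> P"
    unfolding eq using that by (intro cSup_upper[OF _ bdd]) blast
  show "mdiam (metric (M, d)) P \<le> C" if "\<And>a b. a \<in> P \<Longrightarrow> b \<in> P \<Longrightarrow> d a b \<le> C"
    unfolding eq
  proof (rule cSup_least)
    obtain p where "p \<in> P" using assms(2) by blast
    then show "?A \<noteq> {}" by blast
  qed (use that in blast)
qed

end

context monotone_decomposition
begin

text \<open>Work in a ball of radius \<open>r\<close> about \<open>d\<close> in the hyperspace. In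
  the component \<open>Q\<close> of \<open>d\<close>, local connectedness yields a small connected
  set joining \<open>d\<close> to nearby points of \<open>Q\<close>. The finitely many other
  components of diameter above \<open>r / 2\<close> can be removed, and any remaining one that
  enters the ball of radius \<open>r / 2\<close> stays in the ball of radius \<open>r\<close>. These
  are the two alternatives.\<close>

lemma peano_imp_locally_peano:
  assumes "peano_space X"
  shows "locally_peano K D"
proof -
  let ?N = "{P \<in> connected_components_of X. \<not> (\<exists>x. P = {x})}"
  from conjunct2[OF assms[unfolded peano_space_def Let_def]]
  obtain m where m0: "mtopology_of m = X \<and> countable ?N \<and>
      (\<forall>P\<in>?N. locally_connected_space (subtopology X P)) \<and> (\<forall>C>0. finite {P \<in> ?N. mdiam m P > C})"
    by (rule exE)
  have m: "mtopology_of m = X" using m0 by (rule conjunct1)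
  have N: "finite {P \<in> ?N. mdiam m P > C}" if "C > 0" for C
    using m0 that by blast
  have Nlc: "locally_connected_space (subtopology X P)"
    if "P \<in> connected_components_of X" "\<not> (\<exists>x. P = {x})" for P
    using m0 that by blast
  define M where "M = mspace m"
  define dd where "dd = mdist m"
  have Md: "m = metric (M, dd)" "Metric_space M dd" unfolding M_def dd_def by simp_all
  interpret Metric_space M dd by (rule Md(2))
  have top: "mtopology = X" using m unfolding Md(1) mtopology_of by simp
  have DM: "D = M" using topspace_X top topspace_mtopology by simp
  then have MD: "x \<in> D \<longleftrightarrow> x \<in> M" for x by simp
  have bdP: "mbounded P" if "P \<subseteq> D" for P
  proof -
    have "compactin mtopology (topspace mtopology)" using X_space(2) unfolding top compact_space_def .
    then have "mbounded M" using compactin_imp_mbounded by simp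
    then show ?thesis using mbounded_subset that DM by blast
  qed
  show ?thesis
    unfolding locally_peano_def
  proof (intro ballI allI impI, elim conjE)
    fix d U assume d: "d \<in> D" and U: "openin (top_of_set K) U" "d \<subseteq> U"
    define \<U> where "\<U> = {e \<in> D. e \<subseteq> U}"
    have "openin X \<U>" unfolding openin_X \<U>_def using openin_saturated_core[OF U(1)] by blast
    moreover have "d \<in> \<U>" unfolding \<U>_def using d U by blast
    ultimately obtain r where r: "r > 0" "mball d r \<subseteq> \<U>" using openin_mtopology top by metis
    define r2 where "r2 = r / 2"
    have r2: "r2 > 0" "r2 < r" using r(1) unfolding r2_def by auto
    define Q where "Q = connected_component_of_set X d"
    have dQ: "d \<in> Q" unfolding Q_def using d topspace_X by (simp add: connected_component_of_refl)
    have Qc: "Q \<in> connected_components_of X" unfolding Q_def using d topspace_X by (simp add: connected_components_of_def)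
    have "\<exists>O3 W. openin X O3 \<and> d \<in> O3 \<and> connectedin X W \<and> W \<subseteq> mball d r2 \<and> d \<in> W \<and> Q \<inter> O3 \<subseteq> W"
    \<comment> \<open>\<open>peano_space\<close> postulates local connectedness of non-degenerate
      components only, so a one-point \<open>Q\<close> is served by \<open>W = {d}\<close>.\<close>
    proof (cases "\<exists>x. Q = {x}")
      case True
      then have "Q = {d}" using dQ by auto
      then show ?thesis
        using d r2 topspace_X MD openin_topspace[of X]
        by (intro exI[of _ D] exI[of _ "{d}"]) (auto simp: connectedin_sing)
    next
      case False
      have "openin (subtopology X Q) (Q \<inter> mball d r2)"
        using openin_mball[of d r2] top by (simp add: openin_subtopology_Int2)
      moreover have "d \<in> Q \<inter> mball d r2" using dQ d MD r2 by simp
      ultimately obtain V W where VW: "openin (subtopology X Q) V" "connectedin (subtopology X Q) W"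
          "d \<in> V" "V \<subseteq> W" "W \<subseteq> Q \<inter> mball d r2"
        using Nlc[OF Qc False] unfolding locally_connected_space_iff_weak
          weakly_locally_connected_at_def neighbourhood_base_at_def
        using topspace_subtopology topspace_X d dQ by (metis IntI)
      obtain O3 where "openin X O3" "V = Q \<inter> O3" using VW(1) by (auto simp: openin_subtopology)
      then show ?thesis using VW by (auto simp: connectedin_subtopology)
    qed
    then obtain O3 W where O3: "openin X O3" "d \<in> O3" and W: "connectedin X W" "W \<subseteq> mball d r2" "d \<in> W" "Q \<inter> O3 \<subseteq> W"
      by blast
    define Big where "Big = {P \<in> {P \<in> connected_components_of X. \<not> (\<exists>x. P = {x})}. mdiam m P > r2} - {Q}"
    have finBig: "finite Big" unfolding Big_def using N[OF r2(1)] by simp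
    have dBig: "d \<notin> \<Union>Big"
    proof
      assume "d \<in> \<Union>Big"
      then obtain P where P: "P \<in> connected_components_of X" "P \<noteq> Q" "d \<in> P" unfolding Big_def by blast
      then show False using connected_components_of_overlap[OF P(1) Qc] dQ by blast
    qed
    have "closedin X (\<Union>Big)"
      using finBig unfolding Big_def by (intro closedin_Union) (auto intro: closedin_connected_components_of)
    then have oBig: "openin X (D - \<Union>Big)" using topspace_X by (metis openin_diff openin_topspace)
    define \<V> where "\<V> = (D - \<Union>Big) \<inter> mball d r2 \<inter> O3"
    have oV: "openin X \<V>" unfolding \<V>_def using oBig O3 openin_mball[of d r2] top by (simp add: openin_Int)
    have dV: "d \<in> \<V>" unfolding \<V>_def using d dBig O3 MD r2 by simp
    have VU: "\<V> \<subseteq> \<U>" unfolding \<V>_def using r(2) mball_subset_concentric[of r2 r d] r2 by fastforce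
    show "\<exists>V. openin (top_of_set K) V \<and> d \<subseteq> V \<and> V \<subseteq> U \<and>
        (\<forall>y\<in>V. joined_in K U d y)"
    proof (intro exI[of _ "\<Union>\<V>"] conjI ballI)
      show "openin (top_of_set K) (\<Union>\<V>)" using oV openin_X by blast
      show "d \<subseteq> \<Union>\<V>" using dV by blast
      show "\<Union>\<V> \<subseteq> U" using VU unfolding \<U>_def by blast
      fix y assume "y \<in> \<Union>\<V>"
      then obtain e where e: "e \<in> \<V>" "y \<in> e" by blast
      have eD: "e \<in> D" using e(1) unfolding \<V>_def by blast
      have yK: "y \<in> K" using D_facts(6)[OF eD] e(2) by blast
      have clsy: "cls y = e" using cls_eq[OF eD e(2)] .
      define P where "P = connected_component_of_set X e"
      have eP: "e \<in> P" unfolding P_def using eD topspace_X by (simp add: connected_component_of_refl)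
      have Pc: "P \<in> connected_components_of X" unfolding P_def using eD topspace_X by (simp add: connected_components_of_def)
      have PD: "P \<subseteq> D" unfolding P_def using connected_component_of_subset_topspace topspace_X by metis
      show "joined_in K U d y"
      proof (cases "P = Q")
        case True
        then have eW: "e \<in> W" using eP e(1) W(4) unfolding \<V>_def by blast
        \<comment> \<open>The closure makes the joining set compact; it remains in the closed ball
          of radius \<open>r2\<close>, hence in the open one of radius \<open>r\<close>.\<close>
        let ?C = "X closure_of W"
        have "?C \<subseteq> mcball d r2"
          using W(2) closedin_mcball[of d r2] mball_subset_mcball[of d r2] top by (intro closure_of_minimal) auto
        also have "\<dots> \<subseteq> mball d r" using r2 by auto
        finally have CU: "?C \<subseteq> \<U>" using r(2) by blast
        have WC: "W \<subseteq> ?C" using closure_of_subset[of W X] connectedin_subset_topspace[OF W(1)] by blast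
        have "connected (\<Union>?C)" by (rule connected_Union_X[OF connectedin_closure_of[OF W(1)]])
        moreover have "compact (\<Union>?C)" by (rule compact_Union_X) simp
        moreover have "\<Union>?C \<subseteq> U" using CU unfolding \<U>_def by blast
        moreover have "d \<subseteq> \<Union>?C" using WC W(3) by blast
        moreover have "y \<in> \<Union>?C" using WC eW e(2) by blast
        ultimately show ?thesis by blast
      next
        case False
        have "P \<subseteq> \<U>"
        proof (cases "\<exists>x. P = {x}")
          case True
          then show ?thesis using eP e(1) VU by auto
        next
          case np: False
          have "P \<notin> Big" using eP e(1) unfolding \<V>_def by blast
          then have diamP: "mdiam m P \<le> r2" using Pc np False unfolding Big_def by auto
          show ?thesis
          proof
            fix q assume q: "q \<in> P"
            have "dd e q \<le> r2"
              using mdiam_metric(1)[OF bdP[OF PD] _ eP q] eP diamP unfolding Md(1) by force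
            moreover have "dd d e < r2" using e(1) unfolding \<V>_def by simp
            ultimately have "dd d q < r" using triangle[of d e q] d eD q PD MD unfolding r2_def by fastforce
            moreover have "q \<in> M" "d \<in> M" using q PD MD d by blast+
            ultimately have "q \<in> mball d r" by simp
            then show "q \<in> \<U>" using r(2) by blast
          qed
        qed
        moreover have "\<U> \<subseteq> D" unfolding \<U>_def by blast
        ultimately have "connected_component_set K y \<subseteq> \<Union>\<U>"
          using component_Union_X[OF yK, of \<U>] clsy unfolding P_def by simp
        then show ?thesis unfolding \<U>_def by blast
      qed
    qed
  qed
qed

text \<open>Restricted to one component, the criterion is connectedness im kleinen, since the second
  alternative then offers the whole component; held at every point, this is local connectedness. For
  the diameters, cover the compact hyperspace by finitely many neighbourhoods from the criterion: a
  component of diameter above \<open>C\<close> exceeds every ball of radius \<open>C / 2\<close>, so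
  it contains the centre of each neighbourhood that it meets, and the centres are finite in
  number.\<close>

lemma locally_peano_imp_peano:
  assumes "locally_peano K D"
  shows "peano_space X"
proof -
  obtain M dd where Md: "Metric_space M dd" "X = Metric_space.mtopology M dd"
    using X_space(1) unfolding metrizable_space_def by blast
  interpret Metric_space M dd by (rule Md(1))
  have top: "mtopology = X" using Md(2) by simp
  have DM: "D = M" using topspace_X top topspace_mtopology by simp
  then have MD: "x \<in> D \<longleftrightarrow> x \<in> M" for x by simp
  have bdP: "mbounded P" if "P \<subseteq> D" for P
  proof -
    have "compactin mtopology (topspace mtopology)" using X_space(2) unfolding top compact_space_def .
    then have "mbounded M" using compactin_imp_mbounded by simp
    then show ?thesis using mbounded_subset that DM by blast
  qed
  have loc: "\<exists>\<V>. openin X \<V> \<and> d \<in> \<V> \<and> \<V> \<subseteq> \<U> \<and> (\<forall>e\<in>\<V>. (\<exists>C. connectedin X C \<and> C \<subseteq> \<U> \<and> d \<in> C \<and> e \<in> C) \<or>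
      connected_component_of_set X e \<subseteq> \<U>)" if \<U>: "openin X \<U>" "d \<in> \<U>" for d \<U>
  proof -
    have UD: "\<U> \<subseteq> D" and oU: "openin (top_of_set K) (\<Union>\<U>)" using \<U>(1) openin_X by auto
    have dD: "d \<in> D" using UD \<U>(2) by blast
    have "openin (top_of_set K) (\<Union>\<U>) \<and> d \<subseteq> \<Union>\<U>" using oU \<U>(2) by blast
    from mp[OF spec[OF bspec[OF assms[unfolded locally_peano_def] dD]] this]
    obtain V where V0: "openin (top_of_set K) V \<and> d \<subseteq> V \<and> V \<subseteq> \<Union>\<U> \<and> (\<forall>y\<in>V.
      joined_in K (\<Union>\<U>) d y)"
      by (rule exE)
    then have V: "openin (top_of_set K) V" "d \<subseteq> V" "V \<subseteq> \<Union>\<U>"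
      "\<And>y. y \<in> V \<Longrightarrow> joined_in K (\<Union>\<U>) d y"
      by simp_all
    let ?V = "{e \<in> D. e \<subseteq> V}"
    have sub: "e \<in> \<U>" if e: "e \<in> D" "x \<in> e" "x \<in> \<Union>\<U>" for e x
    proof -
      obtain u where "u \<in> \<U>" "x \<in> u" using e(3) by blast
      then show ?thesis using D_eqI[of e u x] e UD by blast
    qed
    show ?thesis
    proof (intro exI[of _ ?V] conjI ballI)
      show "openin X ?V" unfolding openin_X using openin_saturated_core[OF V(1)] by blast
      show "d \<in> ?V" using dD V(2) by blast
      show "?V \<subseteq> \<U>"
      proof
        fix e assume e: "e \<in> ?V"
        then obtain x where "x \<in> e" using D_facts(2) by blast
        then show "e \<in> \<U>" using sub[of e x] e V(3) by blast
      qed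
      fix e assume e: "e \<in> ?V"
      then obtain y where y: "y \<in> e" "y \<in> V" using D_facts(2)[of e] by blast
      have clsy: "cls y = e" using cls_eq[of e y] e y by blast
      have yK: "y \<in> K" using D_facts(6)[of e] e y by blast
      show "(\<exists>C. connectedin X C \<and> C \<subseteq> \<U> \<and> d \<in> C \<and> e \<in> C) \<or> connected_component_of_set X e \<subseteq> \<U>"
        using V(4)[OF y(2)]
      proof
        assume "\<exists>C. compact C \<and> connected C \<and> C \<subseteq> \<Union>\<U> \<and> d \<subseteq> C \<and> y \<in> C"
        then obtain C where C: "connected C" "C \<subseteq> \<Union>\<U>" "d \<subseteq> C" "y \<in> C" by blast
        have CK: "C \<subseteq> K" using C(2) UD D_facts(1) by blast
        have "cls x \<in> \<U>" if "x \<in> C" for x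
          using sub[OF cls_in(1) cls_in(2)] that C(2) CK by blast
        moreover have "d \<in> cls ` C"
        proof -
          obtain x where "x \<in> d" using D_facts(2)[OF dD] by blast
          then show ?thesis using cls_eq[OF dD, of x] C(3) by blast
        qed
        moreover have "e \<in> cls ` C" using clsy C(4) by blast
        ultimately show ?thesis using connectedin_cls_image[OF C(1) CK] by blast
      next
        assume "connected_component_set K y \<subseteq> \<Union>\<U>"
        then show ?thesis using component_Union_X[OF yK UD] clsy by simp
      qed
    qed
  qed
  let ?N = "{P \<in> connected_components_of X. \<not> (\<exists>x. P = {x})}"
  let ?m = "metric (M, dd)"
  have comp: "P \<subseteq> D" "P \<noteq> {}" "connectedin X P" if "P \<in> connected_components_of X" for P
    using connected_components_of_subset[OF that] nonempty_connected_components_of[OF that]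
      connectedin_connected_components_of[OF that] topspace_X by auto
  have ccP: "connected_component_of_set X e = P" if "P \<in> connected_components_of X" "e \<in> P" for e P
    using that connected_component_in_connected_components_of connected_components_of_overlap
    by (metis (no_types, lifting) comp(1) connected_component_of_refl disjoint_iff mem_Collect_eq subsetD topspace_X)
  have lc: "locally_connected_space (subtopology X P)" if P: "P \<in> connected_components_of X" for P
    unfolding locally_connected_space_im_kleinen
  proof (intro allI impI, elim conjE)
    fix V d assume V: "openin (subtopology X P) V" "d \<in> V"
    obtain \<U> where \<U>: "openin X \<U>" "V = \<U> \<inter> P" using V(1) by (auto simp: openin_subtopology)
    obtain \<V> where \<V>: "openin X \<V>" "d \<in> \<V>" "\<V> \<subseteq> \<U>"
      "\<forall>e\<in>\<V>. (\<exists>C. connectedin X C \<and> C \<subseteq> \<U> \<and> d \<in> C \<and> e \<in> C) \<or> connected_component_of_set X e \<subseteq> \<U>"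
      using loc[OF \<U>(1), of d] V(2) \<U>(2) by blast
    have dP: "d \<in> P" using V(2) \<U>(2) by blast
    show "\<exists>U. openin (subtopology X P) U \<and> d \<in> U \<and> U \<subseteq> V \<and>
       (\<forall>y\<in>U. \<exists>C. connectedin (subtopology X P) C \<and> C \<subseteq> V \<and> d \<in> C \<and> y \<in> C)"
    proof (rule exI[of _ "\<V> \<inter> P"], intro conjI ballI)
      show "openin (subtopology X P) (\<V> \<inter> P)" using \<V>(1) by (auto simp: openin_subtopology)
      show "d \<in> \<V> \<inter> P" using \<V>(2) dP by blast
      show "\<V> \<inter> P \<subseteq> V" using \<V>(3) \<U>(2) by blast
      fix e assume e: "e \<in> \<V> \<inter> P"
      then have "(\<exists>C. connectedin X C \<and> C \<subseteq> \<U> \<and> d \<in> C \<and> e \<in> C) \<or> connected_component_of_set X e \<subseteq> \<U>"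
        using \<V>(4) by blast
      then show "\<exists>C. connectedin (subtopology X P) C \<and> C \<subseteq> V \<and> d \<in> C \<and> e \<in> C"
      proof
        assume "\<exists>C. connectedin X C \<and> C \<subseteq> \<U> \<and> d \<in> C \<and> e \<in> C"
        then obtain C where C: "connectedin X C" "C \<subseteq> \<U>" "d \<in> C" "e \<in> C" by blast
        have "C \<subseteq> P" using connected_component_of_maximal[OF C(1,3)] ccP[OF P dP] by simp
        then show ?thesis using C \<U>(2) by (intro exI[of _ C]) (auto simp: connectedin_subtopology)
      next
        assume "connected_component_of_set X e \<subseteq> \<U>"
        then show ?thesis using ccP[OF P, of e] e dP comp(3)[OF P] \<U>(2)
          by (intro exI[of _ P]) (auto simp: connectedin_subtopology)
      qed
    qed
  qed
  have fin: "finite {P \<in> connected_components_of X. mdiam ?m P > C}" if C: "C > 0" for C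
  proof -
    define h where "h = C / 2"
    have h: "h > 0" using C unfolding h_def by simp
    have "\<forall>d\<in>D. \<exists>\<V>. openin X \<V> \<and> d \<in> \<V> \<and> \<V> \<subseteq> mball d h \<and> (\<forall>e\<in>\<V>. (\<exists>C. connectedin X C \<and> C \<subseteq> mball d h \<and> d \<in> C \<and> e \<in> C) \<or>
      connected_component_of_set X e \<subseteq> mball d h)"
      using loc openin_mball top h MD by (metis centre_in_mball_iff)
    from bchoice[OF this] obtain V where V: "\<forall>d\<in>D. openin X (V d) \<and> d \<in> V d \<and> V d \<subseteq> mball d h \<and>
      (\<forall>e\<in>V d. (\<exists>C. connectedin X C \<and> C \<subseteq> mball d h \<and> d \<in> C \<and> e \<in> C) \<or> connected_component_of_set X e \<subseteq> mball d h)"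
      by (rule exE)
    have "compactin X D" using X_space(2) topspace_X unfolding compact_space_def by simp
    then obtain \<F> where \<F>: "finite \<F>" "\<F> \<subseteq> V ` D" "D \<subseteq> \<Union>\<F>"
      using V unfolding compactin_def by (metis (no_types, lifting) UN_I imageE subsetI)
    obtain T where T: "finite T" "T \<subseteq> D" "\<F> = V ` T"
      using finite_subset_image[OF \<F>(1,2)] by blast
    have "{P \<in> connected_components_of X. mdiam ?m P > C} \<subseteq> connected_component_of_set X ` T"
    proof
      fix P assume "P \<in> {P \<in> connected_components_of X. mdiam ?m P > C}"
      then have P: "P \<in> connected_components_of X" "mdiam ?m P > C" by auto
      obtain e where e: "e \<in> P" using comp(2)[OF P(1)] by blast
      then obtain t where t: "t \<in> T" "e \<in> V t" using comp(1)[OF P(1)] \<F>(3) T(3) by blast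
      have tD: "t \<in> D" using t T by blast
      have "\<not> P \<subseteq> mball t h"
      proof
        assume sub: "P \<subseteq> mball t h"
        have "mdiam ?m P \<le> C"
        proof (rule mdiam_metric(2)[OF bdP[OF comp(1)[OF P(1)]] comp(2)[OF P(1)]])
          fix a b assume ab: "a \<in> P" "b \<in> P"
          then have "dd t a < h" "dd t b < h" "t \<in> M" "a \<in> M" "b \<in> M" using sub by auto
          then show "dd a b \<le> C" using triangle[of a t b] commute[of a t] unfolding h_def by simp
        qed
        then show False using P(2) by simp
      qed
      then obtain C where "connectedin X C" "t \<in> C" "e \<in> C"
        using bspec[OF V tD] t(2) ccP[OF P(1) e] by metis
      then have "t \<in> P" using connected_component_of_maximal[of X C e] ccP[OF P(1) e] by blast
      then show "P \<in> connected_component_of_set X ` T" using ccP[OF P(1)] t(1) by blast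
    qed
    then show ?thesis using T(1) finite_surj by blast
  qed
  \<comment> \<open>Two distinct points give a non-degenerate component positive diameter, so
    countability follows from finiteness at the levels \<open>1 / Suc k\<close>.\<close>
  have "?N \<subseteq> (\<Union>k::nat. {P \<in> connected_components_of X. mdiam ?m P > 1 / Suc k})"
  proof
    fix P assume "P \<in> ?N"
    then have P: "P \<in> connected_components_of X" "\<not> (\<exists>x. P = {x})" by auto
    obtain a where a: "a \<in> P" using comp(2)[OF P(1)] by blast
    then obtain b where b: "b \<in> P" "a \<noteq> b" using P(2) by blast
    have "a \<in> M" "b \<in> M" using a b comp(1)[OF P(1)] MD by auto
    then have "dd a b > 0" using b(2) by simp
    then obtain k where k: "1 / Suc k < dd a b" using nat_approx_posE by blast
    have "dd a b \<le> mdiam ?m P"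
      by (rule mdiam_metric(1)[OF bdP[OF comp(1)[OF P(1)]] comp(2)[OF P(1)] a b(1)])
    then show "P \<in> (\<Union>k::nat. {P \<in> connected_components_of X. mdiam ?m P > 1 / Suc k})"
      using k P(1) less_le_trans by blast
  qed
  moreover have "countable {P \<in> connected_components_of X. mdiam ?m P > 1 / Suc k}" for k :: nat
    by (rule countable_finite[OF fin]) simp
  then have "countable (\<Union>k::nat. {P \<in> connected_components_of X. mdiam ?m P > 1 / Suc k})"
    by (intro countable_UN) auto
  ultimately have "countable ?N" by (rule countable_subset)
  moreover have "finite {P \<in> ?N. mdiam ?m P > C}" if "C > 0" for C
    by (rule finite_subset[OF _ fin[OF that]]) auto
  moreover have "mtopology_of ?m = X" using top by simp
  ultimately show ?thesis
    unfolding peano_space_def Let_def using X_space(2) lc by (intro conjI exI[of _ ?m]) auto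
qed

lemma peano_iff_locally_peano: "peano_space X \<longleftrightarrow> locally_peano K D"
  using peano_imp_locally_peano locally_peano_imp_peano by blast

end

section \<open>Components of the classes of a closed equivalence relation\<close>

lemma hausdorff_lim_approx:
  fixes P :: "nat \<Rightarrow> 'a::heine_borel set"
  assumes lim: "hausdorff_lim P L" and P: "\<And>n. closed (P n)" "\<And>n. P n \<noteq> {}" and z: "z \<in> L"
  obtains w where "\<And>n. w n \<in> P n" "w \<longlonglongrightarrow> z"
proof -
  have "\<forall>n. \<exists>y. y \<in> P n \<and> infdist z (P n) = dist z y"
    using infdist_attains_inf[OF P] by blast
  from choice[OF this] obtain w where w: "\<forall>n. w n \<in> P n \<and> infdist z (P n) = dist z (w n)" by (rule exE)
  have "w \<longlonglongrightarrow> z"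
  proof (rule tendstoI)
    fix e :: real assume "e > 0"
    then have "\<forall>\<^sub>F n in sequentially. (\<forall>x\<in>P n. infdist x L < e) \<and> (\<forall>x\<in>L. infdist x (P n) < e)"
      using lim unfolding hausdorff_lim_def by blast
    then show "\<forall>\<^sub>F n in sequentially. dist (w n) z < e"
      by eventually_elim (use z w in \<open>metis dist_commute\<close>)
  qed
  then show thesis using that w by blast
qed

text \<open>Upper semicontinuity is the point. If the sets \<open>c (u n)\<close> are not inside
  \<open>U\<close> while \<open>u n\<close> tends to \<open>y\<close>, a Hausdorff limit of them is
  a continuum through \<open>y\<close> that still meets \<open>K - U\<close>; closedness of
  \<open>R\<close> puts it into the relation class of \<open>y\<close>, and connectedness into the
  component \<open>c y\<close>. This serves both for preimages of classes and for the relation by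
  fibres.\<close>

lemma monotone_decomp_components:
  fixes K :: "'a::euclidean_space set"
  assumes K: "compact K"
    and refl: "\<And>x. x \<in> K \<Longrightarrow> R x x"
    and sym: "\<And>x y. R x y \<Longrightarrow> R y x"
    and trans: "\<And>x y z. R x y \<Longrightarrow> R y z \<Longrightarrow> R x z"
    and closed: "\<And>u v x y. \<lbrakk>\<And>n. u n \<in> K; \<And>n. v n \<in> K; \<And>n::nat. R (u n) (v n); u \<longlonglongrightarrow> x; v \<longlonglongrightarrow> y\<rbrakk> \<Longrightarrow> R x y"
  shows "monotone_decomp K (\<Union>x\<in>K. components {y \<in> K. R x y})"
proof -
  let ?D = "\<Union>x\<in>K. components {y \<in> K. R x y}"
  define c where "c = (\<lambda>x. connected_component_set {y \<in> K. R x y} x)"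
  have cl_eq: "{y \<in> K. R x y} = {y \<in> K. R z y}" if "R x z" for x z
    using that sym trans by blast
  have D_eq: "?D = c ` K"
  proof
    show "c ` K \<subseteq> ?D" unfolding c_def using refl by (auto intro!: componentsI)
    show "?D \<subseteq> c ` K"
    proof
      fix d assume "d \<in> ?D"
      then obtain x where x: "x \<in> K" "d \<in> components {y \<in> K. R x y}" by blast
      obtain z where "z \<in> {y \<in> K. R x y}" and dz: "d = connected_component_set {y \<in> K. R x y} z"
        by (rule componentsE[OF x(2)])
      then have z: "z \<in> K" "R x z" by auto
      then have "d = c z" unfolding c_def dz using cl_eq[OF z(2)] by simp
      then show "d \<in> c ` K" using z(1) by blast
    qed
  qed
  have c_sub: "c x \<subseteq> {y \<in> K. R x y}" for x unfolding c_def by (rule connected_component_subset)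
  have c_self: "x \<in> c x" if "x \<in> K" for x unfolding c_def using that refl by simp
  have c_conn: "connected (c x)" for x unfolding c_def by simp
  have c_max: "C \<subseteq> c x" if "connected C" "x \<in> C" "C \<subseteq> {y \<in> K. R x y}" for C x
    unfolding c_def using that by (simp add: connected_component_maximal)
  have clc: "closed {y \<in> K. R x y}" if x: "x \<in> K" for x
    unfolding closed_sequential_limits
  proof (intro allI impI, elim conjE)
    fix v y assume v: "\<forall>n. v n \<in> {y \<in> K. R x y}" "v \<longlonglongrightarrow> y"
    have "y \<in> K" using v compact_imp_closed[OF K] unfolding closed_sequential_limits by blast
    moreover have "R x y" by (rule closed[of "\<lambda>_. x" v]) (use v x in auto)
    ultimately show "y \<in> {y \<in> K. R x y}" by simp
  qed
  have c_comp: "compact (c x)" if x: "x \<in> K" for x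
  proof -
    have "{y \<in> K. R x y} = K \<inter> {y \<in> K. R x y}" by blast
    then have "compact {y \<in> K. R x y}" using compact_Int_closed[OF K clc[OF x]] by simp
    moreover have "c x \<in> components {y \<in> K. R x y}" unfolding c_def using x refl by (auto intro: componentsI)
    ultimately show ?thesis using compact_components by blast
  qed
  have c_eq: "c x = c z" if z: "z \<in> c x" for x z
  proof -
    have R: "R x z" using z c_sub by blast
    have "c x = connected_component_set {y \<in> K. R x y} z"
      using z unfolding c_def by (simp add: connected_component_eq)
    also have "\<dots> = c z" unfolding c_def using cl_eq[OF R] by simp
    finally show ?thesis .
  qed
  show ?thesis
    unfolding monotone_decomp_def D_eq
  proof (intro conjI ballI)
    show "\<Union>(c ` K) = K" using c_sub c_self by blast
    show "pairwise disjnt (c ` K)"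
      unfolding pairwise_def disjnt_def using c_eq by blast
    show "usc_decomp K (c ` K)"
      unfolding usc_decomp_def
    proof (intro ballI allI impI, elim conjE)
      fix d U assume U: "openin (top_of_set K) U"
      let ?E = "\<Union>{e \<in> c ` K. e \<subseteq> U}"
      have EK: "?E \<subseteq> K" using c_sub by blast
      have KU: "compact (K - U)"
        using closedin_compact[OF K] U by (simp add: openin_closedin_eq)
      have "closedin (top_of_set K) (K - ?E)"
      proof (rule closed_subset)
        show "closed (K - ?E)"
          unfolding closed_sequential_limits
        proof (intro allI impI, elim conjE)
          fix u y assume u: "\<forall>n. u n \<in> K - ?E" "u \<longlonglongrightarrow> y"
          have uK: "u n \<in> K" for n using u by blast
          have y: "y \<in> K" using u(2) uK compact_imp_closed[OF K] unfolding closed_sequential_limits by blast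
          have uU: "c (u n) \<inter> (K - U) \<noteq> {}" for n
          proof -
            have "u n \<notin> ?E" using u by blast
            then have "\<not> c (u n) \<subseteq> U" using c_self[OF uK] uK by blast
            then show ?thesis using c_sub by blast
          qed
          have cne: "c (u n) \<noteq> {}" "c (u n) \<subseteq> K" for n using c_self[OF uK] c_sub by blast+
          obtain r L where r: "strict_mono r" and L: "compact L" "L \<noteq> {}" "L \<subseteq> K" "hausdorff_lim ((\<lambda>n. c (u n)) \<circ> r) L"
            by (rule hausdorff_lim_exists[OF K, of "\<lambda>n. c (u n)"]) (use cne in blast)+
          have ur: "(\<lambda>n. u (r n)) \<longlonglongrightarrow> y" using LIMSEQ_subseq_LIMSEQ[OF u(2) r] by (simp add: o_def)
          have "connected L" by (rule hausdorff_lim_connected[OF L(4,1)]) (use c_conn cne in auto)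
          moreover have "y \<in> L"
            by (rule hausdorff_lim_mem[OF L(4) compact_imp_closed[OF L(1)] L(2) _ ur]) (use c_self[OF uK] in simp)
          moreover have "L \<subseteq> {z \<in> K. R y z}"
          proof
            fix z assume z: "z \<in> L"
            have cl: "closed (((\<lambda>n. c (u n)) \<circ> r) n)" "((\<lambda>n. c (u n)) \<circ> r) n \<noteq> {}" for n
              using compact_imp_closed[OF c_comp[OF uK]] cne by auto
            obtain w where w: "\<And>n. w n \<in> ((\<lambda>n. c (u n)) \<circ> r) n" "w \<longlonglongrightarrow> z"
              by (rule hausdorff_lim_approx[OF L(4) cl z]) (rule that)
            have "w n \<in> K" "R (u (r n)) (w n)" for n using w(1)[of n] c_sub by auto
            then have "R y z" by (intro closed[OF _ _ _ ur w(2)]) (use uK in auto)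
            then show "z \<in> {z \<in> K. R y z}" using z L(3) by blast
          qed
          ultimately have "L \<subseteq> c y" by (rule c_max)
          moreover have "L \<inter> (K - U) \<noteq> {}"
            by (rule hausdorff_lim_meets[OF L(4) compact_imp_closed[OF L(1)] L(2) KU]) (use uU in simp)
          ultimately have "\<not> c y \<subseteq> U" by blast
          moreover have "c y = e" if "y \<in> e" "e \<in> c ` K" for e
            using that c_eq by blast
          ultimately have "y \<notin> ?E" by blast
          then show "y \<in> K - ?E" using y by blast
        qed
      qed blast
      then show "openin (top_of_set K) ?E"
        using EK by (simp add: openin_closedin_eq)
    qed
  qed (use c_self c_comp c_conn in auto)
qed

text \<open>The hyperspace is Hausdorff and \<open>cls\<close> continuous, so distinct limit classes
  would have disjoint neighbourhoods that the common classes of late terms enter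
  simultaneously.\<close>

lemma (in monotone_decomposition) cls_closed:
  assumes "\<And>n. u n \<in> K" "\<And>n. v n \<in> K" "\<And>n::nat. cls (u n) = cls (v n)" "u \<longlonglongrightarrow> x" "v \<longlonglongrightarrow> y"
  shows "cls x = cls y"
proof (rule ccontr)
  assume ne: "cls x \<noteq> cls y"
  have "closed K" using compact_K by (rule compact_imp_closed)
  then have xy: "x \<in> K" "y \<in> K" using assms unfolding closed_sequential_limits by blast+
  obtain \<U> \<V> where UV: "openin X \<U>" "openin X \<V>" "cls x \<in> \<U>" "cls y \<in> \<V>" "disjnt \<U> \<V>"
    using X_space(3) ne cls_in(1)[OF xy(1)] cls_in(1)[OF xy(2)] topspace_X unfolding Hausdorff_space_def by metis
  have ev: "\<forall>\<^sub>F n in sequentially. cls (w n) \<in> \<W>"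
    if w: "\<And>n. w n \<in> K" "w \<longlonglongrightarrow> z" "z \<in> K" and W: "openin X \<W>" "cls z \<in> \<W>" for w :: "nat \<Rightarrow> 'a" and z \<W>
  proof -
    have "openin (top_of_set K) {x \<in> K. cls x \<in> \<W>}"
      using openin_continuous_map_preimage[OF continuous_cls W(1)] by simp
    then obtain G where G: "open G" "{x \<in> K. cls x \<in> \<W>} = K \<inter> G" by (auto simp: openin_open)
    have "z \<in> G" using G(2) w(3) W(2) by blast
    then have "\<forall>\<^sub>F n in sequentially. w n \<in> G" using w(2) G(1) by (simp add: topological_tendstoD)
    then show ?thesis by eventually_elim (use w(1) G(2) in blast)
  qed
  have "\<forall>\<^sub>F n in sequentially. cls (u n) \<in> \<U> \<and> cls (v n) \<in> \<V>"
    using ev[OF assms(1,4) xy(1) UV(1,3)] ev[OF assms(2,5) xy(2) UV(2,4)] by (rule eventually_conj)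
  then obtain n where "cls (u n) \<in> \<U>" "cls (v n) \<in> \<V>" unfolding eventually_sequentially by blast
  then show False using assms(3)[of n] UV(5) unfolding disjnt_def by auto
qed

subsection \<open>Open maps with finite fibres\<close>

text \<open>What is used of a rational map. Openness makes lifts of continua surjective and fibres
  lower semicontinuous; the uniform bound \<open>N\<close> counts the lifts.\<close>

locale finite_open_map = topological_sphere S for S :: "'a::euclidean_space set" +
  fixes f :: "'a \<Rightarrow> 'a" and N :: nat
  assumes cont_f: "continuous_on S f" and f_into: "f ` S \<subseteq> S"
    and open_f: "\<And>U. openin (top_of_set S) U \<Longrightarrow> openin (top_of_set S) (f ` U)"
    and finite_fibre: "\<And>y. y \<in> S \<Longrightarrow> finite (S \<inter> f -` {y})"
    and card_fibre: "\<And>y. y \<in> S \<Longrightarrow> card (S \<inter> f -` {y}) \<le> N"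
begin

lemma openin_pre: "openin (top_of_set S) V \<Longrightarrow> openin (top_of_set S) (S \<inter> f -` V)"
  using continuous_openin_preimage[OF cont_f _] f_into by (auto simp: Pi_iff)

lemma compact_pre: "compact d \<Longrightarrow> compact (S \<inter> f -` d)"
proof -
  assume "compact d"
  then have "closedin (top_of_set S) (S \<inter> f -` d)"
    by (intro continuous_closedin_preimage cont_f compact_imp_closed)
  then show ?thesis using closedin_compact[OF compact_S] by blast
qed

lemma image_Int_pre: "f ` ((S \<inter> f -` d) \<inter> U) = f ` (S \<inter> U) \<inter> d"
  by blast

text \<open>If a point \<open>y\<close> of \<open>d\<close> were missed, its finite fibre would be
  avoided by a compact, relatively open \<open>U\<close> containing \<open>C\<close> (Sura-Bura).
  Openness of \<open>f\<close> and compactness make the image of \<open>U\<close> clopen in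
  \<open>d\<close>, hence all of \<open>d\<close>, and \<open>y\<close> belongs to it.\<close>

lemma component_pre_compact:
  assumes d: "compact d" "connected d" "d \<subseteq> S" and C: "C \<in> components (S \<inter> f -` d)"
  shows "f ` C = d"
proof
  show "f ` C \<subseteq> d" using in_components_subset[OF C] by blast
  show "d \<subseteq> f ` C"
  proof (rule ccontr)
    assume "\<not> d \<subseteq> f ` C"
    then obtain y where y: "y \<in> d" "y \<notin> f ` C" by blast
    let ?F = "S \<inter> f -` {y}"
    have "finite ?F" using finite_fibre[of y] y d(3) by blast
    then have "open (- ?F)" by (intro open_Compl finite_imp_closed)
    moreover have "C \<subseteq> - ?F" using y(2) by blast
    moreover have "locally compact (S \<inter> f -` d)" using compact_pre[OF d(1)] closed_imp_locally_compact compact_imp_closed by blast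
    moreover have "compact C" using compact_components[OF compact_pre[OF d(1)] C] .
    ultimately obtain U where U: "openin (top_of_set (S \<inter> f -` d)) U" "compact U" "C \<subseteq> U" "U \<subseteq> - ?F"
      using Sura_Bura_clopen_subset[OF _ C] by metis
    obtain O' where O': "open O'" "U = (S \<inter> f -` d) \<inter> O'" using U(1) by (auto simp: openin_open)
    have US: "U \<subseteq> S" using O' by blast
    have "f ` U = d \<inter> f ` (S \<inter> O')" using O'(2) image_Int_pre by blast
    moreover have "openin (top_of_set S) (f ` (S \<inter> O'))" by (intro open_f openin_open_Int O'(1))
    then obtain G where "open G" "f ` (S \<inter> O') = S \<inter> G" by (auto simp: openin_open)
    ultimately have "f ` U = d \<inter> G" "open G" using d(3) by auto
    then have 1: "openin (top_of_set d) (f ` U)" by (simp add: openin_open_Int)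
    have "compact (f ` U)" using U(2) US cont_f by (meson compact_continuous_image continuous_on_subset)
    moreover have "f ` U \<subseteq> d" using O'(2) by blast
    ultimately have 2: "closedin (top_of_set d) (f ` U)" using closed_subset compact_imp_closed by blast
    have "f ` U \<noteq> {}" using U(3) in_components_nonempty[OF C] by blast
    then have "f ` U = d" using d(2) 1 2 unfolding connected_clopen by blast
    then obtain x where "x \<in> U" "f x = y" using y(1) by blast
    then show False using U(4) US by blast
  qed
qed

text \<open>\<open>C\<close> is open since \<open>S\<close> is locally connected, and relatively
  closed in the preimage of \<open>V\<close>. Hence its image is clopen in \<open>V\<close>;
  closedness comes from compactness of \<open>S\<close>, after writing \<open>C\<close> as the trace
  of a closed set \<open>F\<close>.\<close>

lemma component_pre_open:
  assumes V: "openin (top_of_set S) V" "connected V" and C: "C \<in> components (S \<inter> f -` V)"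
  shows "f ` C = V" "openin (top_of_set S) C"
proof -
  have VS: "V \<subseteq> S" using V(1) openin_imp_subset by blast
  have op: "openin (top_of_set S) (S \<inter> f -` V)" using openin_pre[OF V(1)] .
  have lc: "locally connected S" using locally_path_connected_S by (rule locally_path_connected_imp_locally_connected)
  show oC: "openin (top_of_set S) C"
    using lc op C unfolding locally_connected_open_component by blast
  have sub: "f ` C \<subseteq> V" using in_components_subset[OF C] by blast
  have 1: "openin (top_of_set V) (f ` C)"
    using open_f[OF oC] sub VS by (meson openin_subset_trans)
  have "closedin (top_of_set (S \<inter> f -` V)) C" using closedin_component[OF C] .
  then obtain F where F: "closed F" "C = (S \<inter> f -` V) \<inter> F" by (auto simp: closedin_closed)
  have "compact (f ` (S \<inter> F))"
    using compact_Int_closed[OF compact_S F(1)] cont_f by (meson compact_continuous_image continuous_on_subset inf_le1)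
  moreover have "f ` C = V \<inter> f ` (S \<inter> F)" using F(2) image_Int_pre by blast
  ultimately have 2: "closedin (top_of_set V) (f ` C)" using closedin_closed_Int compact_imp_closed by metis
  have "f ` C \<noteq> {}" using in_components_nonempty[OF C] by blast
  then show "f ` C = V" using V(2) 1 2 unfolding connected_clopen by blast
qed

text \<open>Each component maps onto \<open>A\<close>, so it picks a point of the fibre over one
  fixed \<open>y\<close>, and different components pick different points.\<close>

lemma components_pre_finite:
  assumes onto: "\<And>C. C \<in> components (S \<inter> f -` A) \<Longrightarrow> f ` C = A" and A: "A \<subseteq> S"
  shows "finite (components (S \<inter> f -` A))" "card (components (S \<inter> f -` A)) \<le> N"
proof -
  let ?C = "components (S \<inter> f -` A)"
  have "finite ?C \<and> card ?C \<le> N"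
  proof (cases "A = {}")
    case False
    then obtain y where y: "y \<in> A" by blast
    have "\<forall>C\<in>?C. \<exists>x. x \<in> C \<and> f x = y"
      using onto y by (metis imageE)
    from bchoice[OF this] obtain h where h: "\<forall>C\<in>?C. h C \<in> C \<and> f (h C) = y" by (rule exE)
    have "inj_on h ?C"
    proof (rule inj_onI)
      fix C C' assume C: "C \<in> ?C" "C' \<in> ?C" "h C = h C'"
      then have "h C \<in> C \<inter> C'" using h by auto
      then show "C = C'" using components_nonoverlap[OF C(1,2)] by blast
    qed
    moreover have "h ` ?C \<subseteq> S \<inter> f -` {y}" using h in_components_subset by fastforce
    ultimately show ?thesis
      using finite_fibre[of y] card_fibre[of y] y A
      by (meson card_inj_on_le finite_subset inj_on_finite le_trans subsetD)
  qed simp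
  then show "finite ?C" "card ?C \<le> N" by auto
qed

text \<open>Openness as lower semicontinuity of preimages: the image of a ball about
  \<open>z\<close> contains a neighbourhood of \<open>f z\<close> in \<open>S\<close>, which late
  sets \<open>P n\<close> enter.\<close>

lemma pre_approx:
  assumes z: "z \<in> S" and P: "\<And>n. P n \<subseteq> S" "\<And>n. P n \<noteq> {}" "(\<lambda>n. infdist (f z) (P n)) \<longlonglongrightarrow> 0" and e: "e > 0"
  shows "\<forall>\<^sub>F n in sequentially. \<exists>x\<in>S \<inter> f -` P n. dist z x < e"
proof -
  have "openin (top_of_set S) (f ` (S \<inter> ball z e))" by (intro open_f openin_open_Int open_ball)
  then obtain O' where O': "open O'" "f ` (S \<inter> ball z e) = S \<inter> O'" by (auto simp: openin_open)
  have "f z \<in> O'" using O'(2) z e by (metis IntE IntI centre_in_ball imageI)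
  then obtain d where d: "d > 0" "ball (f z) d \<subseteq> O'" using O'(1) open_contains_ball by blast
  have "\<forall>\<^sub>F n in sequentially. infdist (f z) (P n) < d"
    using P(3) d(1) by (rule order_tendstoD)
  then show ?thesis
  proof eventually_elim
    case (elim n)
    then obtain p where p: "p \<in> P n" "dist (f z) p < d" using infdist_less_iff[OF P(2)] by blast
    then have "p \<in> S \<inter> O'" using P(1) d(2) by auto
    then obtain x where x: "x \<in> S \<inter> ball z e" "p = f x" using O'(2) by blast
    then show ?case using p(1) by auto
  qed
qed

lemma monotone_pre:
  assumes K: "compact K" "K \<subseteq> S" and D: "monotone_decomp K D"
  shows "monotone_decomp (S \<inter> f -` K) (\<Union>d\<in>D. components (S \<inter> f -` d))"
proof -
  interpret M: monotone_decomposition K D by unfold_locales (use K D in auto)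
  let ?K = "S \<inter> f -` K"
  let ?R = "\<lambda>x y. M.cls (f x) = M.cls (f y)"
  have "monotone_decomp ?K (\<Union>x\<in>?K. components {y \<in> ?K. ?R x y})"
  proof (rule monotone_decomp_components)
    show "compact ?K" using compact_pre[OF K(1)] .
    fix u v x y assume uv: "\<And>n. u n \<in> ?K" "\<And>n. v n \<in> ?K" "\<And>n::nat. ?R (u n) (v n)" "u \<longlonglongrightarrow> x" "v \<longlonglongrightarrow> y"
    have "closed ?K" using compact_pre[OF K(1)] compact_imp_closed by blast
    then have xy: "x \<in> S" "y \<in> S" using uv unfolding closed_sequential_limits by blast+
    have lim: "(\<lambda>n. f (w n)) \<longlonglongrightarrow> f z" if "\<And>n. w n \<in> ?K" "w \<longlonglongrightarrow> z" "z \<in> S" for w :: "nat \<Rightarrow> 'a" and z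
      using cont_f that unfolding continuous_on_sequentially by (auto simp: o_def)
    show "?R x y"
      by (rule M.cls_closed[OF _ _ _ lim[OF uv(1,4) xy(1)] lim[OF uv(2,5) xy(2)]]) (use uv in auto)
  qed auto
  moreover have "(\<Union>x\<in>?K. components {y \<in> ?K. ?R x y}) = (\<Union>d\<in>D. components (S \<inter> f -` d))"
  proof -
    have eq: "{y \<in> ?K. ?R x y} = S \<inter> f -` (M.cls (f x))" if x: "x \<in> ?K" for x
    proof
      show "{y \<in> ?K. ?R x y} \<subseteq> S \<inter> f -` M.cls (f x)" using M.cls_in(2) by auto
      show "S \<inter> f -` M.cls (f x) \<subseteq> {y \<in> ?K. ?R x y}"
      proof
        fix y assume y: "y \<in> S \<inter> f -` M.cls (f x)"
        have d: "M.cls (f x) \<in> D" using M.cls_in(1) x by blast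
        show "y \<in> {y \<in> ?K. ?R x y}" using y M.cls_eq[OF d, of "f y"] M.D_facts(6)[OF d] by auto
      qed
    qed
    show ?thesis
    proof (rule set_eqI)
      fix C
      have "C \<in> components (S \<inter> f -` d) \<and> d \<in> D \<longleftrightarrow>
          (\<exists>x\<in>?K. d = M.cls (f x) \<and> C \<in> components (S \<inter> f -` M.cls (f x)))" for d
      proof
        assume C: "C \<in> components (S \<inter> f -` d) \<and> d \<in> D"
        then obtain x where x: "x \<in> S" "f x \<in> d"
          using in_components_nonempty in_components_subset by blast
        then have "x \<in> ?K" "d = M.cls (f x)" using M.D_facts(6)[of d] M.cls_eq[of d] C by auto
        then show "\<exists>x\<in>?K. d = M.cls (f x) \<and> C \<in> components (S \<inter> f -` M.cls (f x))" using C by blast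
      qed (use M.cls_in(1) in blast)
      then have "(\<exists>d\<in>D. C \<in> components (S \<inter> f -` d)) \<longleftrightarrow>
          (\<exists>x\<in>?K. C \<in> components (S \<inter> f -` M.cls (f x)))" by blast
      also have "\<dots> \<longleftrightarrow> (\<exists>x\<in>?K. C \<in> components {y \<in> ?K. ?R x y})"
        by (intro bex_cong refl) (simp only: eq)
      finally show "C \<in> (\<Union>x\<in>?K. components {y \<in> ?K. ?R x y}) \<longleftrightarrow> C \<in> (\<Union>d\<in>D. components (S \<inter> f -` d))"
        by blast
    qed
  qed
  ultimately show ?thesis by simp
qed

end

text \<open>Finitely many disjoint closed classes cannot split a connected set. This is the source
  of infinitely many classes in \<open>many_classes\<close>, and it also finishes the comparison of
  the two decompositions.\<close>

lemma (in monotone_decomposition) cls_constant_if_finite: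
  assumes "connected C" "C \<subseteq> K" "finite (cls ` C)" "x \<in> C" "y \<in> C"
  shows "cls x = cls y"
proof -
  have cl: "closed d" if "d \<in> cls ` C" for d
    using that assms(2) cls_in(1) D_facts(3) compact_imp_closed by blast
  let ?R = "\<Union>(cls ` C - {cls x})"
  have 1: "closed (cls x)" using cl assms(4) by blast
  have 2: "closed ?R" using assms(3) cl by (intro closed_Union) auto
  have 3: "C \<subseteq> cls x \<union> ?R" using cls_in(2) assms(2) by blast
  have 4: "cls x \<inter> ?R \<inter> C = {}"
  proof -
    have False if z: "z \<in> cls x" "w \<in> C" "cls w \<noteq> cls x" "z \<in> cls w" for z w
      using D_eqI[of "cls x" "cls w" z] z cls_in(1) assms(2,4) by blast
    then show ?thesis by blast
  qed
  have "cls x \<inter> C \<noteq> {}" using cls_in(2)[of x] assms(2,4) by blast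
  then have "?R \<inter> C = {}" using connected_closedD[OF assms(1) 4 3 1 2] by blast
  then have "cls y \<notin> cls ` C - {cls x}" using assms(2,5) cls_in(2)[of y] by blast
  then show ?thesis using assms(5) by blast
qed

lemma (in monotone_decomposition) many_classes:
  assumes "connected C" "C \<subseteq> K" "x \<in> C" "y \<in> C" "cls x \<noteq> cls y"
  obtains Z where "finite Z" "Z \<subseteq> C" "card Z = m" "inj_on cls Z"
proof -
  have "infinite (cls ` C)" using cls_constant_if_finite[OF assms(1,2) _ assms(3,4)] assms(5) by blast
  then obtain T where T: "finite T" "card T = m" "T \<subseteq> cls ` C"
    using infinite_arbitrarily_large by blast
  then obtain Z where Z: "Z \<subseteq> C" "inj_on cls Z" "T = cls ` Z"
    unfolding subset_image_inj by blast
  show thesis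
    by (rule that[of Z]) (use Z T in \<open>auto simp: card_image finite_image_iff\<close>)
qed

section \<open>Lifting the local criterion\<close>

context finite_open_map
begin

lemma connected_subset_one_side:
  assumes "connected C" "open G1" "open G2" "G1 \<inter> G2 = {}" "C \<subseteq> G1 \<union> G2" "x \<in> C" "x \<in> G1"
  shows "C \<subseteq> G1"
  using assms unfolding connected_def by blast

text \<open>Let \<open>e\<close> lie over the class \<open>d\<close>. The finitely many components
  over \<open>d\<close> are separated by open sets \<open>G1\<close> around \<open>e\<close> and
  \<open>G2\<close> around the others, and over a small neighbourhood of \<open>d\<close> the
  preimage stays in their union. A continuum \<open>C\<close> joining \<open>d\<close> to
  \<open>f x\<close> lifts to a component \<open>B\<close> through \<open>x\<close> that maps onto
  \<open>C\<close>; it stays in \<open>G1\<close>, so its points over \<open>d\<close> belong to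
  \<open>e\<close>.\<close>

lemma locally_peano_pre:
  assumes K: "compact K" "K \<subseteq> S" and D: "monotone_decomp K D" and peano: "locally_peano K D"
  shows "locally_peano (S \<inter> f -` K) (\<Union>d\<in>D. components (S \<inter> f -` d))"
  unfolding locally_peano_def
proof (intro ballI allI impI, elim conjE)
  interpret M: monotone_decomposition K D by unfold_locales (use K D in auto)
  let ?K = "S \<inter> f -` K"
  fix e U assume "e \<in> (\<Union>d\<in>D. components (S \<inter> f -` d))" and U: "openin (top_of_set ?K) U" "e \<subseteq> U"
  then obtain d where d: "d \<in> D" "e \<in> components (S \<inter> f -` d)" by blast
  obtain O' where O': "open O'" "U = ?K \<inter> O'" using U(1) by (auto simp: openin_open)
  have dS: "d \<subseteq> S" using M.D_facts(6)[OF d(1)] K(2) by blast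
  have cd: "compact d" "connected d" "d \<noteq> {}" using M.D_facts(2-4) d(1) by auto
  have fin: "finite (components (S \<inter> f -` d))"
    by (rule components_pre_finite(1)[OF component_pre_compact dS]) (use cd dS in auto)
  have clc: "closed c" if "c \<in> components (S \<inter> f -` d)" for c
    using compact_components[OF compact_pre[OF cd(1)] that] compact_imp_closed by blast
  define R where "R = \<Union>(components (S \<inter> f -` d) - {e})"
  have "closed R" unfolding R_def using fin clc by (intro closed_Union) auto
  moreover have "e \<inter> R = {}" unfolding R_def using components_nonoverlap[OF d(2)] by blast
  ultimately obtain G1' G2 where G0: "open G1'" "open G2" "e \<subseteq> G1'" "R \<subseteq> G2" "G1' \<inter> G2 = {}"
    using separation_normal[OF clc[OF d(2)]] by metis
  define G1 where "G1 = G1' \<inter> O'"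
  have G: "open G1" "e \<subseteq> G1" "G1 \<inter> G2 = {}" "G1 \<subseteq> O'" unfolding G1_def using G0 O' U(2) by auto
  have preW: "S \<inter> f -` d \<subseteq> G1 \<union> G2"
  proof -
    have "S \<inter> f -` d = \<Union>(components (S \<inter> f -` d))" by (simp add: Union_components)
    also have "\<dots> \<subseteq> e \<union> R" unfolding R_def by blast
    finally show ?thesis using G(2) G0(4) by blast
  qed
  have eG: "S \<inter> f -` d \<inter> G1 \<subseteq> e"
  proof
    fix x assume x: "x \<in> S \<inter> f -` d \<inter> G1"
    then obtain c where "c \<in> components (S \<inter> f -` d)" "x \<in> c" by (metis IntD1 Union_components UnionE)
    then show "x \<in> e" using x G0(4) G(3) unfolding R_def by blast
  qed
  \<comment> \<open>The points of \<open>K\<close> whose whole fibre lies in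
    \<open>G1 \<union> G2\<close>; open in \<open>K\<close> because the rest of \<open>S\<close> is
    compact and so has a closed image.\<close>
  define U0 where "U0 = K - f ` (S - (G1 \<union> G2))"
  have "compact (S - (G1 \<union> G2))" using compact_S G(1) G0(2) by (simp add: compact_diff open_Un)
  then have cf: "closed (f ` (S - (G1 \<union> G2)))"
    using cont_f by (meson Diff_subset compact_continuous_image compact_imp_closed continuous_on_subset)
  have oU0: "openin (top_of_set K) U0"
    unfolding U0_def Diff_eq[of K] by (rule openin_open_Int[OF open_Compl[OF cf]])
  have dU0: "d \<subseteq> U0" unfolding U0_def using M.D_facts(6)[OF d(1)] preW by auto
  have pU0: "S \<inter> f -` U0 \<subseteq> G1 \<union> G2" unfolding U0_def by blast
  have "openin (top_of_set K) U0 \<and> d \<subseteq> U0" using oU0 dU0 by (rule conjI)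
  from mp[OF spec[OF bspec[OF peano[unfolded locally_peano_def] d(1)]] this]
  obtain V where V0: "openin (top_of_set K) V \<and> d \<subseteq> V \<and> V \<subseteq> U0 \<and> (\<forall>y\<in>V.
      joined_in K U0 d y)"
    by (rule exE)
  then have V: "openin (top_of_set K) V" "d \<subseteq> V" "V \<subseteq> U0" by simp_all
  have Vy: "joined_in K U0 d y"
    if "y \<in> V" for y using V0 that by blast
  have U0K: "U0 \<subseteq> K" unfolding U0_def by blast
  show "\<exists>V. openin (top_of_set ?K) V \<and> e \<subseteq> V \<and> V \<subseteq> U \<and>
      (\<forall>y\<in>V. joined_in ?K U e y)"
  proof (rule exI[of _ "(S \<inter> f -` V) \<inter> G1"], intro conjI ballI)
    have "continuous_on ?K f" using cont_f by (rule continuous_on_subset) blast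
    then have "openin (top_of_set ?K) (?K \<inter> f -` V)"
      using continuous_openin_preimage[of ?K f K V] V(1) by auto
    moreover have "?K \<inter> f -` V = S \<inter> f -` V" using V(3) U0K by blast
    ultimately show "openin (top_of_set ?K) (S \<inter> f -` V \<inter> G1)"
      using G(1) by (metis openin_Int_open)
    show "e \<subseteq> S \<inter> f -` V \<inter> G1" using in_components_subset[OF d(2)] V(2) G(2) by blast
    show "S \<inter> f -` V \<inter> G1 \<subseteq> U" using V(3) U0K G(4) O'(2) by blast
    fix x assume x: "x \<in> S \<inter> f -` V \<inter> G1"
    have in_U: "C \<subseteq> U" if C: "connected C" "C \<subseteq> S \<inter> f -` U0" "x \<in> C" for C
    proof -
      have "C \<subseteq> G1" by (rule connected_subset_one_side[OF C(1) G(1) G0(2) G(3) _ C(3)]) (use C pU0 x in auto)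
      then show ?thesis using C(2) U0K G(4) O'(2) by blast
    qed
    have "f x \<in> V" using x by blast
    from Vy[OF this]
    show "joined_in ?K U e x"
    proof
      assume "\<exists>C. compact C \<and> connected C \<and> C \<subseteq> U0 \<and> d \<subseteq> C \<and> f x \<in> C"
      then obtain C where C: "compact C" "connected C" "C \<subseteq> U0" "d \<subseteq> C" "f x \<in> C" by blast
      have CS: "C \<subseteq> S" using C(3) U0K K(2) by blast
      define B where "B = connected_component_set (S \<inter> f -` C) x"
      have xC: "x \<in> S \<inter> f -` C" using x C(5) by blast
      have Bc: "B \<in> components (S \<inter> f -` C)" unfolding B_def using xC by (rule componentsI)
      have xB: "x \<in> B" unfolding B_def using xC by simp
      have Bsub: "B \<subseteq> S \<inter> f -` C" using in_components_subset[OF Bc] .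
      have fB: "f ` B = C" by (rule component_pre_compact[OF C(1,2) CS Bc])
      have Bcon: "connected B" using in_components_connected[OF Bc] .
      have BG: "B \<subseteq> G1"
      proof (rule connected_subset_one_side[OF Bcon G(1) G0(2) G(3) _ xB])
        have "S \<inter> f -` C \<subseteq> S \<inter> f -` U0" using C(3) by blast
        then show "B \<subseteq> G1 \<union> G2" using Bsub pU0 by blast
      qed (use x in blast)
      obtain y where y: "y \<in> d" using cd(3) by blast
      then obtain x' where x': "x' \<in> B" "f x' = y" using fB C(4) by (metis imageE subsetD)
      have "x' \<in> S \<inter> f -` d \<inter> G1" using x' y Bsub BG by blast
      then have "x' \<in> e" using eG by blast
      then have "connected (B \<union> e)"
        using Bcon in_components_connected[OF d(2)] x'(1) by (intro connected_Un) auto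
      moreover have "compact (B \<union> e)"
        using compact_components[OF compact_pre[OF C(1)] Bc] compact_components[OF compact_pre[OF cd(1)] d(2)]
        by (rule compact_Un)
      moreover have "B \<union> e \<subseteq> U" using in_U[OF Bcon _ xB] Bsub C(3) U(2) by blast
      ultimately show ?thesis using xB by blast
    next
      assume R: "connected_component_set K (f x) \<subseteq> U0"
      let ?C = "connected_component_set ?K x"
      have CK: "?C \<subseteq> ?K" by (rule connected_component_subset)
      have xC: "x \<in> ?C" using x V(3) U0K by auto
      have "connected (f ` ?C)"
        using cont_f CK by (intro connected_continuous_image) (auto intro: continuous_on_subset)
      then have "f ` ?C \<subseteq> connected_component_set K (f x)"
        using CK xC by (intro connected_component_maximal) auto
      then have "?C \<subseteq> S \<inter> f -` U0" using R CK by blast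
      then have "?C \<subseteq> U" using in_U[of ?C] xC by simp
      then show ?thesis ..
    qed
  qed
qed

end

subsection \<open>The decomposition by fibres\<close>

locale fibre_relation = finite_open_map S f N for S :: "'a::euclidean_space set" and f N +
  fixes K :: "'a set" and D :: "'a set set"
  assumes K: "compact K" "K \<subseteq> S" and D: "monotone_decomp (S \<inter> f -` K) D"
begin

sublocale M: monotone_decomposition "S \<inter> f -` K" D
  by unfold_locales (use compact_pre[OF K(1)] D in auto)

definition rel where "rel y z \<longleftrightarrow> M.cls ` (S \<inter> f -` {y}) = M.cls ` (S \<inter> f -` {z})"

abbreviation DS where "DS \<equiv> \<Union>y\<in>K. components {z \<in> K. rel y z}"

text \<open>A point \<open>x\<close> over \<open>y\<close> is approached by points over terms
  \<open>u n\<close>, as \<open>f\<close> is open. The relation replaces each by a point over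
  \<open>v n\<close> in the same class; by compactness these accumulate at a point \<open>l\<close>
  over \<open>z\<close>, and \<open>cls_closed\<close> keeps the class in the limit. Exchanging the
  two sequences gives the other inclusion.\<close>

lemma rel_closed_half:
  assumes u: "\<And>n. u n \<in> K" "\<And>n. v n \<in> K" "\<And>n::nat. rel (u n) (v n)" "u \<longlonglongrightarrow> y" "v \<longlonglongrightarrow> z"
  shows "M.cls ` (S \<inter> f -` {y}) \<subseteq> M.cls ` (S \<inter> f -` {z})"
proof (rule image_subsetI)
  fix x assume x: "x \<in> S \<inter> f -` {y}"
  let ?P = "\<lambda>n. {u n}"
  have uS: "?P n \<subseteq> S" "?P n \<noteq> {}" for n using u(1) K(2) by auto
  have "(\<lambda>n. infdist (f x) (?P n)) \<longlonglongrightarrow> 0"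
    using u(4) x unfolding tendsto_dist_iff[of u] by (simp add: dist_commute[of y])
  then have ev: "\<forall>\<^sub>F n in sequentially. \<exists>w\<in>S \<inter> f -` ?P n. dist x w < e" if "e > 0" for e
    using pre_approx[of x ?P, OF _ uS _ that] x by blast
  \<comment> \<open>The chosen indices \<open>q k\<close> need not increase;
    \<open>q k \<ge> k\<close> is enough for them to tend to infinity.\<close>
  have "\<exists>n w. w \<in> S \<inter> f -` {u n} \<and> dist x w < 1 / Suc k \<and> n \<ge> k" for k :: nat
  proof -
    have "\<forall>\<^sub>F n in sequentially. (\<exists>w\<in>S \<inter> f -` ?P n. dist x w < 1 / Suc k) \<and> n \<ge> k"
      by (intro eventually_conj ev eventually_ge_at_top) simp
    then show ?thesis unfolding eventually_sequentially by blast
  qed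
  then obtain q w where qw: "\<And>k. w k \<in> S \<inter> f -` {u (q k)}" "\<And>k. dist x (w k) < 1 / Suc k" "\<And>k. q k \<ge> k"
    by metis
  have "\<exists>w'. w' \<in> S \<inter> f -` {v (q k)} \<and> M.cls (w k) = M.cls w'" for k
  proof -
    have "M.cls (w k) \<in> M.cls ` (S \<inter> f -` {v (q k)})"
      using qw(1)[of k] u(3)[of "q k"] unfolding rel_def by blast
    then show ?thesis by blast
  qed
  then obtain w' where w': "\<And>k. w' k \<in> S \<inter> f -` {v (q k)}" "\<And>k. M.cls (w k) = M.cls (w' k)" by metis
  have w'S: "w' k \<in> S" for k using w'(1) by blast
  obtain l r where l: "l \<in> S" "strict_mono r" "(w' \<circ> r) \<longlonglongrightarrow> l"
    using compact_S w'S unfolding compact_def by metis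
  have wx: "w \<longlonglongrightarrow> x"
  proof -
    have "(\<lambda>k. dist (w k) x) \<longlonglongrightarrow> 0"
      by (rule tendsto_sandwich[OF _ _ tendsto_const LIMSEQ_inverse_real_of_nat])
         (use qw(2) in \<open>auto simp: dist_commute inverse_eq_divide less_imp_le\<close>)
    then show ?thesis unfolding tendsto_dist_iff[of w] .
  qed
  have fl: "f l = z"
  proof -
    have "(\<lambda>k. f ((w' \<circ> r) k)) \<longlonglongrightarrow> f l"
      using cont_f l w'S unfolding continuous_on_sequentially by (auto simp: o_def)
    moreover have "(\<lambda>k. f ((w' \<circ> r) k)) = (\<lambda>k. v (q (r k)))" using w'(1) by auto
    moreover have "filterlim (\<lambda>k. q (r k)) at_top sequentially"
    proof (rule filterlim_at_top_mono[OF filterlim_ident])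
      have "k \<le> q (r k)" for k using qw(3)[of "r k"] seq_suble[OF l(2), of k] by simp
      then show "\<forall>\<^sub>F k in sequentially. k \<le> q (r k)" by simp
    qed
    then have "(\<lambda>k. v (q (r k))) \<longlonglongrightarrow> z" using u(5) by (rule filterlim_compose[rotated])
    ultimately show ?thesis using LIMSEQ_unique by metis
  qed
  have "M.cls x = M.cls l"
  proof (rule M.cls_closed[OF _ _ _ LIMSEQ_subseq_LIMSEQ[OF wx l(2)] l(3)])
    show "(w \<circ> r) n \<in> S \<inter> f -` K" for n using qw(1)[of "r n"] u(1) by auto
    show "(w' \<circ> r) n \<in> S \<inter> f -` K" for n using w'(1)[of "r n"] u(2) by auto
    show "M.cls ((w \<circ> r) n) = M.cls ((w' \<circ> r) n)" for n using w'(2) by simp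
  qed
  then show "M.cls x \<in> M.cls ` (S \<inter> f -` {z})" using l(1) fl by blast
qed

lemma monotone_DS: "monotone_decomp K DS"
proof (rule monotone_decomp_components[OF K(1)])
  fix u v y z assume u: "\<And>n. u n \<in> K" "\<And>n. v n \<in> K" "\<And>n::nat. rel (u n) (v n)" "u \<longlonglongrightarrow> y" "v \<longlonglongrightarrow> z"
  have vu: "rel (v n) (u n)" for n using u(3)[of n] unfolding rel_def by simp
  show "rel y z" unfolding rel_def
    by (rule subset_antisym[OF rel_closed_half[OF u] rel_closed_half[OF u(2,1) vu u(5,4)]])
qed (auto simp: rel_def)

end

section \<open>Lifts of converging continua\<close>

context finite_open_map
begin

text \<open>A connected set over \<open>A\<close> that meets \<open>C\<close> has its image inside
  the component \<open>Q\<close>. Thus lifts of components of \<open>A\<close> qualify as the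
  components that \<open>limit_continuum_meets_few_classes\<close> works with.\<close>

lemma component_pre_component:
  assumes Q: "Q \<in> components A" and C: "C \<in> components (S \<inter> f -` Q)"
  shows "C \<in> components (S \<inter> f -` A)"
  unfolding in_components_maximal
proof (intro conjI allI impI)
  have QA: "Q \<subseteq> A" using in_components_subset[OF Q] .
  have CQ: "C \<subseteq> S \<inter> f -` Q" using in_components_subset[OF C] .
  have Cne: "C \<noteq> {}" using in_components_nonempty[OF C] .
  show "C \<noteq> {}" "connected C" using Cne in_components_connected[OF C] by auto
  show "C \<subseteq> S \<inter> f -` A" using CQ QA by blast
  fix B assume B: "B \<noteq> {} \<and> C \<subseteq> B \<and> B \<subseteq> S \<inter> f -` A \<and> connected B"
  have "connected (f ` B)"
    using cont_f B by (intro connected_continuous_image) (auto intro: continuous_on_subset)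
  moreover have "f ` B \<subseteq> A" using B by blast
  moreover have "Q \<inter> f ` B \<noteq> {}" using Cne CQ B by blast
  ultimately have "f ` B \<subseteq> Q" using components_maximal[OF Q] by blast
  then have "B \<subseteq> S \<inter> f -` Q" using B by blast
  moreover have "C \<inter> B \<noteq> {}" using Cne B by blast
  ultimately have "B \<subseteq> C" using components_maximal[OF C, of B] B by blast
  then show "B = C" using B by blast
qed

text \<open>For each \<open>n\<close> some component of the preimage of \<open>Q n\<close> serves many of the points of
  \<open>Z\<close>; pass to a subsequence along which these points do not change.\<close>

lemma preimage_components_approach:
  assumes Q: "\<And>n. compact (Q n)" "\<And>n. connected (Q n)" "\<And>n. Q n \<subseteq> S" "\<And>n. Q n \<noteq> {}"
    and Z: "finite Z" "Z \<subseteq> S" "card Z > m * N"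
    and lim: "\<And>z. z \<in> Z \<Longrightarrow> (\<lambda>n. infdist (f z) (Q n)) \<longlonglongrightarrow> 0"
  obtains r C Y where "strict_mono (r :: nat \<Rightarrow> nat)" "\<And>n. C n \<in> components (S \<inter> f -` Q (r n))"
    "Y \<subseteq> Z" "m < card Y" "\<And>z. z \<in> Y \<Longrightarrow> (\<lambda>n. infdist z (C n)) \<longlonglongrightarrow> 0"
proof -
  have Zne: "Z \<noteq> {}" using Z(3) by auto
  have near: "(\<lambda>n. infdist z (S \<inter> f -` Q n)) \<longlonglongrightarrow> 0" and ne: "\<forall>\<^sub>F n in sequentially. S \<inter> f -` Q n \<noteq> {}"
    if z: "z \<in> Z" for z
  proof -
    have ev: "\<forall>\<^sub>F n in sequentially. \<exists>x\<in>S \<inter> f -` Q n. dist z x < e" if "e > 0" for e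
      by (rule pre_approx[OF _ Q(3,4) lim[OF z] that]) (use z Z(2) in blast)
    show "(\<lambda>n. infdist z (S \<inter> f -` Q n)) \<longlonglongrightarrow> 0"
    proof (rule tendstoI)
      fix e :: real assume "e > 0"
      from ev[OF this] show "\<forall>\<^sub>F n in sequentially. dist (infdist z (S \<inter> f -` Q n)) 0 < e"
        by eventually_elim (auto simp: infdist_nonneg intro: le_less_trans[OF infdist_le])
    qed
    show "\<forall>\<^sub>F n in sequentially. S \<inter> f -` Q n \<noteq> {}"
      by (rule eventually_mono[OF ev[OF zero_less_one]]) blast
  qed
  \<comment> \<open>Early preimages may be empty; they have no component, and their
    \<open>infdist\<close> is 0 by convention.\<close>
  obtain n0 where n0: "\<And>n. n \<ge> n0 \<Longrightarrow> S \<inter> f -` Q n \<noteq> {}"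
    using ne Zne unfolding eventually_sequentially by blast
  have "\<exists>C\<in>components (S \<inter> f -` Q n). m < card {z \<in> Z. infdist z C \<le> infdist z (S \<inter> f -` Q n)}"
    if n: "n \<ge> n0" for n
  proof -
    let ?P = "S \<inter> f -` Q n" let ?T = "components ?P"
    have fin: "finite ?T" "card ?T \<le> N"
      using components_pre_finite[OF component_pre_compact[OF Q(1,2,3)] Q(3)] by auto
    have cl: "closed ?P" using compact_pre[OF Q(1)] compact_imp_closed by blast
    \<comment> \<open>The component containing a nearest point of the preimage realises the distance
      of \<open>z\<close>. As there are at most \<open>N\<close> components, one of them serves more
      than \<open>m\<close> points.\<close>
    have "\<exists>C\<in>?T. infdist z C \<le> infdist z ?P" for z
    proof -
      obtain x where x: "x \<in> ?P" "infdist z ?P = dist z x" using infdist_attains_inf[OF cl n0[OF n]] by blast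
      then obtain C where "C \<in> ?T" "x \<in> C" by (metis Union_components UnionE)
      then show ?thesis using infdist_le[of x C z] x(2) by auto
    qed
    then obtain k where k: "\<And>z. k z \<in> ?T \<and> infdist z (k z) \<le> infdist z ?P" by metis
    have "m * card ?T \<le> m * N" using fin(2) by (rule mult_le_mono2)
    then have "card Z > m * card ?T" using Z(3) by (rule le_less_trans)
    then obtain C where C: "C \<in> ?T" "m < card {z \<in> Z. k z = C}"
      using pigeonhole_many[OF fin(1) _ Z(1), of k m] k by blast
    have "card {z \<in> Z. k z = C} \<le> card {z \<in> Z. infdist z C \<le> infdist z ?P}"
      using Z(1) k by (intro card_mono) auto
    then show ?thesis using C by (meson less_le_trans)
  qed
  then have "\<forall>n. \<exists>C. n \<ge> n0 \<longrightarrow> C \<in> components (S \<inter> f -` Q n) \<and>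
      m < card {z \<in> Z. infdist z C \<le> infdist z (S \<inter> f -` Q n)}" by blast
  from choice[OF this] obtain C where C: "\<forall>n. n \<ge> n0 \<longrightarrow> C n \<in> components (S \<inter> f -` Q n) \<and>
      m < card {z \<in> Z. infdist z (C n) \<le> infdist z (S \<inter> f -` Q n)}" by (rule exE)
  define Y where "Y = (\<lambda>n. {z \<in> Z. infdist z (C n) \<le> infdist z (S \<inter> f -` Q n)})"
  have "Y ` {n0..} \<subseteq> Pow Z" unfolding Y_def by blast
  then have "finite (Y ` {n0..})" using Z(1) by (meson finite_Pow_iff finite_subset)
  then obtain n1 where n1: "n1 \<in> {n0..}" "infinite {n \<in> {n0..}. Y n = Y n1}"
    using pigeonhole_infinite[of "{n0..}" Y] infinite_Ici by blast
  define r where "r = enumerate {n \<in> {n0..}. Y n = Y n1}"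
  have r: "strict_mono r" unfolding r_def by (rule strict_mono_enumerate[OF n1(2)])
  have rin: "r n \<ge> n0" "Y (r n) = Y n1" for n
    using enumerate_in_set[OF n1(2), of n] unfolding r_def by auto
  show thesis
  proof (rule that[OF r, of "\<lambda>n. C (r n)" "Y n1"])
    show "C (r n) \<in> components (S \<inter> f -` Q (r n))" for n using C rin(1) by blast
    show "Y n1 \<subseteq> Z" unfolding Y_def by blast
    show "m < card (Y n1)" using C n1(1) unfolding Y_def by auto
    fix z assume z: "z \<in> Y n1"
    then have zZ: "z \<in> Z" unfolding Y_def by blast
    show "(\<lambda>n. infdist z (C (r n))) \<longlonglongrightarrow> 0"
    proof (rule tendsto_sandwich[OF _ _ tendsto_const])
      show "(\<lambda>n. infdist z (S \<inter> f -` Q (r n))) \<longlonglongrightarrow> 0"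
        using LIMSEQ_subseq_LIMSEQ[OF near[OF zZ] r] by (simp add: o_def)
      have "infdist z (C (r n)) \<le> infdist z (S \<inter> f -` Q (r n))" for n
        using z rin(2)[of n] unfolding Y_def by blast
      then show "\<forall>\<^sub>F n in sequentially. infdist z (C (r n)) \<le> infdist z (S \<inter> f -` Q (r n))" by simp
    qed (simp add: infdist_nonneg)
  qed
qed

end

lemma (in topological_sphere) finite_connected_cover:
  assumes "compact F" "F \<subseteq> S" "r > 0"
  obtains VV where "finite VV" "F \<subseteq> \<Union>VV" "\<And>V. V \<in> VV \<Longrightarrow> openin (top_of_set S) V"
    "\<And>V. V \<in> VV \<Longrightarrow> connected V" "\<And>V. V \<in> VV \<Longrightarrow> \<exists>c\<in>F. V \<subseteq> ball c r"
proof -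
  have lc: "locally connected S"
    using locally_path_connected_S by (rule locally_path_connected_imp_locally_connected)
  have "\<exists>V O'. openin (top_of_set S) V \<and> connected V \<and> V \<subseteq> ball c r \<and> open O' \<and> V = S \<inter> O' \<and> c \<in> O'"
    if c: "c \<in> F" for c
  proof -
    let ?B = "S \<inter> ball c r"
    let ?V = "connected_component_set ?B c"
    have oB: "openin (top_of_set S) ?B" by (simp add: openin_open_Int)
    have cB: "c \<in> ?B" using c assms(2,3) by auto
    have oV: "openin (top_of_set S) ?V"
      using lc oB componentsI[OF cB] unfolding locally_connected_open_component by blast
    obtain O' where O': "open O'" "?V = S \<inter> O'" using oV by (auto simp: openin_open)
    have cV: "c \<in> ?V" using cB by simp
    show ?thesis
    proof (rule exI[of _ ?V], rule exI[of _ O'], intro conjI)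
      show "?V \<subseteq> ball c r" using connected_component_subset[of ?B c] by blast
      show "c \<in> O'" using cV unfolding O'(2) by blast
    qed (rule oV connected_connected_component O')+
  qed
  then obtain V G where VG: "\<forall>c\<in>F. openin (top_of_set S) (V c) \<and> connected (V c) \<and> V c \<subseteq> ball c r \<and>
      open (G c) \<and> V c = S \<inter> G c \<and> c \<in> G c" by metis
  have "\<forall>c\<in>F. open (G c)" using VG by blast
  moreover have "F \<subseteq> (\<Union>c\<in>F. G c)" using VG by blast
  ultimately obtain T where T: "T \<subseteq> F" "finite T" "F \<subseteq> (\<Union>c\<in>T. G c)"
    using compactE_image[OF assms(1), of F G] by metis
  show thesis
  proof (rule that[of "V ` T"])
    show "finite (V ` T)" using T(2) by simp
    show "F \<subseteq> \<Union>(V ` T)"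
    proof
      fix x assume x: "x \<in> F"
      then obtain c where c: "c \<in> T" "x \<in> G c" using T(3) by blast
      have "V c = S \<inter> G c" using VG c(1) T(1) by blast
      then show "x \<in> \<Union>(V ` T)" using c x assms(2) by blast
    qed
    fix W assume "W \<in> V ` T"
    then obtain c where c: "c \<in> F" "W = V c" using T(1) by blast
    show "openin (top_of_set S) W" "connected W" using VG c by blast+
    show "\<exists>c\<in>F. W \<subseteq> ball c r" using VG c by blast
  qed
qed

section \<open>Pushing the local criterion down\<close>

context fibre_relation
begin

text \<open>Failure at \<open>s\<close> gives points \<open>y n\<close> tending to \<open>s\<close>
  whose components in a set \<open>A \<subseteq> U\<close> avoid \<open>s\<close> and yet reach far
  from it. Their limit \<open>L\<close> meets \<open>s\<close> and leaves it, so close to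
  \<open>s\<close> it contains a continuum \<open>N0\<close> with unrelated points, and some lift
  \<open>N1\<close> of \<open>N0\<close> meets infinitely many classes. Lifts of the approximating
  components then contradict \<open>limit_continuum_meets_few_classes\<close>.\<close>

lemma locally_peano_DS:
  assumes peano: "locally_peano (S \<inter> f -` K) D"
  shows "locally_peano K DS"
  unfolding locally_peano_def
proof (intro ballI allI impI, elim conjE, rule ccontr)
  interpret DS: monotone_decomposition K DS
    by unfold_locales (use K monotone_DS in auto)
  fix s U assume s: "s \<in> DS" and U: "openin (top_of_set K) U" "s \<subseteq> U"
  assume neg: "\<not> (\<exists>V. openin (top_of_set K) V \<and> s \<subseteq> V \<and> V \<subseteq> U \<and>
     (\<forall>y\<in>V. joined_in K U s y))"
  have sc: "compact s" "connected s" "s \<noteq> {}" "s \<subseteq> K" using DS.D_facts s by auto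
  have "compact (K - U)" using closedin_compact[OF K(1)] U(1) by (simp add: openin_closedin_eq)
  moreover have "s \<inter> (K - U) = {}" using U(2) by blast
  ultimately obtain h where h: "h > 0" "\<And>x y. x \<in> s \<Longrightarrow> y \<in> K - U \<Longrightarrow> h \<le> dist x y"
    using separate_compact_closed[OF sc(1) compact_imp_closed] by metis
  \<comment> \<open>Three layers about \<open>s\<close>: \<open>N0\<close> stays within
    \<open>r\<close>, the closures of the sets in \<open>VV\<close> stay at distance at least
    \<open>2 * r\<close>, and \<open>VV\<close> covers the part of \<open>K\<close> at distance at
    least \<open>3 * r\<close>, so that \<open>A\<close> remains in \<open>U\<close>. The gap
    between the first two keeps \<open>N1\<close> off the lifted closures.\<close>
  define r where "r = h / 3"
  have r: "r > 0" unfolding r_def using h(1) by simp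
  have rU: "y \<in> U" if y: "y \<in> K" "infdist y s < 3 * r" for y
  proof (rule ccontr)
    assume "y \<notin> U"
    obtain x where x: "x \<in> s" "dist y x < 3 * r" using y(2) sc(3) infdist_less_iff by blast
    then show False using h(2)[of x y] y(1) \<open>y \<notin> U\<close> unfolding r_def by (simp add: dist_commute)
  qed
  have "\<exists>y. y \<in> K \<and> infdist y s < r \<and> infdist y s < 1 / Suc n \<and> \<not> connected_component_set K y \<subseteq> U \<and>
      (\<forall>C. compact C \<longrightarrow> connected C \<longrightarrow> C \<subseteq> U \<longrightarrow> s \<subseteq> C \<longrightarrow> y \<notin> C)" for n :: nat
  proof -
    let ?V = "K \<inter> ({y. infdist y s < r} \<inter> {y. infdist y s < 1 / Suc n})"
    have "openin (top_of_set K) ?V"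
      by (intro openin_open_Int open_Int open_Collect_less continuous_intros)
    moreover have "s \<subseteq> ?V" using sc(4) r by auto
    moreover have "?V \<subseteq> U" using rU r by auto
    ultimately have "\<not> (\<forall>y\<in>?V. joined_in K U s y)"
      using neg by blast
    then show ?thesis by blast
  qed
  then obtain y where y: "\<And>n. y n \<in> K" "\<And>n. infdist (y n) s < r" "\<And>n. infdist (y n) s < 1 / Suc n"
    "\<And>n. \<not> connected_component_set K (y n) \<subseteq> U"
    "\<And>n C. compact C \<Longrightarrow> connected C \<Longrightarrow> C \<subseteq> U \<Longrightarrow> s \<subseteq> C \<Longrightarrow> y n \<notin> C" by metis
  define F where "F = K \<inter> {y. 3 * r \<le> infdist y s}"
  have cF: "compact F" unfolding F_def using K(1)
    by (intro compact_Int_closed closed_Collect_le continuous_intros)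
  obtain VV where VV: "finite VV" "F \<subseteq> \<Union>VV" "\<And>V. V \<in> VV \<Longrightarrow> openin (top_of_set S) V"
    "\<And>V. V \<in> VV \<Longrightarrow> connected V" "\<And>V. V \<in> VV \<Longrightarrow> \<exists>c\<in>F. V \<subseteq> ball c r"
    by (rule finite_connected_cover[OF cF _ r]) (use F_def K(2) that in auto)
  let ?far = "{y. 2 * r \<le> infdist y s}"
  have clfar: "closed ?far" by (intro closed_Collect_le continuous_intros)
  have Vfar: "closure V \<subseteq> ?far" if V: "V \<in> VV" for V
  proof (rule closure_minimal[OF _ clfar])
    obtain c where c: "c \<in> F" "V \<subseteq> ball c r" using VV(5)[OF V] by blast
    show "V \<subseteq> ?far"
    proof
      fix x assume "x \<in> V"
      then have "dist c x < r" using c(2) by auto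
      moreover have "3 * r \<le> infdist c s" using c(1) unfolding F_def by blast
      ultimately show "x \<in> ?far" using infdist_triangle[of c s x] by simp
    qed
  qed
  define A where "A = K - \<Union>VV"
  have cA: "compact A"
  proof -
    have "openin (top_of_set S) (\<Union>VV)" using VV(3) by (intro openin_Union) auto
    then obtain O' where O': "open O'" "\<Union>VV = S \<inter> O'" by (auto simp: openin_open)
    have "A = K - O'" unfolding A_def O'(2) using K(2) by blast
    then show ?thesis using K(1) O'(1) by (simp add: compact_diff)
  qed
  have AK: "A \<subseteq> K" unfolding A_def by blast
  have AU: "A \<subseteq> U"
  proof
    fix x assume x: "x \<in> A"
    then have "x \<notin> F" using VV(2) unfolding A_def by blast
    then show "x \<in> U" using x AK rU[of x] unfolding F_def by auto
  qed
  have nearA: "x \<in> A" if x: "x \<in> K" "infdist x s < 2 * r" for x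
  proof -
    have "x \<notin> V" if "V \<in> VV" for V
      using Vfar[OF that] closure_subset[of V] x(2) by auto
    then show ?thesis using x(1) unfolding A_def by blast
  qed
  have yA: "y n \<in> A" for n using nearA[OF y(1)] y(2)[of n] r by simp
  obtain l q where l: "l \<in> K" "strict_mono q" "(y \<circ> q) \<longlonglongrightarrow> l"
    using K(1) y(1) unfolding compact_def by metis
  have ls: "l \<in> s"
  proof -
    have "(\<lambda>n. infdist ((y \<circ> q) n) s) \<longlonglongrightarrow> infdist l s" using l(3) by (rule tendsto_infdist)
    moreover have "(\<lambda>n. infdist (y n) s) \<longlonglongrightarrow> 0"
      by (rule tendsto_sandwich[OF _ _ tendsto_const LIMSEQ_inverse_real_of_nat])
         (use y(3) in \<open>auto simp: inverse_eq_divide less_imp_le infdist_nonneg\<close>)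
    then have "(\<lambda>n. infdist ((y \<circ> q) n) s) \<longlonglongrightarrow> 0" using LIMSEQ_subseq_LIMSEQ[OF _ l(2)] by (simp add: o_def)
    ultimately have "infdist l s = 0" using LIMSEQ_unique by blast
    then show ?thesis using in_closed_iff_infdist_zero[OF compact_imp_closed[OF sc(1)] sc(3)] by simp
  qed
  define P where "P = (\<lambda>n. connected_component_set A (y (q n)))"
  have Pcomp: "P n \<in> components A" for n unfolding P_def using yA by (rule componentsI)
  have P: "compact (P n)" "connected (P n)" "P n \<noteq> {}" "P n \<subseteq> A" "y (q n) \<in> P n" for n
    using compact_components[OF cA Pcomp] in_components_connected[OF Pcomp] in_components_nonempty[OF Pcomp]
      in_components_subset[OF Pcomp] yA unfolding P_def by auto
  have AS: "A \<subseteq> S" using AK K(2) by blast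
  have PS: "P n \<subseteq> S" for n using P(4) AS by blast
  have Ps: "P n \<inter> s = {}" for n
  proof (rule ccontr)
    assume "P n \<inter> s \<noteq> {}"
    then have "connected (P n \<union> s)" using P(2) sc(2) by (intro connected_Un) auto
    moreover have "compact (P n \<union> s)" using P(1) sc(1) by (rule compact_Un)
    moreover have "P n \<union> s \<subseteq> U" using P(4) AU U(2) by blast
    ultimately show False using y(5)[of "P n \<union> s" "q n"] P(5) by blast
  qed
  \<comment> \<open>The component of \<open>y (q n)\<close> in \<open>K\<close> leaves
    \<open>U\<close>, hence \<open>A\<close>; boundary bumping carries the component in
    \<open>A\<close> to the closure of the removed part.\<close>
  have Pfar: "P n \<inter> (S \<inter> ?far) \<noteq> {}" for n
  proof -
    let ?Q = "connected_component_set K (y (q n))"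
    have Qc: "?Q \<in> components K" using y(1) by (rule componentsI)
    have "compact ?Q" "connected ?Q" using compact_components[OF K(1) Qc] by auto
    moreover have nQ: "\<not> ?Q \<subseteq> A" using y(4)[of "q n"] AU by blast
    moreover have "y (q n) \<in> ?Q \<inter> A" using y(1) yA by simp
    ultimately have "connected_component_set (?Q \<inter> A) (y (q n)) \<inter> closure (?Q - A) \<noteq> {}"
      using compact_imp_closed[OF cA] by (intro boundary_bumping_set)
    moreover have "connected_component_set (?Q \<inter> A) (y (q n)) \<subseteq> P n"
      unfolding P_def by (rule connected_component_mono) blast
    moreover have "closure (?Q - A) \<subseteq> ?far"
    proof (rule closure_minimal[OF _ clfar])
      have "?Q - A \<subseteq> \<Union>VV" using connected_component_subset[of K "y (q n)"] unfolding A_def by blast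
      also have "\<dots> \<subseteq> ?far" using Vfar closure_subset by blast
      finally show "?Q - A \<subseteq> ?far" .
    qed
    ultimately show ?thesis using PS by blast
  qed
  obtain u L where u: "strict_mono u" and L: "compact L" "L \<noteq> {}" "L \<subseteq> S" "hausdorff_lim (P \<circ> u) L"
    by (rule hausdorff_lim_exists[OF compact_S P(3) PS]) (rule that)
  have Lcon: "connected L" by (rule hausdorff_lim_connected[OF L(4,1)]) (use P in auto)
  have LA: "L \<subseteq> A" by (rule hausdorff_lim_subset[OF L(4) compact_imp_closed[OF cA]]) (use P in auto)
  have lL: "l \<in> L"
    by (rule hausdorff_lim_mem[OF L(4) compact_imp_closed[OF L(1)] L(2) _ LIMSEQ_subseq_LIMSEQ[OF l(3) u]])
       (use P(5) in simp)
  have Lfar: "L \<inter> (S \<inter> ?far) \<noteq> {}"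
    by (rule hausdorff_lim_meets[OF L(4) compact_imp_closed[OF L(1)] L(2)])
       (use Pfar compact_S clfar in \<open>auto intro: compact_Int_closed\<close>)
  let ?near = "{y. infdist y s \<le> r}"
  have clnear: "closed ?near" by (intro closed_Collect_le continuous_intros)
  \<comment> \<open>Cutting \<open>L\<close> down to distance \<open>r\<close> keeps it away from
    the sets in \<open>VV\<close>, while boundary bumping still leads the component of
    \<open>l\<close> out to distance \<open>r\<close>, hence out of \<open>s\<close>.\<close>
  define N0 where "N0 = connected_component_set (L \<inter> ?near) l"
  have lnear: "l \<in> L \<inter> ?near" using lL ls r by simp
  have N0c: "N0 \<in> components (L \<inter> ?near)" unfolding N0_def using lnear by (rule componentsI)
  have N0: "compact N0" "connected N0" "N0 \<subseteq> L" "N0 \<subseteq> ?near" "l \<in> N0"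
    using compact_components[OF compact_Int_closed[OF L(1) clnear] N0c] in_components_connected[OF N0c]
      in_components_subset[OF N0c] lnear unfolding N0_def by auto
  have "\<not> N0 \<subseteq> s"
  proof
    assume N0s: "N0 \<subseteq> s"
    have "\<not> L \<subseteq> ?near" using Lfar r by fastforce
    then have "N0 \<inter> closure (L - ?near) \<noteq> {}"
      unfolding N0_def using boundary_bumping_set[OF L(1) Lcon clnear lnear] by blast
    moreover have "closure (L - ?near) \<subseteq> {y. r \<le> infdist y s}"
      by (rule closure_minimal) (auto intro!: closed_Collect_le continuous_intros)
    ultimately obtain a where "a \<in> s" "r \<le> infdist a s" using N0s by blast
    then show False using r by simp
  qed
  have N0K: "N0 \<subseteq> K" using N0(3) LA AK by blast
  \<comment> \<open>Otherwise \<open>N0\<close> would be a connected part of one relation class and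
    so lie in \<open>s\<close>, a component of that class.\<close>
  have "\<exists>v\<in>N0. \<not> rel l v"
  proof (rule ccontr)
    assume "\<not> ?thesis"
    then have R: "\<And>v. v \<in> N0 \<Longrightarrow> rel l v" by blast
    obtain c where c: "c \<in> K" "s \<in> components {z \<in> K. rel c z}" using s by blast
    have "rel c l" using ls in_components_subset[OF c(2)] by blast
    then have "rel c w" if "w \<in> N0" for w using R[OF that] unfolding rel_def by (rule trans)
    then have "N0 \<subseteq> {z \<in> K. rel c z}" using N0K by blast
    then have "N0 \<subseteq> s" using components_maximal[OF c(2) N0(2)] N0(5) ls by blast
    then show False using \<open>\<not> N0 \<subseteq> s\<close> by blast
  qed
  then obtain v where v: "v \<in> N0" "\<not> rel l v" by blast
  \<comment> \<open>Either inclusion between the two sets of classes may be the one that fails;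
    \<open>a\<close> and \<open>b\<close> name the points in the order in which it does.\<close>
  have "\<exists>a b x. a \<in> N0 \<and> b \<in> N0 \<and> x \<in> S \<inter> f -` {a} \<and> M.cls x \<notin> M.cls ` (S \<inter> f -` {b})"
  proof (cases "M.cls ` (S \<inter> f -` {l}) \<subseteq> M.cls ` (S \<inter> f -` {v})")
    case True
    then have "\<not> M.cls ` (S \<inter> f -` {v}) \<subseteq> M.cls ` (S \<inter> f -` {l})" using v(2) unfolding rel_def by blast
    then show ?thesis using v(1) N0(5) by blast
  next
    case False
    then show ?thesis using v(1) N0(5) by blast
  qed
  then obtain a b x where abx: "a \<in> N0" "b \<in> N0" "x \<in> S \<inter> f -` {a}" "M.cls x \<notin> M.cls ` (S \<inter> f -` {b})"
    by blast
  define N1 where "N1 = connected_component_set (S \<inter> f -` N0) x"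
  have xN: "x \<in> S \<inter> f -` N0" using abx(1,3) by blast
  have N1c: "N1 \<in> components (S \<inter> f -` N0)" unfolding N1_def using xN by (rule componentsI)
  have N0S: "N0 \<subseteq> S" using N0K K(2) by blast
  have N1: "compact N1" "connected N1" "N1 \<subseteq> S \<inter> f -` N0" "x \<in> N1"
    using compact_components[OF compact_pre[OF N0(1)] N1c] in_components_connected[OF N1c]
      in_components_subset[OF N1c] xN unfolding N1_def by auto
  have "f ` N1 = N0" by (rule component_pre_compact[OF N0(1,2) N0S N1c])
  \<comment> \<open>As \<open>N1\<close> maps onto \<open>N0\<close>, it has a point over
    \<open>b\<close>; the class of that point differs from the class of \<open>x\<close>, which the
    fibre over \<open>b\<close> does not meet.\<close>
  then obtain x' where x': "x' \<in> N1" "f x' = b" using abx(2) by (metis imageE)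
  have "M.cls x' \<noteq> M.cls x" using x' N1(3) abx(4) by blast
  moreover have N1K: "N1 \<subseteq> S \<inter> f -` K" using N1(3) N0K by blast
  define WW where "WW = (\<Union>V\<in>VV. components (S \<inter> f -` V))"
  have VS: "V \<subseteq> S" if "V \<in> VV" for V using VV(3)[OF that] openin_imp_subset by blast
  have WW: "finite WW" "\<And>W. W \<in> WW \<Longrightarrow> openin (top_of_set S) W" "\<And>W. W \<in> WW \<Longrightarrow> connected W"
  proof -
    have "finite (components (S \<inter> f -` V))" if V: "V \<in> VV" for V
      by (rule components_pre_finite(1)[OF component_pre_open(1)[OF VV(3,4)] VS]) (use V in auto)
    then show "finite WW" unfolding WW_def using VV(1) by blast
    show "openin (top_of_set S) W" "connected W" if "W \<in> WW" for W
      using that component_pre_open(2)[OF VV(3,4)] in_components_connected unfolding WW_def by blast+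
  qed
  \<comment> \<open>Of \<open>m * N + 1\<close> points in \<open>N1\<close>, more than
    \<open>m\<close> remain for one sequence of lifts, that is at least
    \<open>2 * card WW + 2\<close>, the number that \<open>limit_continuum_meets_few_classes\<close>
    requires.\<close>
  define m where "m = 2 * card WW + 1"
  obtain Z where Z: "finite Z" "Z \<subseteq> N1" "card Z = m * N + 1" "inj_on M.cls Z"
    using M.many_classes[OF N1(2) N1K N1(4) x'(1)] calculation by metis
  define Q where "Q = P \<circ> u"
  have Q: "compact (Q n)" "connected (Q n)" "Q n \<subseteq> S" "Q n \<noteq> {}" for n unfolding Q_def using P PS by auto
  have ZS: "Z \<subseteq> S" using Z(2) N1(3) by blast
  have lim: "(\<lambda>n. infdist (f z) (Q n)) \<longlonglongrightarrow> 0" if z: "z \<in> Z" for z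
  proof (rule tendstoI)
    fix e :: real assume "e > 0"
    then have "\<forall>\<^sub>F n in sequentially. (\<forall>x\<in>Q n. infdist x L < e) \<and> (\<forall>x\<in>L. infdist x (Q n) < e)"
      using L(4) unfolding hausdorff_lim_def Q_def by blast
    moreover have "f z \<in> L" using z Z(2) N1(3) N0(3) by blast
    ultimately show "\<forall>\<^sub>F n in sequentially. dist (infdist (f z) (Q n)) 0 < e"
      by (auto elim!: eventually_mono simp: infdist_nonneg)
  qed
  have cZ: "card Z > m * N" using Z(3) by simp
  obtain t C Y where t: "strict_mono (t :: nat \<Rightarrow> nat)" "\<And>n. C n \<in> components (S \<inter> f -` Q (t n))"
    "Y \<subseteq> Z" "m < card Y" "\<And>z. z \<in> Y \<Longrightarrow> (\<lambda>n. infdist z (C n)) \<longlonglongrightarrow> 0"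
    by (rule preimage_components_approach[OF Q Z(1) ZS cZ lim]) (use that in blast)+
  have Qcomp: "Q n \<in> components A" for n unfolding Q_def using Pcomp by simp
  show False
  proof (rule limit_continuum_meets_few_classes[of "S \<inter> f -` K" D "S \<inter> f -` A" WW N1 C Y M.cls])
    show "compact (S \<inter> f -` K)" "S \<inter> f -` K \<subseteq> S" using compact_pre[OF K(1)] by auto
    show "compact d" "d \<subseteq> S \<inter> f -` K" if "d \<in> D" for d using M.D_facts(3,6) that by auto
    show "pairwise disjnt D" by (rule M.D_facts(5))
    show "locally_peano (S \<inter> f -` K) D" by (rule peano)
    show "closed (S \<inter> f -` A)" using compact_pre[OF cA] compact_imp_closed by blast
    show "S \<inter> f -` A \<subseteq> S \<inter> f -` K" using AK by blast
    show "finite WW" "\<And>W. W \<in> WW \<Longrightarrow> openin (top_of_set S) W" "\<And>W. W \<in> WW \<Longrightarrow> connected W" using WW by auto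
    show "W \<inter> (S \<inter> f -` A) = {}" if W: "W \<in> WW" for W
    proof -
      obtain V where "V \<in> VV" "W \<in> components (S \<inter> f -` V)" using W unfolding WW_def by blast
      then show ?thesis using in_components_subset[of W "S \<inter> f -` V"] unfolding A_def by blast
    qed
    show "S \<inter> f -` K - S \<inter> f -` A \<subseteq> \<Union>WW"
    proof
      fix w assume w: "w \<in> S \<inter> f -` K - S \<inter> f -` A"
      then obtain V where V: "V \<in> VV" "f w \<in> V" unfolding A_def by blast
      then have "w \<in> \<Union>(components (S \<inter> f -` V))" using w by (simp add: Union_components)
      then show "w \<in> \<Union>WW" using V(1) unfolding WW_def by blast
    qed
    show "compact N1" "connected N1" by (rule N1)+
    show "N1 \<subseteq> S \<inter> f -` A" using N1(3) N0(3) LA by blast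
    show "N1 \<inter> closure W = {}" if W: "W \<in> WW" for W
    proof -
      obtain V where V: "V \<in> VV" "W \<in> components (S \<inter> f -` V)" using W unfolding WW_def by blast
      have WV: "W \<subseteq> S" "f ` W \<subseteq> V" using in_components_subset[OF V(2)] by auto
      have "closure W \<subseteq> S" using WV(1) compact_imp_closed[OF compact_S] by (rule closure_minimal)
      then have "f ` closure W \<subseteq> closure V"
        using cont_f WV(2) closure_subset[of V] by (intro image_closure_subset) (auto intro: continuous_on_subset)
      then have "f ` closure W \<subseteq> ?far" using Vfar[OF V(1)] by blast
      moreover have "f ` N1 \<subseteq> ?near" using N1(3) N0(4) by blast
      ultimately have False if "w \<in> N1" "w \<in> closure W" for w using that r by fastforce
      then show ?thesis by blast
    qed
    show "C n \<in> components (S \<inter> f -` A)" for n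
      by (rule component_pre_component[OF Qcomp t(2)])
    show "C n \<inter> N1 = {}" for n
    proof (rule ccontr)
      assume "C n \<inter> N1 \<noteq> {}"
      \<comment> \<open>A component of \<open>A\<close> that meets the connected \<open>N0\<close>
        contains it, and with it the point \<open>l\<close> of \<open>s\<close>; but the continua
        \<open>P n\<close> avoid \<open>s\<close>.\<close>
      then have "Q (t n) \<inter> N0 \<noteq> {}" using in_components_subset[OF t(2)[of n]] N1(3) by blast
      then have "N0 \<subseteq> Q (t n)" using components_maximal[OF Qcomp N0(2)] N0(3) LA by blast
      then show False using N0(5) ls Ps[of "u (t n)"] unfolding Q_def by auto
    qed
    show "finite Y" "Y \<subseteq> N1" using t(3) Z(1,2) by (auto intro: finite_subset)
    show "2 * card WW + 2 \<le> card Y" using t(4) unfolding m_def by simp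
    fix z assume z: "z \<in> Y"
    then have "z \<in> S \<inter> f -` K" using t(3) Z(2) N1K by blast
    then show "M.cls z \<in> D" "z \<in> M.cls z" using M.cls_in by auto
    show "(\<lambda>n. infdist z (C n)) \<longlonglongrightarrow> 0" using t(5)[OF z] .
  next
    show "inj_on M.cls Y" using Z(4) t(3) by (rule inj_on_subset)
  qed
qed

end

section \<open>Comparison of the two core decompositions\<close>

context finite_open_map
begin

text \<open>Minimality is applied on both levels: upstairs against the components over the classes
  of \<open>DK\<close>, downstairs against the decomposition by fibres. The first refinement puts
  the image of a class inside some \<open>d\<close>, the second makes it fill
  \<open>d\<close>.\<close>

theorem core_decomp_PS_pre:
  assumes K: "compact K" "K \<subseteq> S"
    and DK: "core_decomp_PS K DK" and DfK: "core_decomp_PS (S \<inter> f -` K) DfK"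
  shows "\<forall>d\<in>DfK. f ` d \<in> DK" "(\<Union>d\<in>DK. components (S \<inter> f -` d)) = DfK"
proof -
  let ?K = "S \<inter> f -` K"
  let ?E = "\<Union>d\<in>DK. components (S \<inter> f -` d)"
  have mDK: "monotone_decomp K DK" and pDK: "peano_space (hyperspace K DK)"
    and minK: "\<And>D'. monotone_decomp K D' \<Longrightarrow> peano_space (hyperspace K D') \<Longrightarrow> finer DK D'"
    using DK unfolding core_decomp_PS_def by auto
  have mDf: "monotone_decomp ?K DfK" and pDf: "peano_space (hyperspace ?K DfK)"
    and minf: "\<And>D'. monotone_decomp ?K D' \<Longrightarrow> peano_space (hyperspace ?K D') \<Longrightarrow> finer DfK D'"
    using DfK unfolding core_decomp_PS_def by auto
  interpret DK: monotone_decomposition K DK by unfold_locales (use K mDK in auto)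
  interpret R: fibre_relation S f N K DfK by unfold_locales (use K mDf in auto)
  have E: "monotone_decomp ?K ?E" by (rule monotone_pre[OF K mDK])
  interpret E: monotone_decomposition ?K ?E by unfold_locales (use compact_pre[OF K(1)] E in auto)
  have "locally_peano K DK" using pDK DK.peano_iff_locally_peano by simp
  then have "locally_peano ?K ?E" by (rule locally_peano_pre[OF K mDK])
  then have "peano_space (hyperspace ?K ?E)" using E.peano_iff_locally_peano by simp
  with E have fE: "finer DfK ?E" by (rule minf)
  interpret DS: monotone_decomposition K R.DS by unfold_locales (use K R.monotone_DS in auto)
  have "locally_peano ?K DfK" using pDf R.M.peano_iff_locally_peano by simp
  then have "locally_peano K R.DS" by (rule R.locally_peano_DS)
  then have "peano_space (hyperspace K R.DS)" using DS.peano_iff_locally_peano by simp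
  with R.monotone_DS have fS: "finer DK R.DS" by (rule minK)
  have onto: "f ` d' = d" if d': "d' \<in> DfK" "d' \<subseteq> e" and d: "d \<in> DK" "e \<in> components (S \<inter> f -` d)" for d' d e
  proof
    show "f ` d' \<subseteq> d" using d'(2) in_components_subset[OF d(2)] by blast
    obtain x0 where x0: "x0 \<in> d'" using R.M.D_facts(2)[OF d'(1)] by blast
    have x0S: "x0 \<in> S" "f x0 \<in> d" using x0 d'(2) in_components_subset[OF d(2)] by auto
    obtain s where s: "s \<in> R.DS" "d \<subseteq> s" using fS d(1) unfolding finer_def by blast
    obtain c where c: "s \<in> components {z \<in> K. R.rel c z}" using s(1) by blast
    show "d \<subseteq> f ` d'"
    proof
      fix y assume y: "y \<in> d"
      have "R.rel c y" "R.rel c (f x0)" using y x0S(2) s(2) in_components_subset[OF c] by auto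
      then have eq: "R.M.cls ` (S \<inter> f -` {f x0}) = R.M.cls ` (S \<inter> f -` {y})" unfolding R.rel_def by simp
      have "R.M.cls x0 = d'" using R.M.cls_eq[OF d'(1) x0] .
      moreover have "R.M.cls x0 \<in> R.M.cls ` (S \<inter> f -` {f x0})" using x0S(1) by blast
      ultimately have "d' \<in> R.M.cls ` (S \<inter> f -` {y})" using eq by simp
      then obtain x where x: "x \<in> S" "f x = y" "d' = R.M.cls x" by blast
      have "x \<in> ?K" using x(1,2) y DK.D_facts(6)[OF d(1)] by blast
      then have "x \<in> d'" using R.M.cls_in(2) x(3) by simp
      then show "y \<in> f ` d'" using x(2) by blast
    qed
  qed
  have sub_E: "\<exists>d\<in>DK. \<exists>e\<in>components (S \<inter> f -` d). d' \<subseteq> e" if "d' \<in> DfK" for d'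
    using fE that unfolding finer_def by blast
  show "\<forall>d\<in>DfK. f ` d \<in> DK"
  proof
    fix d' assume d': "d' \<in> DfK"
    obtain d e where "d \<in> DK" "e \<in> components (S \<inter> f -` d)" "d' \<subseteq> e" using sub_E[OF d'] by blast
    then show "f ` d' \<in> DK" using onto[OF d'] by simp
  qed
  have E_sub: "e \<in> DfK" if e: "d \<in> DK" "e \<in> components (S \<inter> f -` d)" for d e
  proof -
    have eE: "e \<in> ?E" using e by blast
    have eK: "e \<subseteq> ?K" using E.D_facts(6)[OF eE] .
    have cls_e: "R.M.cls x \<subseteq> e" if x: "x \<in> e" for x
    proof -
      have xK: "x \<in> ?K" using x eK by blast
      obtain e' where e': "e' \<in> ?E" "R.M.cls x \<subseteq> e'" using sub_E[OF R.M.cls_in(1)[OF xK]] by blast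
      have "x \<in> e'" using e'(2) R.M.cls_in(2)[OF xK] by blast
      then show ?thesis using E.D_eqI[OF eE e'(1) x] e'(2) by simp
    qed
    \<comment> \<open>One fibre suffices to count: every class inside \<open>e\<close> maps onto
      \<open>d\<close>, so it meets the finite fibre over this \<open>y\<close>.\<close>
    obtain y where y: "y \<in> d" using DK.D_facts(2)[OF e(1)] by blast
    have yS: "y \<in> S" using y DK.D_facts(6)[OF e(1)] K(2) by blast
    have "R.M.cls ` e \<subseteq> R.M.cls ` (S \<inter> f -` {y})"
    proof (rule image_subsetI)
      fix x assume x: "x \<in> e"
      have xK: "x \<in> ?K" using x eK by blast
      have "f ` R.M.cls x = d" by (rule onto[OF R.M.cls_in(1)[OF xK] cls_e[OF x] e])
      then obtain x' where x': "x' \<in> R.M.cls x" "f x' = y" using y by blast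
      have "x' \<in> S" using x'(1) cls_e[OF x] eK by blast
      moreover have "R.M.cls x' = R.M.cls x" using R.M.cls_eq[OF R.M.cls_in(1)[OF xK] x'(1)] .
      ultimately show "R.M.cls x \<in> R.M.cls ` (S \<inter> f -` {y})" using x'(2) by (metis IntI image_eqI singletonI vimageI)
    qed
    then have fin: "finite (R.M.cls ` e)" using finite_fibre[OF yS] by (meson finite_imageI finite_subset)
    obtain x where x: "x \<in> e" using E.D_facts(2)[OF eE] by blast
    have "e \<subseteq> R.M.cls x"
    proof
      fix z assume z: "z \<in> e"
      have "R.M.cls z = R.M.cls x"
        by (rule R.M.cls_constant_if_finite[OF in_components_connected[OF e(2)] eK fin z x])
      then show "z \<in> R.M.cls x" using R.M.cls_in(2)[of z] z eK by blast
    qed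
    then have "e = R.M.cls x" using cls_e[OF x] by blast
    then show ?thesis using R.M.cls_in(1)[of x] x eK by blast
  qed
  show "?E = DfK"
  proof
    show "?E \<subseteq> DfK" using E_sub by blast
    show "DfK \<subseteq> ?E"
    proof
      fix d' assume d': "d' \<in> DfK"
      obtain d e where e: "d \<in> DK" "e \<in> components (S \<inter> f -` d)" "d' \<subseteq> e" using sub_E[OF d'] by blast
      obtain x where x: "x \<in> d'" using R.M.D_facts(2)[OF d'] by blast
      have "d' = e" using R.M.D_eqI[OF d' E_sub[OF e(1,2)] x] x e(3) by blast
      then show "d' \<in> ?E" using e(1,2) by blast
    qed
  qed
qed

end

subsection \<open>Rational maps of the sphere\<close>

text \<open>\<open>proj a b\<close> is the point with homogeneous coordinates \<open>[a : b]\<close>, and \<open>flip\<close> is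
  inversion \<open>w \<mapsto> 1 / w\<close> in the stereographic coordinate.\<close>

definition proj :: "complex \<Rightarrow> complex \<Rightarrow> complex \<times> real" where
  "proj a b = (of_real (2 / ((cmod a)\<^sup>2 + (cmod b)\<^sup>2)) * (a * cnj b),
               ((cmod a)\<^sup>2 - (cmod b)\<^sup>2) / ((cmod a)\<^sup>2 + (cmod b)\<^sup>2))"

definition flip :: "complex \<times> real \<Rightarrow> complex \<times> real" where
  "flip x = (cnj (fst x), - snd x)"

lemma cmod_sq_sum_pos: "a \<noteq> 0 \<or> b \<noteq> 0 \<Longrightarrow> (cmod a)\<^sup>2 + (cmod b)\<^sup>2 > 0"
  by (auto simp: add_pos_nonneg add_nonneg_pos)

lemma flip_flip [simp]: "flip (flip x) = x"
  by (simp add: flip_def)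

lemma flip_rsphere: "flip x \<in> rsphere \<longleftrightarrow> x \<in> rsphere"
  by (cases x) (simp add: flip_def rsphere_def)

lemma continuous_flip: "continuous_on A flip"
  unfolding flip_def by (intro continuous_intros)

lemma flip_image: "flip ` A = flip -` A"
proof
  show "flip ` A \<subseteq> flip -` A" by (rule image_subsetI) simp
  show "flip -` A \<subseteq> flip ` A"
  proof
    fix x assume "x \<in> flip -` A"
    then show "x \<in> flip ` A" using image_eqI[of x flip "flip x" A] by simp
  qed
qed

lemma openin_flip:
  assumes "openin (top_of_set rsphere) U"
  shows "openin (top_of_set rsphere) (flip ` U)"
proof -
  obtain G where G: "open G" "U = rsphere \<inter> G" using assms by (auto simp: openin_open)
  have "open (flip -` G)" using continuous_flip[of UNIV] G(1) by (simp add: continuous_on_open_vimage)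
  moreover have "flip ` U = rsphere \<inter> flip -` G" unfolding flip_image G(2) by (rule set_eqI) (simp add: flip_rsphere)
  ultimately show ?thesis by (simp add: openin_open_Int)
qed

lemma flip_proj: "flip (proj a b) = proj b a"
  by (simp add: flip_def proj_def add.commute mult.commute minus_divide_left)

lemma proj_scale:
  assumes "k \<noteq> 0"
  shows "proj (k * a) (k * b) = proj a b"
proof -
  define K where "K = (cmod k)\<^sup>2"
  have K: "K > 0" using assms by (simp add: K_def)
  have kk: "k * cnj k = of_real K" unfolding K_def by (metis complex_norm_square of_real_power)
  have n: "(cmod (k * x))\<^sup>2 = K * (cmod x)\<^sup>2" for x by (simp add: K_def norm_mult power_mult_distrib)
  have s: "K * (cmod a)\<^sup>2 + K * (cmod b)\<^sup>2 = K * ((cmod a)\<^sup>2 + (cmod b)\<^sup>2)"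
    "K * (cmod a)\<^sup>2 - K * (cmod b)\<^sup>2 = K * ((cmod a)\<^sup>2 - (cmod b)\<^sup>2)" by (simp_all add: algebra_simps)
  have "k * a * cnj (k * b) = (k * cnj k) * (a * cnj b)" by simp
  then have kab: "k * a * cnj (k * b) = of_real K * (a * cnj b)" using kk by simp
  define D where "D = (cmod a)\<^sup>2 + (cmod b)\<^sup>2"
  have "of_real (2 / (K * D)) * (of_real K * (a * cnj b)) = of_real (2 / (K * D) * K) * (a * cnj b)" by simp
  also have "2 / (K * D) * K = 2 / D" using K by simp
  finally have fst: "of_real (2 / (K * D)) * (of_real K * (a * cnj b)) = of_real (2 / D) * (a * cnj b)" .
  have snd: "(K * x) / (K * D) = x / D" for x using K by simp
  show ?thesis unfolding proj_def n s kab D_def[symmetric] fst snd ..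
qed

lemma stereo_proj: "stereo w = proj w 1"
  by (simp add: stereo_def proj_def add.commute)

lemma proj_eq_stereo: "b \<noteq> 0 \<Longrightarrow> proj a b = stereo (a / b)"
  using proj_scale[of b "a / b" 1] by (simp add: stereo_proj)

lemma proj_eq_north: "a \<noteq> 0 \<Longrightarrow> proj a 0 = north"
  by (simp add: proj_def north_def)

lemma proj_rsphere:
  assumes "a \<noteq> 0 \<or> b \<noteq> 0"
  shows "proj a b \<in> rsphere"
proof -
  define A where "A = (cmod a)\<^sup>2"
  define B where "B = (cmod b)\<^sup>2"
  have AB: "A + B > 0" using cmod_sq_sum_pos[OF assms] by (simp add: A_def B_def)
  have "cmod (of_real (2 / (A + B)) * (a * cnj b)) = 2 / (A + B) * (cmod a * cmod b)"
    using AB by (simp add: norm_mult norm_divide flip: of_real_add)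
  then have "(cmod (of_real (2 / (A + B)) * (a * cnj b)))\<^sup>2 = 4 * (A * B) / (A + B)\<^sup>2"
    by (simp add: A_def B_def power_mult_distrib power_divide)
  moreover have "((A - B) / (A + B))\<^sup>2 = (A - B)\<^sup>2 / (A + B)\<^sup>2" by (simp add: power_divide)
  moreover have "4 * (A * B) / (A + B)\<^sup>2 + (A - B)\<^sup>2 / (A + B)\<^sup>2 = 1"
  proof -
    have "4 * (A * B) + (A - B)\<^sup>2 = (A + B)\<^sup>2" by (simp add: algebra_simps power2_eq_square)
    then show ?thesis using AB by (simp only: add_divide_distrib[symmetric]) simp
  qed
  ultimately show ?thesis unfolding rsphere_def proj_def A_def B_def by simp
qed

lemma continuous_proj:
  assumes "continuous_on A P" "continuous_on A Q" "\<And>w. w \<in> A \<Longrightarrow> P w \<noteq> 0 \<or> Q w \<noteq> 0"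
  shows "continuous_on A (\<lambda>w. proj (P w) (Q w))"
proof -
  have "\<forall>w\<in>A. (cmod (P w))\<^sup>2 + (cmod (Q w))\<^sup>2 \<noteq> 0"
    using cmod_sq_sum_pos assms(3) by (metis less_irrefl)
  then show ?thesis unfolding proj_def by (intro continuous_intros assms(1,2))
qed

section \<open>The stereographic chart\<close>

lemma stereo_rsphere: "stereo w \<in> rsphere"
  unfolding stereo_proj by (rule proj_rsphere) simp

lemma stereo_neq_north: "stereo w \<noteq> north"
proof -
  have "((cmod w)\<^sup>2 - 1) / ((cmod w)\<^sup>2 + 1) \<noteq> 1"
    using cmod_sq_sum_pos[of 1 w] by (simp add: field_simps)
  then show ?thesis unfolding stereo_def north_def by simp
qed

lemma continuous_stereo: "continuous_on A stereo"
  unfolding stereo_proj by (rule continuous_proj) (auto intro: continuous_intros)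

lemma unstereo_stereo: "unstereo (stereo w) = w"
proof -
  define A where "A = (cmod w)\<^sup>2 + 1"
  have A: "A > 0" unfolding A_def by (simp add: add_nonneg_pos)
  have "1 - ((cmod w)\<^sup>2 - 1) / A = 2 / A" using A by (simp add: field_simps A_def)
  then have "unstereo (stereo w) = of_real (2 / A) * w / of_real (2 / A)"
    unfolding unstereo_def stereo_def A_def by (simp add: add.commute)
  then show ?thesis using A by simp
qed

lemma snd_neq_1: "x \<in> rsphere - {north} \<Longrightarrow> snd x \<noteq> 1"
  by (cases x) (auto simp: rsphere_def north_def)

lemma stereo_unstereo:
  assumes "x \<in> rsphere - {north}"
  shows "stereo (unstereo x) = x"
proof -
  obtain z t where x: "x = (z, t)" by (cases x)
  have t: "1 - t \<noteq> 0" using snd_neq_1[OF assms] x by simp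
  have zt: "(cmod z)\<^sup>2 = (1 - t) * (1 + t)" using assms unfolding x rsphere_def by (simp add: algebra_simps power2_eq_square)
  have "(cmod (z / of_real (1 - t)))\<^sup>2 = (cmod z)\<^sup>2 / (1 - t)\<^sup>2"
    by (simp only: norm_divide norm_of_real power_divide power2_abs)
  also have "\<dots> = (1 + t) / (1 - t)" unfolding zt using t by (simp add: power2_eq_square)
  finally have w: "(cmod (z / of_real (1 - t)))\<^sup>2 = (1 + t) / (1 - t)" .
  have s: "1 + (1 + t) / (1 - t) = 2 / (1 - t)" "(1 + t) / (1 - t) + 1 = 2 / (1 - t)"
    "(1 + t) / (1 - t) - 1 = 2 * t / (1 - t)" using t by (simp_all add: field_simps)
  have "of_real (2 / (2 / (1 - t))) * (z / of_real (1 - t)) = of_real (1 - t) * (z / of_real (1 - t))"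
    by simp
  also have "\<dots> = z" using t by (metis nonzero_mult_div_cancel_left of_real_eq_0_iff times_divide_eq_right)
  finally have fst: "of_real (2 / (2 / (1 - t))) * (z / of_real (1 - t)) = z" .
  have snd: "2 * t / (1 - t) / (2 / (1 - t)) = t" using t by simp
  show ?thesis
    unfolding x unstereo_def stereo_def fst_conv snd_conv w s fst snd ..
qed

lemma continuous_unstereo: "continuous_on (rsphere - {north}) unstereo"
  unfolding unstereo_def using snd_neq_1 by (intro continuous_intros) force

lemma openin_rsphere_north: "openin (top_of_set rsphere) (rsphere - {north})"
  unfolding Diff_eq by (rule openin_open_Int) auto

lemma openin_stereo:
  assumes "open U"
  shows "openin (top_of_set rsphere) (stereo ` U)"
proof -
  have "stereo ` U = (rsphere - {north}) \<inter> unstereo -` U"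
  proof
    show "stereo ` U \<subseteq> (rsphere - {north}) \<inter> unstereo -` U"
      by (rule image_subsetI) (simp add: stereo_rsphere stereo_neq_north unstereo_stereo)
    show "(rsphere - {north}) \<inter> unstereo -` U \<subseteq> stereo ` U"
    proof
      fix x assume "x \<in> (rsphere - {north}) \<inter> unstereo -` U"
      then show "x \<in> stereo ` U" using image_eqI[of x stereo "unstereo x" U] stereo_unstereo by simp
    qed
  qed
  moreover have "openin (top_of_set (rsphere - {north})) ((rsphere - {north}) \<inter> unstereo -` U)"
    using continuous_openin_preimage_gen[OF continuous_unstereo assms] .
  ultimately show ?thesis using openin_trans openin_rsphere_north by metis
qed

text \<open>Away from the zeros of \<open>Q\<close> this is the open mapping theorem for
  \<open>P / Q\<close> followed by the open embedding \<open>stereo\<close>. At a zero of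
  \<open>Q\<close> the two polynomials are exchanged, which amounts to composing with
  \<open>flip\<close>; the conditions on proportionality keep both quotients from being
  constant.\<close>

lemma openin_proj_polys:
  assumes PQ: "\<And>w. poly P w \<noteq> 0 \<or> poly Q w \<noteq> 0" "\<And>c. P \<noteq> smult c Q" "\<And>c. Q \<noteq> smult c P" and U: "open U"
  shows "openin (top_of_set rsphere) ((\<lambda>w. proj (poly P w) (poly Q w)) ` U)"
proof -
  have key: "\<exists>T. openin (top_of_set rsphere) T \<and> proj (poly P w) (poly Q w) \<in> T \<and> T \<subseteq> (\<lambda>w. proj (poly P w) (poly Q w)) ` U"
    if w: "w \<in> U" "poly Q w \<noteq> 0" and nc: "\<And>c. P \<noteq> smult c Q" for P Q w
  proof -
    have "open (U \<inter> {w. poly Q w \<noteq> 0})"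
      by (intro open_Int U open_Collect_neq continuous_intros)
    then obtain e where e: "e > 0" "ball w e \<subseteq> U \<inter> {w. poly Q w \<noteq> 0}"
      using w openE[of "U \<inter> {w. poly Q w \<noteq> 0}" w] by blast
    let ?h = "\<lambda>z. poly P z / poly Q z"
    have "?h holomorphic_on ball w e" using e(2) by (intro holomorphic_intros) auto
    moreover have "\<not> ?h constant_on ball w e"
    proof
      assume "?h constant_on ball w e"
      then obtain c where c: "\<And>z. z \<in> ball w e \<Longrightarrow> poly P z / poly Q z = c" unfolding constant_on_def by blast
      have "poly (P - smult c Q) z = 0" if "z \<in> ball w e" for z
        using c[OF that] e(2) that by (auto simp: field_simps)
      then have "ball w e \<subseteq> {z. poly (P - smult c Q) z = 0}" by blast
      moreover have "infinite (ball w e)" using uncountable_ball[OF e(1)] countable_finite by blast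
      ultimately have "P - smult c Q = 0" using poly_roots_finite finite_subset by blast
      then show False using nc[of c] by simp
    qed
    ultimately have "open (?h ` ball w e)"
      by (intro open_mapping_thm[of ?h "ball w e"]) auto
    then have "openin (top_of_set rsphere) (stereo ` ?h ` ball w e)" by (rule openin_stereo)
    moreover have eq: "proj (poly P z) (poly Q z) = stereo (?h z)" if "z \<in> ball w e" for z
      using e(2) that by (intro proj_eq_stereo) auto
    then have "stereo ` ?h ` ball w e \<subseteq> (\<lambda>w. proj (poly P w) (poly Q w)) ` U"
      using e(2) by (force simp: image_iff)
    moreover have "proj (poly P w) (poly Q w) \<in> stereo ` ?h ` ball w e"
      using eq[of w] e(1) by auto
    ultimately show ?thesis by blast
  qed
  show ?thesis
  proof (subst openin_subopen, intro ballI)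
    fix x assume "x \<in> (\<lambda>w. proj (poly P w) (poly Q w)) ` U"
    then obtain w where w: "w \<in> U" "x = proj (poly P w) (poly Q w)" by blast
    show "\<exists>T. openin (top_of_set rsphere) T \<and> x \<in> T \<and> T \<subseteq> (\<lambda>w. proj (poly P w) (poly Q w)) ` U"
    proof (cases "poly Q w = 0")
      case False
      then show ?thesis using key[OF w(1) False PQ(2)] w(2) by blast
    next
      case True
      then have "poly P w \<noteq> 0" using PQ(1)[of w] by blast
      from key[OF w(1) this PQ(3)]
      obtain T where T: "openin (top_of_set rsphere) T" "proj (poly Q w) (poly P w) \<in> T"
        "T \<subseteq> (\<lambda>w. proj (poly Q w) (poly P w)) ` U" by blast
      have "flip ` T \<subseteq> (\<lambda>w. proj (poly P w) (poly Q w)) ` U"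
        using T(3) flip_proj by (force simp: image_iff)
      moreover have "x \<in> flip ` T" using T(2) w(2) flip_proj by (metis imageI)
      ultimately show ?thesis using openin_flip[OF T(1)] by blast
    qed
  qed
qed

text \<open>Homogeneous coordinates absorb the cases of \<open>rat_map\<close>. In the chart
  \<open>stereo\<close> the map is \<open>[p : q]\<close>; in the chart centred at
  \<open>north\<close>, obtained by \<open>flip\<close>, it is \<open>[P : Q]\<close> with reversed
  polynomials. The two charts cover the sphere, and continuity and openness are read off in
  each.\<close>

lemma rational_map_finite_open_map:
  assumes "rational_map f"
  obtains N where "finite_open_map rsphere f N"
proof -
  obtain p q where q0: "q \<noteq> 0" and cop: "coprime p q" and deg: "degree p \<ge> 1 \<or> degree q \<ge> 1"
    and f: "\<And>x. x \<in> rsphere \<Longrightarrow> f x = rat_map p q x"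
    using assms unfolding rational_map_def by blast
  have pq: "poly p w \<noteq> 0 \<or> poly q w \<noteq> 0" for w using coprime_poly_0[OF cop] .
  have ncp: "p \<noteq> smult c q" for c
  proof
    assume "p = smult c q"
    then have "q dvd p" by (simp add: dvd_smult)
    then have "is_unit q" using coprime_common_divisor[OF cop _ dvd_refl] by simp
    then have "degree q = 0" using is_unit_iff_degree[OF q0] by simp
    moreover have "degree p \<le> degree q" unfolding \<open>p = smult c q\<close> by (rule degree_smult_le)
    ultimately show False using deg by linarith
  qed
  have ncq: "q \<noteq> smult c p" for c
  proof
    assume q: "q = smult c p"
    then have "p dvd q" by (simp add: dvd_smult)
    then have "is_unit p" using coprime_common_divisor[OF cop dvd_refl] by simp
    moreover have "p \<noteq> 0" using q q0 by auto
    ultimately have "degree p = 0" using is_unit_iff_degree[of p] by simp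
    moreover have "degree q \<le> degree p" unfolding q by (rule degree_smult_le)
    ultimately show False using deg by linarith
  qed
  define n where "n = max (degree p) (degree q)"
  \<comment> \<open>For nonzero \<open>u\<close> the values are
    \<open>u ^ n * poly p (1 / u)\<close> and the same with \<open>q\<close>; padding both to the
    common degree \<open>n\<close> preserves the ratio. At 0 they are the coefficients of degree
    \<open>n\<close>, which reproduces the three cases of \<open>rat_map\<close> at
    \<open>north\<close>.\<close>
  define P where "P = reflect_poly p * monom 1 (n - degree p)"
  define Q where "Q = reflect_poly q * monom 1 (n - degree q)"
  have rev: "poly (reflect_poly g * monom 1 (n - degree g)) u = u ^ n * poly g (1 / u)"
    if "u \<noteq> 0" "degree g \<le> n" for g and u :: complex
  proof -
    have "u ^ degree g * u ^ (n - degree g) = u ^ n" using that(2) by (simp flip: power_add)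
    then show ?thesis using that(1)
      by (simp add: poly_reflect_poly_nz poly_monom inverse_eq_divide mult.commute mult.left_commute)
  qed
  have dn: "degree p \<le> n" "degree q \<le> n" unfolding n_def by auto
  have PQnz: "poly P u = u ^ n * poly p (1 / u)" "poly Q u = u ^ n * poly q (1 / u)" if "u \<noteq> 0" for u
    unfolding P_def Q_def using rev[OF that] dn by auto
  have PQ0: "poly P 0 = (if degree p = n then lead_coeff p else 0)" "poly Q 0 = (if degree q = n then lead_coeff q else 0)"
    unfolding P_def Q_def using dn by (auto simp: poly_monom power_0_left)
  \<comment> \<open>The zero polynomial has degree 0, whereas \<open>n \<ge> 1\<close> by the
    hypothesis on the degrees.\<close>
  have p0: "p \<noteq> 0" if "degree p = n" using that deg unfolding n_def by auto
  have PQ: "poly P u \<noteq> 0 \<or> poly Q u \<noteq> 0" for u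
  proof (cases "u = 0")
    case True
    have "degree p = n \<or> degree q = n" unfolding n_def by auto
    then show ?thesis unfolding True PQ0 using p0 q0 by auto
  next
    case False
    then show ?thesis using PQnz[OF False] pq[of "1 / u"] by simp
  qed
  \<comment> \<open>A proportion between the reversed polynomials is one between \<open>p\<close>
    and \<open>q\<close> at all nonzero points, hence identically.\<close>
  have eq_if: "g1 = smult c g2" if H: "\<And>u. u \<noteq> 0 \<Longrightarrow> u ^ n * poly g1 (1 / u) = c * (u ^ n * poly g2 (1 / u))" for g1 g2 :: "complex poly" and c
  proof -
    have "poly (g1 - smult c g2) w = 0" if "w \<noteq> 0" for w
    proof -
      have "(1 / w) ^ n * poly g1 w = (1 / w) ^ n * (c * poly g2 w)" using H[of "1 / w"] that by (simp add: mult.left_commute)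
      then show ?thesis using that by simp
    qed
    then have "- {0} \<subseteq> {w. poly (g1 - smult c g2) w = 0}" by blast
    moreover have "infinite (- {0::complex})" by (metis Compl_eq_Diff_UNIV finite.emptyI finite_insert infinite_UNIV_char_0 infinite_remove)
    ultimately have "g1 - smult c g2 = 0" using poly_roots_finite finite_subset by blast
    then show ?thesis by simp
  qed
  have ncP: "P \<noteq> smult c Q" for c
  proof
    assume "P = smult c Q"
    then have "p = smult c q" by (intro eq_if) (metis PQnz poly_smult)
    then show False using ncp by blast
  qed
  have ncQ: "Q \<noteq> smult c P" for c
  proof
    assume "Q = smult c P"
    then have "q = smult c p" by (intro eq_if) (metis PQnz poly_smult)
    then show False using ncq by blast
  qed
  let ?g = "\<lambda>w. proj (poly p w) (poly q w)" and ?h = "\<lambda>u. proj (poly P u) (poly Q u)"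
  have fg: "f (stereo w) = ?g w" for w
  proof -
    have "f (stereo w) = rat_map p q (stereo w)" using f stereo_rsphere by blast
    also have "\<dots> = ?g w"
      unfolding rat_map_def using stereo_neq_north[of w] pq[of w]
      by (auto simp: unstereo_stereo Let_def proj_eq_north proj_eq_stereo)
    finally show ?thesis .
  qed
  have flip0: "flip (stereo 0) = north" by (simp add: flip_def stereo_def north_def)
  have flip_inv: "flip (stereo u) = stereo (1 / u)" if "u \<noteq> 0" for u
    unfolding stereo_proj[of u] flip_proj using that by (simp add: proj_eq_stereo)
  have fh: "f (flip (stereo u)) = ?h u" for u
  proof (cases "u = 0")
    case True
    have nr: "north \<in> rsphere" by (simp add: north_def rsphere_def)
    have "f (flip (stereo u)) = rat_map p q north" unfolding True flip0 using f nr by blast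
    also have "\<dots> = ?h 0"
      unfolding rat_map_def PQ0 n_def using p0 q0 n_def
      by (auto simp: proj_eq_north proj_eq_stereo max_def)
    finally show ?thesis using True by simp
  next
    case False
    have "f (flip (stereo u)) = ?g (1 / u)" unfolding flip_inv[OF False] fg ..
    also have "\<dots> = ?h u" unfolding PQnz[OF False] using False by (simp add: proj_scale)
    finally show ?thesis .
  qed
  have cg: "continuous_on UNIV ?g" and ch: "continuous_on UNIV ?h"
    using pq PQ by (intro continuous_proj continuous_intros; blast)+
  let ?T1 = "rsphere - {north}" let ?T2 = "flip ` (rsphere - {north})"
  have flr: "flip ` rsphere = rsphere" unfolding flip_image using flip_rsphere by blast
  have T2: "?T2 \<subseteq> rsphere" using flr by blast
  have cover: "?T1 \<union> ?T2 = rsphere"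
  proof -
    have "north = flip (stereo 0)" using flip0 by simp
    then have "north \<in> ?T2" using stereo_rsphere stereo_neq_north by blast
    then show ?thesis using T2 by blast
  qed
  have "finite_open_map rsphere f (n + 1)"
  proof (intro finite_open_map.intro finite_open_map_axioms.intro)
    show "topological_sphere rsphere" by (rule rsphere.topological_sphere_axioms)
    have "continuous_on ?T1 (\<lambda>x. ?g (unstereo x))"
      using continuous_on_compose2[OF cg continuous_unstereo] by simp
    then have c1: "continuous_on ?T1 f"
      by (rule continuous_on_eq) (metis fg stereo_unstereo)
    have "continuous_on ?T2 (\<lambda>x. ?h (unstereo (flip x)))"
    proof (rule continuous_on_compose2[OF ch])
      show "continuous_on ?T2 (\<lambda>x. unstereo (flip x))"
        by (rule continuous_on_compose2[OF continuous_unstereo continuous_flip]) auto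
    qed simp
    then have c2: "continuous_on ?T2 f"
    proof (rule continuous_on_eq)
      fix x assume "x \<in> ?T2"
      then obtain z where z: "z \<in> ?T1" "x = flip z" by blast
      show "?h (unstereo (flip x)) = f x" using fh[of "unstereo z"] stereo_unstereo[OF z(1)] z(2) by simp
    qed
    have "continuous_on (?T1 \<union> ?T2) f"
    proof (rule continuous_on_Un_local_open[OF _ _ c1 c2])
      show "openin (top_of_set (?T1 \<union> ?T2)) ?T1" unfolding cover by (rule openin_rsphere_north)
      show "openin (top_of_set (?T1 \<union> ?T2)) ?T2" unfolding cover by (rule openin_flip[OF openin_rsphere_north])
    qed
    then show "continuous_on rsphere f" unfolding cover .
    have fr: "f x \<in> rsphere" if "x \<in> rsphere" for x
    proof (cases "x = north")
      case True
      then show ?thesis using fh[of 0] flip0 PQ by (simp add: proj_rsphere)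
    next
      case False
      then show ?thesis using fg[of "unstereo x"] stereo_unstereo[of x] that pq by (simp add: proj_rsphere)
    qed
    then show "f ` rsphere \<subseteq> rsphere" by blast
    show "openin (top_of_set rsphere) (f ` U)" if U: "openin (top_of_set rsphere) U" for U
    proof -
      obtain G where G: "open G" "U = rsphere \<inter> G" using U by (auto simp: openin_open)
      have o1: "open (stereo -` G)" using continuous_stereo[of UNIV] G(1) by (simp add: continuous_on_open_vimage)
      have "continuous_on UNIV (\<lambda>u. flip (stereo u))"
        by (rule continuous_on_compose2[OF continuous_flip continuous_stereo]) auto
      then have o2: "open ((\<lambda>u. flip (stereo u)) -` G)" using G(1) by (simp add: continuous_on_open_vimage)
      have "f ` U = ?g ` (stereo -` G) \<union> ?h ` ((\<lambda>u. flip (stereo u)) -` G)"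
      proof
        show "f ` U \<subseteq> ?g ` (stereo -` G) \<union> ?h ` ((\<lambda>u. flip (stereo u)) -` G)"
        proof (rule image_subsetI)
          fix x assume x: "x \<in> U"
          show "f x \<in> ?g ` (stereo -` G) \<union> ?h ` ((\<lambda>u. flip (stereo u)) -` G)"
          proof (cases "x = north")
            case True
            then have "f x = ?h 0" "0 \<in> (\<lambda>u. flip (stereo u)) -` G" using fh[of 0] flip0 x G(2) by auto
            then show ?thesis by blast
          next
            case False
            then have "stereo (unstereo x) = x" using x G(2) by (intro stereo_unstereo) auto
            then have "f x = ?g (unstereo x)" "unstereo x \<in> stereo -` G" using fg[of "unstereo x"] x G(2) by auto
            then show ?thesis by blast
          qed
        qed
        have "?g w \<in> f ` U" if "stereo w \<in> G" for w
          using fg[of w] that stereo_rsphere[of w] G(2) by (metis IntI imageI)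
        moreover have "?h u \<in> f ` U" if "flip (stereo u) \<in> G" for u
          using fh[of u] that stereo_rsphere[of u] flip_rsphere G(2) by (metis IntI imageI)
        ultimately show "?g ` (stereo -` G) \<union> ?h ` ((\<lambda>u. flip (stereo u)) -` G) \<subseteq> f ` U" by blast
      qed
      then show ?thesis
        using openin_proj_polys[OF pq ncp ncq o1] openin_proj_polys[OF PQ ncP ncQ o2] by (simp add: openin_Un)
    qed
    have fib: "finite (rsphere \<inter> f -` {y}) \<and> card (rsphere \<inter> f -` {y}) \<le> n + 1" if y: "y \<in> rsphere" for y
    proof -
      \<comment> \<open>The polynomial is \<open>q\<close> over \<open>north\<close> and
        \<open>p - smult c q\<close> over \<open>stereo c\<close>. Its at most \<open>n\<close>
        roots account for the finite points of the fibre; the summand 1 in \<open>n + 1\<close>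
        allows for \<open>north\<close>.\<close>
      have "\<exists>g. g \<noteq> 0 \<and> degree g \<le> n \<and> (\<forall>w. ?g w = y \<longrightarrow> poly g w = 0)"
      proof (cases "y = north")
        case True
        have "poly q w = 0" if "?g w = y" for w
          using that True proj_eq_stereo[of "poly q w" "poly p w"] stereo_neq_north by metis
        then show ?thesis using q0 dn by blast
      next
        case False
        then obtain c where c: "y = stereo c" using y stereo_unstereo by (metis DiffI singletonD)
        have "poly (p - smult c q) w = 0" if gw: "?g w = y" for w
        proof (cases "poly q w = 0")
          case True
          then have "?g w = north" using pq[of w] proj_eq_north by auto
          then show ?thesis using gw False by simp
        next
          case nz: False
          then have "stereo (poly p w / poly q w) = stereo c" using gw c proj_eq_stereo by simp
          then have "poly p w / poly q w = c" by (metis unstereo_stereo)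
          then show ?thesis using nz by (simp add: field_simps)
        qed
        moreover have "p - smult c q \<noteq> 0" using ncp[of c] by simp
        moreover have "degree (p - smult c q) \<le> n"
          using dn degree_smult_le[of c q] by (intro degree_diff_le) auto
        ultimately show ?thesis by blast
      qed
      then obtain g where g: "g \<noteq> 0" "degree g \<le> n" "\<And>w. ?g w = y \<Longrightarrow> poly g w = 0" by blast
      let ?R = "{w. poly g w = 0}"
      have sub: "rsphere \<inter> f -` {y} \<subseteq> insert north (stereo ` ?R)"
      proof
        fix x assume x: "x \<in> rsphere \<inter> f -` {y}"
        show "x \<in> insert north (stereo ` ?R)"
        proof (cases "x = north")
          case False
          then have xs: "stereo (unstereo x) = x" using x by (intro stereo_unstereo) auto
          then have "?g (unstereo x) = y" using fg[of "unstereo x"] x by simp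
          then show ?thesis using g(3) xs by (metis (mono_tags) imageI insertCI mem_Collect_eq)
        qed simp
      qed
      have finR: "finite ?R" using poly_roots_finite[OF g(1)] .
      have "card ?R \<le> n" using card_poly_roots_bound[OF g(1)] g(2) by simp
      then have "card (insert north (stereo ` ?R)) \<le> n + 1"
        using card_image_le[OF finR, of stereo] card_insert_le_m1[of "n + 1" "stereo ` ?R" north] by simp
      then show ?thesis using finR sub by (meson card_mono finite_imageI finite_insert finite_subset le_trans)
    qed
    show "finite (rsphere \<inter> f -` {y})" "card (rsphere \<inter> f -` {y}) \<le> n + 1" if "y \<in> rsphere" for y
      using fib[OF that] by auto
  qed
  then show thesis by (rule that)
qed

theorem theoremA:
  fixes K :: "(complex \<times> real) set"
    and f :: "complex \<times> real \<Rightarrow> complex \<times> real"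
    and DK DfK :: "(complex \<times> real) set set"
  assumes "K \<subseteq> rsphere" and "compact K"
    and "rational_map f"
    and "core_decomp_PS K DK"
    and "core_decomp_PS (rsphere \<inter> f -` K) DfK"
  shows "(\<forall>d\<in>DfK. f ` d \<in> DK) \<and>
         (\<Union>d\<in>DK. components (rsphere \<inter> f -` d)) = DfK"
proof -
  obtain N where "finite_open_map rsphere f N"
    by (rule rational_map_finite_open_map[OF assms(3)])
  then interpret finite_open_map rsphere f N .
  show ?thesis using core_decomp_PS_pre[OF assms(2,1,4,5)] by (rule conjI)
qed

end
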